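(* Suppose that $f_s:\mathbb{R}^{n\times n}\to\mathbb{R}$ satisfies the $\delta$-RIP$_{2r,2r}$ property with $\delta<1/3$. Given an arbitrary constant $\alpha>0$, there exists a positive constant $\lambda_1=\lambda_1(\delta,r,\sigma_r(M_s^* ),\|M_s^*\|_F,\alpha)$, depending only on the listed quantities, such that for every $\lambda\in(0,\lambda_1]$ the problem $$\min_{U\in\mathbb{R}^{n\times r}}\ h_s(U):=f_s(UU^T)$$ satisfies the $(\alpha,\beta,\gamma)$-strict saddle property with $\beta:=\lambda$ and $\gamma:=2\lambda$.
   Context: $f_s$ is twice continuously differentiable, and (without loss of generality, by replacing $f_s(M)$ with $\frac12[f_s(M)+f_s(M^T)]$) $\nabla f_s(M)$ is assumed symmetric. Standing assumptions: $f_s$ has a first-order critical point $M_s^*$ (i.e. $\nabla f_s(M_s^* )=0$) that is symmetric, positive semidefinite and of rank at most $r$ (it is then the unique global minimizer of $f_s$ over symmetric positive semidefinite matrices of rank at most $r$), and in fact $\mathrm{rank}(M_s^* )=r$. $\delta$-RIP$_{2r,2r}$ (with $\delta\in[0,1)$): $(1-\delta)\|K\|_F^2\le[\nabla^2f_s(M)](K,K)\le(1+\delta)\|K\|_F^2$ for all $M,K\in\mathbb{R}^{n\times n}$ of rank at most $2r$. Strict saddle property: for an optimization problem $\min_{x\in\mathcal X}F(x)$ with set of global minima $\mathcal X^*$, the problem satisfies the $(\alpha,\beta,\gamma)$-strict saddle property ($\alpha,\beta,\gamma>0$) if for every $x\in\mathcal X$ at least one of the following holds: $\mathrm{dist}(x,\mathcal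 X^* )\le\alpha$; $\|\nabla F(x)\|_F\ge\beta$; $\lambda_{min}[\nabla^2F(x)]\le-\gamma$. Here the distance is the Frobenius distance in the factor space $\mathbb{R}^{n\times r}$. $\sigma_r(\cdot)$ is the $r$-th largest singular value; $\lambda_{min}$ is the minimal eigenvalue. *)

theory Defs
  imports
    "Jordan_Normal_Form.DL_Rank"
    "Jordan_Normal_Form.Char_Poly"
    "HOL-Library.Extended_Real"
begin

text \<open>
  Matrices are those of \<open>Jordan_Normal_Form.Matrix\<close>, so that the dimensions are natural numbers
  over which one can quantify inside a formula. A real function on the space of \<open>n\<close> by \<open>m\<close>
  matrices is a function on \<open>real mat\<close> of which only the values on \<open>carrier_mat n m\<close> matter.
\<close>

subsection \<open>Frobenius geometry, rank, singular values\<close>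

definition mat_inner :: "real mat \<Rightarrow> real mat \<Rightarrow> real" where
  "mat_inner A B = (\<Sum>i<dim_row A. \<Sum>j<dim_col A. A $$ (i, j) * B $$ (i, j))"

definition fro_norm :: "real mat \<Rightarrow> real" where
  "fro_norm A = sqrt (mat_inner A A)"

abbreviation mat_rank :: "real mat \<Rightarrow> nat" where
  "mat_rank A \<equiv> vec_space.rank (dim_row A) A"

definition symmetric_mat :: "real mat \<Rightarrow> bool" where
  "symmetric_mat A \<longleftrightarrow> A\<^sup>T = A"

definition psd_mat :: "nat \<Rightarrow> real mat \<Rightarrow> bool" where
  "psd_mat n A \<longleftrightarrow> A \<in> carrier_mat n n \<and> symmetric_mat A
     \<and> (\<forall>v \<in> carrier_vec n. 0 \<le> v \<bullet> (A *\<^sub>v v))"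

text \<open>
  Square roots of the eigenvalues of \<open>A\<^sup>T * A\<close>, with multiplicity, in decreasing order. The
  matrix has \<open>dim_col A\<close> real eigenvalues, hence so many singular values are listed. The \<open>k\<close>-th
  largest one is counted from \<open>k = 1\<close>.
\<close>

definition singular_values :: "real mat \<Rightarrow> real list" where
  "singular_values A =
     rev (sorted_list_of_multiset (image_mset sqrt (proots (char_poly (A\<^sup>T * A)))))"

definition singular_value :: "nat \<Rightarrow> real mat \<Rightarrow> real" where
  "singular_value k A = singular_values A ! (k - 1)"

subsection \<open>Differentiation on the space of \<open>n\<close> by \<open>m\<close> matrices\<close>

text \<open>
  Frechet derivatives with respect to the Frobenius norm. The gradient represents the first
  derivative through the inner product; the Hessian at \<open>X\<close> is the linear operator that is the
  derivative of the gradient map, so that the associated bilinear form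
  \<open>[\<nabla>\<^sup>2F(X)](K, L)\<close> is \<open>mat_inner (hessian n m F X K) L\<close>.
\<close>

definition has_gradient ::
    "nat \<Rightarrow> nat \<Rightarrow> (real mat \<Rightarrow> real) \<Rightarrow> real mat \<Rightarrow> real mat \<Rightarrow> bool" where
  "has_gradient n m F X G \<longleftrightarrow> G \<in> carrier_mat n m \<and>
     (\<forall>e>0. \<exists>d>0. \<forall>K \<in> carrier_mat n m. fro_norm K < d \<longrightarrow>
        \<bar>F (X + K) - F X - mat_inner G K\<bar> \<le> e * fro_norm K)"

definition gradient :: "nat \<Rightarrow> nat \<Rightarrow> (real mat \<Rightarrow> real) \<Rightarrow> real mat \<Rightarrow> real mat" where
  "gradient n m F X = (THE G. has_gradient n m F X G)"

definition linear_op :: "nat \<Rightarrow> nat \<Rightarrow> (real mat \<Rightarrow> real mat) \<Rightarrow> bool" where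
  "linear_op n m T \<longleftrightarrow>
     (\<forall>K \<in> carrier_mat n m. T K \<in> carrier_mat n m) \<and>
     (\<forall>K \<in> carrier_mat n m. \<forall>L \<in> carrier_mat n m. T (K + L) = T K + T L) \<and>
     (\<forall>c. \<forall>K \<in> carrier_mat n m. T (c \<cdot>\<^sub>m K) = c \<cdot>\<^sub>m T K)"

definition has_hessian ::
    "nat \<Rightarrow> nat \<Rightarrow> (real mat \<Rightarrow> real) \<Rightarrow> real mat \<Rightarrow> (real mat \<Rightarrow> real mat) \<Rightarrow> bool" where
  "has_hessian n m F X T \<longleftrightarrow> linear_op n m T \<and>
     (\<forall>e>0. \<exists>d>0. \<forall>K \<in> carrier_mat n m. fro_norm K < d \<longrightarrow>
        fro_norm (gradient n m F (X + K) - gradient n m F X - T K) \<le> e * fro_norm K)"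

text \<open>
  The operator is unique only on \<open>carrier_mat n m\<close>, hence \<open>SOME\<close>; all uses are on that carrier.
\<close>

definition hessian ::
    "nat \<Rightarrow> nat \<Rightarrow> (real mat \<Rightarrow> real) \<Rightarrow> real mat \<Rightarrow> real mat \<Rightarrow> real mat" where
  "hessian n m F X = (SOME T. has_hessian n m F X T)"

definition twice_cont_diff :: "nat \<Rightarrow> nat \<Rightarrow> (real mat \<Rightarrow> real) \<Rightarrow> bool" where
  "twice_cont_diff n m F \<longleftrightarrow>
     (\<forall>X \<in> carrier_mat n m. \<exists>G. has_gradient n m F X G) \<and>
     (\<forall>X \<in> carrier_mat n m. \<exists>T. has_hessian n m F X T) \<and>
     (\<forall>X \<in> carrier_mat n m. \<forall>e>0. \<exists>d>0. \<forall>Y \<in> carrier_mat n m. fro_norm (Y - X) < d \<longrightarrow>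
        (\<forall>K \<in> carrier_mat n m.
           fro_norm (hessian n m F Y K - hessian n m F X K) \<le> e * fro_norm K))"

subsection \<open>Restricted isometry and strict saddles\<close>

text \<open>The parameter \<open>k\<close> bounds the rank of both the point and the direction.\<close>

definition RIP :: "nat \<Rightarrow> nat \<Rightarrow> real \<Rightarrow> (real mat \<Rightarrow> real) \<Rightarrow> bool" where
  "RIP n k \<delta> f \<longleftrightarrow> (\<forall>M \<in> carrier_mat n n. \<forall>K \<in> carrier_mat n n.
     mat_rank M \<le> k \<and> mat_rank K \<le> k \<longrightarrow>
       (1 - \<delta>) * (fro_norm K)\<^sup>2 \<le> mat_inner (hessian n n f M K) K \<and>
       mat_inner (hessian n n f M K) K \<le> (1 + \<delta>) * (fro_norm K)\<^sup>2)"

text \<open>Minimal eigenvalue of a self-adjoint operator on the space of \<open>n\<close> by \<open>m\<close> matrices.\<close>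

definition lambda_min :: "nat \<Rightarrow> nat \<Rightarrow> (real mat \<Rightarrow> real mat) \<Rightarrow> real" where
  "lambda_min n m T =
     Min {c. \<exists>V \<in> carrier_mat n m. V \<noteq> 0\<^sub>m n m \<and> T V = c \<cdot>\<^sub>m V}"

definition global_minima :: "nat \<Rightarrow> nat \<Rightarrow> (real mat \<Rightarrow> real) \<Rightarrow> real mat set" where
  "global_minima n m F = {X \<in> carrier_mat n m. \<forall>Y \<in> carrier_mat n m. F X \<le> F Y}"

text \<open>Extended reals, so that the distance to the empty set is infinite.\<close>

definition set_dist :: "real mat \<Rightarrow> real mat set \<Rightarrow> ereal" where
  "set_dist X S = (INF Y \<in> S. ereal (fro_norm (X - Y)))"

definition strict_saddle ::
    "nat \<Rightarrow> nat \<Rightarrow> (real mat \<Rightarrow> real) \<Rightarrow> real \<Rightarrow> real \<Rightarrow> real \<Rightarrow> bool" where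
  "strict_saddle n m F \<alpha> \<beta> \<gamma> \<longleftrightarrow> 0 < \<alpha> \<and> 0 < \<beta> \<and> 0 < \<gamma> \<and>
     (\<forall>X \<in> carrier_mat n m.
        set_dist X (global_minima n m F) \<le> ereal \<alpha> \<or>
        \<beta> \<le> fro_norm (gradient n m F X) \<or>
        lambda_min n m (hessian n m F X) \<le> - \<gamma>)"

text \<open>
  The gradient is required to be symmetric only at symmetric points, which is what replacing
  \<open>f(M)\<close> by \<open>(f(M) + f(M\<^sup>T)) / 2\<close> achieves. Symmetry at every point would make the derivative of
  \<open>f\<close> vanish in all skew-symmetric directions, contradicting \<open>RIP\<close> as soon as \<open>n \<ge> 2\<close>.
\<close>

definition symmetric_gradient :: "nat \<Rightarrow> (real mat \<Rightarrow> real) \<Rightarrow> bool" where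
  "symmetric_gradient n f \<longleftrightarrow>
     (\<forall>M \<in> carrier_mat n n. symmetric_mat M \<longrightarrow> symmetric_mat (gradient n n f M))"

end

theory Submission
  imports Defs
begin

text \<open>
  Write \<open>M = U U\<^sup>T\<close> and \<open>M* = Z Z\<^sup>T\<close> with \<open>Z\<close> of size \<open>n\<close> by \<open>r\<close>, let \<open>G\<close> be the gradient of \<open>f\<close> at \<open>M\<close>
  and \<open>c\<close> the smallest eigenvalue of \<open>U\<^sup>T U\<close>, with unit eigenvector \<open>v\<close>. Restricted strong
  convexity along the segment from \<open>M*\<close> to \<open>M\<close>, whose points have rank at most \<open>2 r\<close>, gives
  \<open>(1 - \<delta>) |M - M*|\<^sup>2 \<le> \<langle>G, M - M*\<rangle>\<close>. The Hessian of the factored problem in a direction \<open>y v\<^sup>T\<close> with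
  \<open>U\<^sup>T y = 0\<close> shows \<open>- \<langle>G y, y\<rangle> \<le> ((1 + \<delta>) c + \<lambda>) |y|\<^sup>2\<close>. Decompose \<open>Z = U W + Y\<close> with \<open>U\<^sup>T Y = 0\<close>: a small
  gradient makes \<open>\<langle>G, M - M*\<rangle>\<close> equal to \<open>- \<langle>G Y, Y\<rangle>\<close> up to \<open>O(\<lambda>)\<close>, while \<open>2 c |Y|\<^sup>2 \<le> |M - M*|\<^sup>2\<close>. Therefore
  \<open>(1 - \<delta> - (1 + \<delta>) / 2) |M - M*|\<^sup>2 = O(\<lambda>)\<close>, and the factor is positive exactly when \<open>\<delta> < 1 / 3\<close>.
  Taking instead the columns of \<open>Z\<close> for \<open>y\<close> bounds \<open>|U|\<close> and keeps \<open>c\<close> away from \<open>0\<close>, so that all constants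
  are independent of \<open>n\<close> and \<open>f\<close>. Finally, decomposing \<open>U = Z W' + Y'\<close> and replacing \<open>W'\<close> by its polar
  factor \<open>R\<close> yields a global minimizer \<open>Z R\<close> close to \<open>U\<close>.
\<close>

subsection \<open>The Frobenius inner product\<close>

text \<open>The constant has to be fixed before \<open>n\<close>, \<open>f\<close>, the minimizer
  and \<open>U\<close> are known. So there is no compactness argument over points: every estimate is
  explicit, and traces are taken of \<open>r\<close> by \<open>r\<close> Gram matrices to keep
  \<open>n\<close> out.

  In a direction \<open>y v\<^sup>T\<close> the Hessian of \<open>f\<close> is tested on
  \<open>a y\<^sup>T + y a\<^sup>T\<close> with \<open>a = U v\<close>, whose squared norm is
  \<open>2 (|a|\<^sup>2 |y|\<^sup>2 + \<langle>a, y\<rangle>\<^sup>2)\<close>. The cross term can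
  double the cost; it disappears when \<open>y\<close> is orthogonal to the columns of
  \<open>U\<close>, which is the reason for splitting off \<open>Y\<close>. The price of the
  splitting is that \<open>W\<close> is controlled only by \<open>|Z| / sqrt c\<close>, so
  \<open>c\<close> must first be bounded below. There the doubled cost is harmless: a tiny
  \<open>c\<close> would force \<open>U U\<^sup>T\<close> so close to \<open>Z Z\<^sup>T\<close>
  that the smallest eigenvalue of \<open>U\<^sup>T U\<close> is at least half the singular value, a
  contradiction.

  A second obstacle is \<open>lambda_min\<close>, a \<open>Min\<close> over eigenvalues. It says
  something about the quadratic form only once the Hessian of the factored problem is computed,
  identified with the one picked by \<open>SOME\<close>, and shown to be self-adjoint.\<close>

declare minus_carrier_mat [simp]

lemma mat_minus_eq_0D:
  assumes "A \<in> carrier_mat n m" "B \<in> carrier_mat n m" "A - B = (0\<^sub>m n m :: real mat)"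
  shows "A = B"
proof (rule eq_matI)
  fix i j assume ij: "i < dim_row B" "j < dim_col B"
  have "(A - B) $$ (i,j) = 0" unfolding assms(3) using assms(1,2) ij by simp
  then show "A $$ (i,j) = B $$ (i,j)" using assms(1,2) ij by simp
qed (use assms in auto)

section \<open>Matrix algebra\<close>

lemma mat_mult_assoc:
  "dim_col A = dim_row B \<Longrightarrow> dim_col B = dim_row C \<Longrightarrow> A * B * C = A * (B * (C :: real mat))"
  by (rule assoc_mult_mat[of A "dim_row A" "dim_col A" B "dim_col B" C "dim_col C"]) auto

lemma mat_transpose_mult:
  "dim_col A = dim_row B \<Longrightarrow> (A * B)\<^sup>T = B\<^sup>T * (A :: real mat)\<^sup>T"
  by (rule transpose_mult[of A "dim_row A" "dim_col A" B "dim_col B"]) auto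

lemma mat_transpose_add:
  "dim_row A = dim_row B \<Longrightarrow> dim_col A = dim_col B \<Longrightarrow> (A + B)\<^sup>T = A\<^sup>T + (B :: real mat)\<^sup>T"
  by (intro eq_matI) auto

lemma mat_transpose_minus:
  "dim_row A = dim_row B \<Longrightarrow> dim_col A = dim_col B \<Longrightarrow> (A - B)\<^sup>T = A\<^sup>T - (B :: real mat)\<^sup>T"
  by (intro eq_matI) auto

lemma mat_transpose_smult: "(c \<cdot>\<^sub>m A)\<^sup>T = c \<cdot>\<^sub>m (A :: real mat)\<^sup>T"
  by (intro eq_matI) auto

lemma mat_add_mult:
  "dim_row A = dim_row B \<Longrightarrow> dim_col A = dim_col B \<Longrightarrow> dim_col A = dim_row C \<Longrightarrow>
    (A + B) * C = A * C + B * (C :: real mat)"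
  by (rule add_mult_distrib_mat[of A "dim_row A" "dim_col A" B C "dim_col C"]) auto

lemma mat_mult_add:
  "dim_row B = dim_row C \<Longrightarrow> dim_col B = dim_col C \<Longrightarrow> dim_col A = dim_row B \<Longrightarrow>
    A * (B + C) = A * B + A * (C :: real mat)"
  by (rule mult_add_distrib_mat[of A "dim_row A" "dim_col A" B "dim_col B" C]) auto

lemma mat_minus_mult:
  "dim_row A = dim_row B \<Longrightarrow> dim_col A = dim_col B \<Longrightarrow> dim_col A = dim_row C \<Longrightarrow>
    (A - B) * C = A * C - B * (C :: real mat)"
  by (rule minus_mult_distrib_mat[of A "dim_row A" "dim_col A" B C "dim_col C"]) auto

lemma mat_mult_minus:
  "dim_row B = dim_row C \<Longrightarrow> dim_col B = dim_col C \<Longrightarrow> dim_col A = dim_row B \<Longrightarrow>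
    A * (B - C) = A * B - A * (C :: real mat)"
  by (rule mult_minus_distrib_mat[of A "dim_row A" "dim_col A" B "dim_col B" C]) auto

lemma mat_smult_mult: "dim_col A = dim_row B \<Longrightarrow> (c \<cdot>\<^sub>m A) * B = c \<cdot>\<^sub>m (A * (B :: real mat))"
  by (rule mult_smult_assoc_mat[of A "dim_row A" "dim_col A" B "dim_col B"]) auto

lemma mat_mult_smult: "dim_col A = dim_row B \<Longrightarrow> A * (c \<cdot>\<^sub>m B) = c \<cdot>\<^sub>m (A * (B :: real mat))"
  by (rule mult_smult_distrib[of A "dim_row A" "dim_col A" B "dim_col B"]) auto

text \<open>The conditions of these rules compare \<open>dim_row\<close> and \<open>dim_col\<close>
  instead of naming carriers, so that rewriting leaves no dimension variable to be guessed.\<close>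

lemmas mat_expand = mat_mult_assoc mat_transpose_mult mat_transpose_add mat_transpose_minus
  mat_transpose_smult mat_add_mult mat_mult_add mat_minus_mult mat_mult_minus mat_smult_mult mat_mult_smult

section \<open>Bilinearity, adjoints and the Cauchy-Schwarz inequality\<close>

lemma mat_inner_add_left:
  "dim_row A = dim_row B \<Longrightarrow> dim_col A = dim_col B \<Longrightarrow>
    mat_inner (A + B) C = mat_inner A C + mat_inner B C"
  unfolding mat_inner_def by (simp add: sum.distrib distrib_right)

lemma mat_inner_add_right:
  "dim_row A = dim_row C \<Longrightarrow> dim_col A = dim_col C \<Longrightarrow>
    mat_inner A (B + C) = mat_inner A B + mat_inner A C"
  unfolding mat_inner_def by (simp add: sum.distrib distrib_left)

lemma mat_inner_minus_left:
  "dim_row A = dim_row B \<Longrightarrow> dim_col A = dim_col B \<Longrightarrow>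
    mat_inner (A - B) C = mat_inner A C - mat_inner B C"
  unfolding mat_inner_def by (simp add: sum_subtractf left_diff_distrib)

lemma mat_inner_minus_right:
  "dim_row A = dim_row C \<Longrightarrow> dim_col A = dim_col C \<Longrightarrow>
    mat_inner A (B - C) = mat_inner A B - mat_inner A C"
  unfolding mat_inner_def by (simp add: sum_subtractf right_diff_distrib)

lemma mat_inner_smult_left: "mat_inner (c \<cdot>\<^sub>m A) B = c * mat_inner A B"
  unfolding mat_inner_def by (simp add: sum_distrib_left mult.assoc)

lemma mat_inner_smult_right:
  "dim_row A = dim_row B \<Longrightarrow> dim_col A = dim_col B \<Longrightarrow> mat_inner A (c \<cdot>\<^sub>m B) = c * mat_inner A B"
  unfolding mat_inner_def by (simp add: sum_distrib_left mult.left_commute)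

lemma mat_inner_commute:
  "dim_row A = dim_row B \<Longrightarrow> dim_col A = dim_col B \<Longrightarrow> mat_inner A B = mat_inner B A"
  unfolding mat_inner_def by (simp add: mult.commute)

lemma mat_inner_transpose:
  "dim_row A = dim_row B \<Longrightarrow> dim_col A = dim_col B \<Longrightarrow> mat_inner A\<^sup>T B\<^sup>T = mat_inner A B"
  unfolding mat_inner_def by (simp add: sum.swap[of _ "{..<dim_row B}"])

lemma mat_inner_zero_left [simp]: "mat_inner (0\<^sub>m n m) A = 0"
  unfolding mat_inner_def by simp

lemma mat_inner_zero_right [simp]:
  "dim_row A = n \<Longrightarrow> dim_col A = m \<Longrightarrow> mat_inner A (0\<^sub>m n m) = 0"
  unfolding mat_inner_def by simp

lemma mat_inner_nonneg [simp]: "0 \<le> mat_inner A A"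
  unfolding mat_inner_def by (intro sum_nonneg) auto

text \<open>Both sides are the triple sum of \<open>A $$ (i,k) * C $$ (i,j) * B $$ (k,j)\<close>
  with the two inner sums exchanged. Together with the mirrored rule below it moves factors across
  the inner product everywhere later on.\<close>

lemma mat_inner_mult_left:
  assumes "dim_col A = dim_row B" "dim_row C = dim_row A" "dim_col C = dim_col B"
  shows "mat_inner (A * B) C = mat_inner A (C * B\<^sup>T)"
proof -
  have l: "(\<Sum>j<dim_col B. (A * B) $$ (i,j) * C $$ (i,j))
      = (\<Sum>j<dim_col B. \<Sum>k<dim_row B. A $$ (i,k) * (C $$ (i,j) * B $$ (k,j)))"
    if "i < dim_row A" for i
    using that assms
    by (intro sum.cong refl) (simp add: scalar_prod_def sum_distrib_right atLeast0LessThan mult.assoc mult.commute[of "B $$ _"])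
  have r: "(\<Sum>k<dim_row B. A $$ (i,k) * (C * B\<^sup>T) $$ (i,k))
      = (\<Sum>k<dim_row B. \<Sum>j<dim_col B. A $$ (i,k) * (C $$ (i,j) * B $$ (k,j)))"
    if "i < dim_row A" for i
    using that assms
    by (intro sum.cong refl) (simp add: scalar_prod_def sum_distrib_left atLeast0LessThan)
  have "(\<Sum>j<dim_col B. (A * B) $$ (i,j) * C $$ (i,j)) = (\<Sum>k<dim_row B. A $$ (i,k) * (C * B\<^sup>T) $$ (i,k))"
    if "i < dim_row A" for i
    unfolding l[OF that] r[OF that] by (rule sum.swap)
  then show ?thesis unfolding mat_inner_def using assms by simp
qed

lemma mat_inner_mult_right:
  assumes "dim_col A = dim_row B" "dim_row C = dim_row A" "dim_col C = dim_col B"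
  shows "mat_inner (A * B) C = mat_inner B (A\<^sup>T * C)"
proof -
  have "mat_inner (A * B) C = mat_inner (A * B)\<^sup>T C\<^sup>T"
    using assms by (intro mat_inner_transpose[symmetric]) auto
  also have "\<dots> = mat_inner (B\<^sup>T * A\<^sup>T) C\<^sup>T"
    using assms by (subst mat_transpose_mult) auto
  also have "\<dots> = mat_inner B\<^sup>T (C\<^sup>T * A)"
    using assms by (subst mat_inner_mult_left) auto
  also have "C\<^sup>T * A = (A\<^sup>T * C)\<^sup>T"
    using assms by (subst mat_transpose_mult) auto
  also have "mat_inner B\<^sup>T (A\<^sup>T * C)\<^sup>T = mat_inner B (A\<^sup>T * C)"
    using assms by (intro mat_inner_transpose) auto
  finally show ?thesis .
qed

text \<open>Kept free of matrices because it yields Cauchy-Schwarz twice: for the Frobenius inner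
  product and for the merely semidefinite form in the eigenvector lemma.\<close>

lemma discriminant_nonpos:
  fixes a b c :: real
  assumes "\<And>t. 0 \<le> a + 2 * t * b + t\<^sup>2 * c"
  shows "b\<^sup>2 \<le> a * c"
proof (cases "c = 0")
  case True
  have "b = 0"
  proof (rule ccontr)
    assume "b \<noteq> 0"
    \<comment> \<open>The affine function \<open>a + 2 t b\<close> is evaluated where it takes the
      value \<open>- 1\<close>.\<close>
    then have "a + 2 * (- (a + 1) / (2 * b)) * b = - 1" by (simp add: field_simps)
    with assms[of "- (a + 1) / (2 * b)"] True show False by simp
  qed
  with True show ?thesis by simp
next
  case False
  have c: "0 < c"
  proof (rule ccontr)
    assume "\<not> 0 < c"
    with False have c: "c < 0" by simp
    \<comment> \<open>Chosen so that \<open>t * \<bar>c\<bar> = \<bar>c\<bar> + \<bar>a\<bar> + 2 *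
      \<bar>b\<bar>\<close>: the negative quadratic term then outweighs the other two.\<close>
    define t where "t = 1 + \<bar>a / c\<bar> + 2 * \<bar>b / c\<bar>"
    have 1: "\<bar>a / c\<bar> * \<bar>c\<bar> = \<bar>a\<bar>" "\<bar>b / c\<bar> * \<bar>c\<bar> = \<bar>b\<bar>" using c by (auto simp: abs_mult[symmetric])
    have t: "1 \<le> t" by (simp add: t_def)
    have "t * \<bar>c\<bar> = \<bar>c\<bar> + \<bar>a\<bar> + 2 * \<bar>b\<bar>" unfolding t_def using 1 c by (simp add: algebra_simps)
    then have "t\<^sup>2 * \<bar>c\<bar> = t * (\<bar>c\<bar> + \<bar>a\<bar> + 2 * \<bar>b\<bar>)" by (metis mult.assoc power2_eq_square)
    also have "\<dots> = t * \<bar>c\<bar> + t * \<bar>a\<bar> + 2 * t * \<bar>b\<bar>" by (simp add: algebra_simps)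
    finally have "t\<^sup>2 * \<bar>c\<bar> = t * \<bar>c\<bar> + t * \<bar>a\<bar> + 2 * t * \<bar>b\<bar>" .
    moreover have "t * \<bar>a\<bar> \<ge> \<bar>a\<bar>" using t by (simp add: mult_left_le_one_le mult_le_cancel_right1)
    moreover have "t * \<bar>c\<bar> > 0" using t c by (intro mult_pos_pos) auto
    moreover have "2 * t * b \<le> 2 * t * \<bar>b\<bar>" using t by (simp add: mult_left_mono)
    moreover have "t\<^sup>2 * \<bar>c\<bar> = - (t\<^sup>2 * c)" using c by simp
    ultimately show False using assms[of t] by linarith
  qed
  \<comment> \<open>The minimizer of the parabola is \<open>t = - b / c\<close>.\<close>
  have "a + 2 * (- b / c) * b + (- b / c)\<^sup>2 * c = a - b\<^sup>2 / c"
    using c by (simp add: field_simps power2_eq_square)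
  with assms[of "- b / c"] have "b\<^sup>2 / c \<le> a" by simp
  then show ?thesis using c by (simp add: field_simps)
qed

lemma mat_inner_Cauchy_Schwarz_sq:
  assumes "dim_row A = dim_row B" "dim_col A = dim_col B"
  shows "(mat_inner A B)\<^sup>2 \<le> mat_inner A A * mat_inner B B"
proof (rule discriminant_nonpos)
  fix t :: real
  have "mat_inner (A + t \<cdot>\<^sub>m B) (A + t \<cdot>\<^sub>m B)
      = mat_inner A A + 2 * t * mat_inner A B + t\<^sup>2 * mat_inner B B"
    using assms
    by (simp add: mat_inner_add_left mat_inner_add_right mat_inner_smult_left mat_inner_smult_right
        mat_inner_commute[of B A] power2_eq_square algebra_simps)
  then show "0 \<le> mat_inner A A + 2 * t * mat_inner A B + t\<^sup>2 * mat_inner B B"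
    by (metis mat_inner_nonneg)
qed

section \<open>The Frobenius norm\<close>

lemma fro_norm_nonneg [simp]: "0 \<le> fro_norm A"
  unfolding fro_norm_def by simp

lemma fro_norm_sq: "(fro_norm A)\<^sup>2 = mat_inner A A"
  unfolding fro_norm_def by simp

lemma mat_inner_Cauchy_Schwarz:
  assumes "dim_row A = dim_row B" "dim_col A = dim_col B"
  shows "\<bar>mat_inner A B\<bar> \<le> fro_norm A * fro_norm B"
proof -
  have "\<bar>mat_inner A B\<bar>\<^sup>2 \<le> (fro_norm A * fro_norm B)\<^sup>2"
    using mat_inner_Cauchy_Schwarz_sq[OF assms] by (simp add: power_mult_distrib fro_norm_sq)
  then show ?thesis by (rule power2_le_imp_le) simp
qed

lemma mat_inner_le:
  "dim_row A = dim_row B \<Longrightarrow> dim_col A = dim_col B \<Longrightarrow> mat_inner A B \<le> fro_norm A * fro_norm B"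
  using mat_inner_Cauchy_Schwarz[of A B] by linarith

lemma fro_norm_zero [simp]: "fro_norm (0\<^sub>m n m) = 0"
  unfolding fro_norm_def by simp

lemma mat_inner_eq_0D:
  assumes "mat_inner A A = 0" shows "A = 0\<^sub>m (dim_row A) (dim_col A)"
proof (rule eq_matI)
  fix i j assume ij: "i < dim_row (0\<^sub>m (dim_row A) (dim_col A) :: real mat)"
    "j < dim_col (0\<^sub>m (dim_row A) (dim_col A) :: real mat)"
  have "(\<Sum>j<dim_col A. A $$ (i, j) * A $$ (i, j)) = 0"
    using assms ij unfolding mat_inner_def by (subst (asm) sum_nonneg_eq_0_iff) (auto intro: sum_nonneg)
  then show "A $$ (i, j) = 0\<^sub>m (dim_row A) (dim_col A) $$ (i, j)"
    using ij by (subst (asm) sum_nonneg_eq_0_iff) auto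
qed auto

lemma fro_norm_eq_0D: "fro_norm A = 0 \<Longrightarrow> A = 0\<^sub>m (dim_row A) (dim_col A)"
  using mat_inner_eq_0D by (simp add: fro_norm_def)

lemma fro_norm_pos: "A \<in> carrier_mat n m \<Longrightarrow> A \<noteq> 0\<^sub>m n m \<Longrightarrow> 0 < fro_norm A"
  using fro_norm_eq_0D[of A] fro_norm_nonneg[of A] by (auto simp: less_le simp del: fro_norm_nonneg)

lemma fro_norm_transpose [simp]: "fro_norm A\<^sup>T = fro_norm A"
  unfolding fro_norm_def by (simp add: mat_inner_transpose)

lemma fro_norm_smult: "fro_norm (c \<cdot>\<^sub>m A) = \<bar>c\<bar> * fro_norm A"
  unfolding fro_norm_def
  by (simp add: mat_inner_smult_left mat_inner_smult_right mult.assoc[symmetric] real_sqrt_mult)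

lemma fro_norm_add_le:
  assumes "dim_row A = dim_row B" "dim_col A = dim_col B"
  shows "fro_norm (A + B) \<le> fro_norm A + fro_norm B"
proof (rule power2_le_imp_le)
  have "(fro_norm (A + B))\<^sup>2 = (fro_norm A)\<^sup>2 + 2 * mat_inner A B + (fro_norm B)\<^sup>2"
    using assms by (simp add: fro_norm_sq mat_inner_add_left mat_inner_add_right mat_inner_commute[of B A])
  also have "\<dots> \<le> (fro_norm A + fro_norm B)\<^sup>2"
    using mat_inner_le[OF assms] by (simp add: power2_sum)
  finally show "(fro_norm (A + B))\<^sup>2 \<le> (fro_norm A + fro_norm B)\<^sup>2" .
qed simp

lemma minus_eq_add_smult:
  "dim_row A = dim_row B \<Longrightarrow> dim_col A = dim_col B \<Longrightarrow> A - B = A + (- 1) \<cdot>\<^sub>m (B :: real mat)"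
  by (intro eq_matI) auto

lemma fro_norm_diff_le:
  assumes "dim_row A = dim_row B" "dim_col A = dim_col B"
  shows "fro_norm (A - B) \<le> fro_norm A + fro_norm B"
  using fro_norm_add_le[of A "(- 1) \<cdot>\<^sub>m B"] assms by (simp add: minus_eq_add_smult fro_norm_smult)

lemma fro_norm_minus_commute:
  assumes "dim_row A = dim_row B" "dim_col A = dim_col B"
  shows "fro_norm (A - B) = fro_norm (B - A)"
proof -
  have "B - A = (- 1) \<cdot>\<^sub>m (A - B)" using assms by (intro eq_matI) auto
  then show ?thesis by (simp add: fro_norm_smult)
qed

lemma mat_inner_cols:
  "mat_inner A B = (\<Sum>j<dim_col A. \<Sum>i<dim_row A. A $$ (i,j) * B $$ (i,j))"
  unfolding mat_inner_def by (rule sum.swap)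

text \<open>Each entry of the product is a row of \<open>A\<close> against a column of
  \<open>B\<close>, bounded by Cauchy-Schwarz; the resulting double sum of products factorizes. Row
  and column are repackaged as one-row matrices to reuse the inequality for
  \<open>mat_inner\<close>.\<close>

lemma fro_norm_mult_le:
  assumes "dim_col A = dim_row B"
  shows "fro_norm (A * B) \<le> fro_norm A * fro_norm B"
proof (rule power2_le_imp_le)
  have CS: "((A * B) $$ (i,j))\<^sup>2 \<le> (\<Sum>k<dim_col A. (A $$ (i,k))\<^sup>2) * (\<Sum>k<dim_row B. (B $$ (k,j))\<^sup>2)"
    if "i < dim_row A" "j < dim_col B" for i j
  proof -
    let ?a = "mat 1 (dim_col A) (\<lambda>(_,k). A $$ (i,k))" and ?b = "mat 1 (dim_col A) (\<lambda>(_,k). B $$ (k,j))"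
    have "mat_inner ?a ?b = (A * B) $$ (i,j)" using that assms
      by (simp add: mat_inner_def scalar_prod_def atLeast0LessThan)
    moreover have "mat_inner ?a ?a = (\<Sum>k<dim_col A. (A $$ (i,k))\<^sup>2)"
      by (simp add: mat_inner_def power2_eq_square)
    moreover have "mat_inner ?b ?b = (\<Sum>k<dim_row B. (B $$ (k,j))\<^sup>2)"
      using assms by (simp add: mat_inner_def power2_eq_square)
    ultimately show ?thesis using mat_inner_Cauchy_Schwarz_sq[of ?a ?b] by simp
  qed
  have "(fro_norm (A * B))\<^sup>2 = (\<Sum>i<dim_row A. \<Sum>j<dim_col B. ((A * B) $$ (i,j))\<^sup>2)"
    unfolding fro_norm_sq mat_inner_def by (simp add: power2_eq_square)
  also have "\<dots> \<le> (\<Sum>i<dim_row A. \<Sum>j<dim_col B.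
      (\<Sum>k<dim_col A. (A $$ (i,k))\<^sup>2) * (\<Sum>k<dim_row B. (B $$ (k,j))\<^sup>2))"
    using CS by (intro sum_mono) auto
  also have "\<dots> = (\<Sum>i<dim_row A. \<Sum>k<dim_col A. (A $$ (i,k))\<^sup>2) * (\<Sum>j<dim_col B. \<Sum>k<dim_row B. (B $$ (k,j))\<^sup>2)"
    by (rule sum_product[symmetric])
  also have "\<dots> = (fro_norm A * fro_norm B)\<^sup>2"
    unfolding power_mult_distrib fro_norm_sq mat_inner_cols[of B B] mat_inner_def[of A A]
    by (simp add: power2_eq_square)
  finally show "(fro_norm (A * B))\<^sup>2 \<le> (fro_norm A * fro_norm B)\<^sup>2" .
qed simp

text \<open>The two Gram matrices have the same nonzero eigenvalues, hence the same norm; here one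
  factor is simply moved across the inner product. This is how \<open>n\<close> by \<open>n\<close>
  norms become \<open>r\<close> by \<open>r\<close> ones.\<close>

lemma mat_inner_self_transpose_mult:
  "mat_inner (A * A\<^sup>T) (A * A\<^sup>T) = mat_inner (A\<^sup>T * A) (A\<^sup>T * A)"
proof -
  have "mat_inner (A * A\<^sup>T) (A * A\<^sup>T) = mat_inner A (A * A\<^sup>T * A)"
    by (simp add: mat_inner_mult_left)
  also have "A * A\<^sup>T * A = A * (A\<^sup>T * A)" by (rule mat_mult_assoc) auto
  also have "mat_inner A (A * (A\<^sup>T * A)) = mat_inner (A * (A\<^sup>T * A)) A" by (rule mat_inner_commute) auto
  also have "\<dots> = mat_inner (A\<^sup>T * A) (A\<^sup>T * A)" by (rule mat_inner_mult_right) auto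
  finally show ?thesis .
qed

lemmas mat_inner_expand = mat_inner_add_left mat_inner_add_right mat_inner_minus_left
  mat_inner_minus_right mat_inner_smult_left mat_inner_smult_right

subsection \<open>Symmetric matrices and operators\<close>

text \<open>Vectors are one-column matrices throughout, so that the matrix product and
  \<open>mat_inner\<close> serve for them as well.\<close>

definition unit_col :: "nat \<Rightarrow> nat \<Rightarrow> real mat" where
  "unit_col m j = mat m 1 (\<lambda>(i,_). if i = j then 1 else 0)"

lemma unit_col_carrier [simp]: "unit_col m j \<in> carrier_mat m 1"
  "unit_col m j \<in> carrier_mat m (Suc 0)" "dim_row (unit_col m j) = m" "dim_col (unit_col m j) = 1"
  unfolding unit_col_def by auto

lemma index_mult_unit_col:
  assumes "dim_col A = m" "i < dim_row A" "j < m"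
  shows "(A * unit_col m j) $$ (i, 0) = A $$ (i, j)"
proof -
  have "(A * unit_col m j) $$ (i, 0) = (\<Sum>k<m. A $$ (i,k) * (if k = j then 1 else 0))"
    using assms by (simp add: unit_col_def scalar_prod_def atLeast0LessThan)
  also have "\<dots> = (\<Sum>k<m. if k = j then A $$ (i,k) else 0)" by (intro sum.cong) auto
  also have "\<dots> = A $$ (i,j)" using assms by simp
  finally show ?thesis .
qed

lemma mat_inner_unit_col: "i < n \<Longrightarrow> dim_row A = n \<Longrightarrow> dim_col A = 1 \<Longrightarrow> mat_inner A (unit_col n i) = A $$ (i, 0)"
proof -
  assume a: "i < n" "dim_row A = n" "dim_col A = 1"
  have "mat_inner A (unit_col n i) = (\<Sum>k<n. A $$ (k,0) * (if k = i then 1 else 0))"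
    unfolding mat_inner_def using a by (simp add: unit_col_def)
  also have "\<dots> = (\<Sum>k<n. if k = i then A $$ (k,0) else 0)" by (intro sum.cong) auto
  also have "\<dots> = A $$ (i, 0)" using a by simp
  finally show ?thesis .
qed

lemma mat_inner_sum_unit_cols:
  assumes "dim_row A = dim_row B" "dim_col A = m" "dim_col B = m"
  shows "mat_inner A B = (\<Sum>j<m. mat_inner (A * unit_col m j) (B * unit_col m j))"
proof -
  have "mat_inner (A * unit_col m j) (B * unit_col m j) = (\<Sum>i<dim_row A. A $$ (i,j) * B $$ (i,j))" if "j < m" for j
  proof -
    have "mat_inner (A * unit_col m j) (B * unit_col m j)
        = (\<Sum>i<dim_row A. (A * unit_col m j) $$ (i,0) * (B * unit_col m j) $$ (i,0))"
      by (simp add: mat_inner_def del: index_mult_mat(1))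
    also have "\<dots> = (\<Sum>i<dim_row A. A $$ (i,j) * B $$ (i,j))"
      using assms that by (intro sum.cong refl) (simp add: index_mult_unit_col del: index_mult_mat(1))
    finally show ?thesis .
  qed
  then show ?thesis unfolding mat_inner_cols[of A B] using assms by simp
qed

text \<open>Both sides are sums over the columns of \<open>X\<close>.\<close>

lemma quadratic_form_lower_bound:
  assumes Q: "Q \<in> carrier_mat m m" and X: "X \<in> carrier_mat m k"
    and le: "\<And>x. x \<in> carrier_mat m 1 \<Longrightarrow> c * mat_inner x x \<le> mat_inner (Q * x) x"
  shows "c * mat_inner X X \<le> mat_inner (Q * X) X"
proof -
  have "c * mat_inner X X = (\<Sum>j<k. c * mat_inner (X * unit_col k j) (X * unit_col k j))"
    using X by (subst mat_inner_sum_unit_cols[of X X k]) (auto simp: sum_distrib_left)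
  also have "\<dots> \<le> (\<Sum>j<k. mat_inner (Q * (X * unit_col k j)) (X * unit_col k j))"
    using X by (intro sum_mono le) auto
  also have "\<dots> = (\<Sum>j<k. mat_inner (Q * X * unit_col k j) (X * unit_col k j))"
    using X Q by (intro sum.cong refl, subst mat_mult_assoc) auto
  also have "\<dots> = mat_inner (Q * X) X"
    using X Q by (subst mat_inner_sum_unit_cols[of "Q * X" X k]) auto
  finally show ?thesis .
qed

text \<open>The determinant decides between an inverse and a kernel vector; the latter is repackaged
  as a one-column matrix.\<close>

lemma mat_one_cases:
  assumes B: "(B :: real mat) \<in> carrier_mat n n"
  obtains B' where "B' \<in> carrier_mat n n" "B * B' = 1\<^sub>m n" "B' * B = 1\<^sub>m n"
    | x where "x \<in> carrier_mat n 1" "x \<noteq> 0\<^sub>m n 1" "B * x = 0\<^sub>m n 1"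
proof (cases "det B = 0")
  case False
  from det_non_zero_imp_unit[OF B False, of undefined]
  have "B \<in> Units (ring_mat TYPE(real) n undefined)" .
  then obtain B' where "B' \<in> carrier_mat n n" "B * B' = 1\<^sub>m n" "B' * B = 1\<^sub>m n"
    unfolding Units_def ring_mat_simps by auto
  then show ?thesis by (rule that(1))
next
  case True
  then obtain v where v: "v \<in> carrier_vec n" "v \<noteq> 0\<^sub>v n" "B *\<^sub>v v = 0\<^sub>v n"
    using det_0_iff_vec_prod_zero[OF B] by auto
  define x where "x = mat n 1 (\<lambda>(i,_). v $ i)"
  have x: "x \<in> carrier_mat n 1" unfolding x_def by simp
  have cx: "col x 0 = v" using v unfolding x_def by auto
  have "x \<noteq> 0\<^sub>m n 1" using v(2) cx by auto
  moreover have "B * x = 0\<^sub>m n 1"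
  proof (rule eq_matI)
    fix i j assume ij: "i < dim_row (0\<^sub>m n 1 :: real mat)" "j < dim_col (0\<^sub>m n 1 :: real mat)"
    then have "(B * x) $$ (i,j) = row B i \<bullet> v" using B x cx by auto
    also have "\<dots> = (B *\<^sub>v v) $ i" using B ij by simp
    finally show "(B * x) $$ (i,j) = 0\<^sub>m n 1 $$ (i,j)" using ij v(3) by simp
  qed (use B x in auto)
  ultimately show ?thesis using that(2) x by blast
qed

text \<open>
  No compactness is needed: if \<open>A - c\<close> were invertible for the infimum \<open>c\<close> of the Rayleigh quotient,
  the Cauchy-Schwarz inequality for its semidefinite form would bound the quotient away from \<open>c\<close>.
\<close>

lemma symmetric_min_eigenvector:
  assumes A: "A \<in> carrier_mat n n" and n: "0 < n"
    and sym: "\<And>x y. x \<in> carrier_mat n 1 \<Longrightarrow> y \<in> carrier_mat n 1 \<Longrightarrow> mat_inner (A * x) y = mat_inner x (A * y)"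
  obtains c v where "v \<in> carrier_mat n 1" "mat_inner v v = 1" "A * v = c \<cdot>\<^sub>m v"
    "\<And>x. x \<in> carrier_mat n 1 \<Longrightarrow> c * mat_inner x x \<le> mat_inner (A * x) x"
proof -
  define S where "S = {mat_inner (A * x) x |x. x \<in> carrier_mat n 1 \<and> mat_inner x x = 1}"
  define c where "c = Inf S"
  have low: "- fro_norm A \<le> s" if sS: "s \<in> S" for s
  proof -
    obtain x where x: "x \<in> carrier_mat n 1" "mat_inner x x = 1" "s = mat_inner (A * x) x"
      using sS unfolding S_def by blast
    have nx: "fro_norm x = 1" using x(2) by (simp add: fro_norm_def)
    have "\<bar>s\<bar> \<le> fro_norm (A * x) * fro_norm x"
      unfolding x(3) using x(1) A by (intro mat_inner_Cauchy_Schwarz) auto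
    also have "\<dots> \<le> fro_norm A * fro_norm x * fro_norm x"
      using x(1) A by (intro mult_right_mono fro_norm_mult_le) auto
    finally show ?thesis using nx by simp
  qed
  have bdd: "bdd_below S" using low by (auto simp: bdd_below_def)
  \<comment> \<open>A unit vector exists because \<open>0 < n\<close>; without it the infimum would
    be taken over the empty set.\<close>
  have "mat_inner (unit_col n 0) (unit_col n 0) = 1"
    using n by (subst mat_inner_unit_col) (auto simp: unit_col_def)
  then have ne: "S \<noteq> {}" unfolding S_def by (auto intro!: exI[of _ "unit_col n 0"])
  have ge: "c * mat_inner x x \<le> mat_inner (A * x) x" if x: "x \<in> carrier_mat n 1" for x
  proof (cases "x = 0\<^sub>m n 1")
    case True then show ?thesis using A by simp
  next
    case False
    then have px: "0 < fro_norm x" using fro_norm_pos[OF x] by simp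
    define t where "t = 1 / fro_norm x"
    have t: "t\<^sup>2 * mat_inner x x = 1" using px by (simp add: t_def power_divide fro_norm_sq[symmetric])
    define y where "y = t \<cdot>\<^sub>m x"
    have y: "y \<in> carrier_mat n 1" using x by (simp add: y_def)
    have "mat_inner y y = 1" using t by (simp add: y_def mat_inner_expand power2_eq_square mult.assoc)
    then have "mat_inner (A * y) y \<in> S" unfolding S_def using y by auto
    then have "c \<le> mat_inner (A * y) y" unfolding c_def by (rule cInf_lower[OF _ bdd])
    also have "\<dots> = t\<^sup>2 * mat_inner (A * x) x"
      using x A by (simp add: y_def mat_mult_smult mat_inner_expand power2_eq_square mult.assoc)
    finally have "c * mat_inner x x \<le> t\<^sup>2 * mat_inner (A * x) x * mat_inner x x"
      by (rule mult_right_mono) simp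
    also have "\<dots> = t\<^sup>2 * mat_inner x x * mat_inner (A * x) x" by simp
    also have "\<dots> = mat_inner (A * x) x" using t by simp
    finally show ?thesis .
  qed
  define B where "B = A - c \<cdot>\<^sub>m 1\<^sub>m n"
  have B: "B \<in> carrier_mat n n" using A unfolding B_def by simp
  have Bx: "B * x = A * x - c \<cdot>\<^sub>m x" if "x \<in> carrier_mat n 1" for x
    using that A unfolding B_def by (simp add: mat_minus_mult mat_smult_mult)
  have Bsym: "mat_inner (B * x) y = mat_inner x (B * y)"
    if "x \<in> carrier_mat n 1" "y \<in> carrier_mat n 1" for x y
    using that A sym[OF that] by (simp add: Bx mat_inner_expand)
  have Bpsd: "0 \<le> mat_inner (B * x) x" if "x \<in> carrier_mat n 1" for x
    using ge[OF that] that A by (simp add: Bx mat_inner_expand)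
  consider (inv) B' where "B' \<in> carrier_mat n n" "B * B' = 1\<^sub>m n" "B' * B = 1\<^sub>m n"
    | (ker) x where "x \<in> carrier_mat n 1" "x \<noteq> 0\<^sub>m n 1" "B * x = 0\<^sub>m n 1"
    using mat_one_cases[OF B] by metis
  then show ?thesis
  proof cases
    case inv
    \<comment> \<open>An upper bound for \<open>mat_inner (B' * x) x\<close> over unit vectors,
      increased by one to make it positive.\<close>
    define C where "C = fro_norm B' + 1"
    have C: "0 < C" unfolding C_def using fro_norm_nonneg[of B'] by linarith
    have "c + 1 / C \<le> s" if sS: "s \<in> S" for s
    proof -
      obtain x where x: "x \<in> carrier_mat n 1" "mat_inner x x = 1" "s = mat_inner (A * x) x"
        using sS unfolding S_def by blast
      have nx: "fro_norm x = 1" using x(2) by (simp add: fro_norm_def)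
      define y where "y = B' * x"
      have y: "y \<in> carrier_mat n 1" using inv x by (simp add: y_def)
      have By: "B * y = x" unfolding y_def using inv x B by (subst mat_mult_assoc[symmetric]) auto
      \<comment> \<open>Cauchy-Schwarz for the semidefinite form of \<open>B\<close>. With
        \<open>B * y = x\<close> the left side is \<open>1\<close> and the last factor at most
        \<open>C\<close>, so the form of \<open>B\<close> is at least \<open>1 / C\<close> on unit
        vectors, and \<open>c\<close> would not be the infimum.\<close>
      have "(mat_inner (B * x) y)\<^sup>2 \<le> mat_inner (B * x) x * mat_inner (B * y) y"
      proof (rule discriminant_nonpos)
        fix t :: real
        have "0 \<le> mat_inner (B * (x + t \<cdot>\<^sub>m y)) (x + t \<cdot>\<^sub>m y)" using x y by (intro Bpsd) auto
        also have "\<dots> = mat_inner (B * x) x + t * mat_inner (B * x) y + t * mat_inner (B * y) x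
            + t\<^sup>2 * mat_inner (B * y) y"
          using x y B by (simp add: mat_expand mat_inner_expand power2_eq_square algebra_simps)
        also have "mat_inner (B * y) x = mat_inner (B * x) y"
          unfolding Bsym[OF y x(1)] using x y B by (intro mat_inner_commute) auto
        finally show "0 \<le> mat_inner (B * x) x + 2 * t * mat_inner (B * x) y + t\<^sup>2 * mat_inner (B * y) y"
          by simp
      qed
      also have "mat_inner (B * x) y = 1" unfolding Bsym[OF x(1) y] By by (rule x)
      also have "mat_inner (B * y) y \<le> C"
      proof -
        have "mat_inner x y \<le> fro_norm x * fro_norm y" using x y by (intro mat_inner_le) auto
        also have "fro_norm y \<le> fro_norm B' * fro_norm x" unfolding y_def using inv x by (intro fro_norm_mult_le) auto
        finally show ?thesis unfolding By C_def using nx by simp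
      qed
      finally have "1 \<le> mat_inner (B * x) x * C"
        using Bpsd[OF x(1)] by (simp add: mult_left_mono)
      then have "1 / C \<le> mat_inner (B * x) x" using C by (simp add: field_simps)
      also have "\<dots> = s - c" using x A by (simp add: Bx mat_inner_expand)
      finally show ?thesis by simp
    qed
    then have "c + 1 / C \<le> c" unfolding c_def[symmetric] using cInf_greatest[OF ne, of "c + 1 / C"] by (simp add: c_def)
    then show ?thesis using C by simp
  next
    case ker
    then have px: "0 < fro_norm x" using fro_norm_pos by simp
    define t where "t = 1 / fro_norm x"
    have t: "t\<^sup>2 * mat_inner x x = 1" using px by (simp add: t_def power_divide fro_norm_sq[symmetric])
    define v where "v = t \<cdot>\<^sub>m x"
    have v: "v \<in> carrier_mat n 1" using ker by (simp add: v_def)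
    have "mat_inner v v = 1" using t by (simp add: v_def mat_inner_expand power2_eq_square mult.assoc)
    moreover have "A * x = c \<cdot>\<^sub>m x"
    proof (rule eq_matI)
      fix i j assume ij: "i < dim_row (c \<cdot>\<^sub>m x)" "j < dim_col (c \<cdot>\<^sub>m x)"
      have "(A * x - c \<cdot>\<^sub>m x) $$ (i,j) = 0" using ker ij Bx by simp
      then show "(A * x) $$ (i,j) = (c \<cdot>\<^sub>m x) $$ (i,j)" using ij A ker by simp
    qed (use A ker in auto)
    then have "A * v = c \<cdot>\<^sub>m v" unfolding v_def using A ker
      by (simp add: mat_mult_smult) (auto simp: mult.left_commute)
    ultimately show ?thesis using that[OF v] ge by blast
  qed
qed

section \<open>Flattening: operators on matrices as square matrices\<close>

definition mat_to_col :: "nat \<Rightarrow> nat \<Rightarrow> real mat \<Rightarrow> real mat" where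
  "mat_to_col n m K = mat (n * m) 1 (\<lambda>(k,_). K $$ (k div m, k mod m))"

lemma mat_to_col_carrier [simp]: "mat_to_col n m K \<in> carrier_mat (n * m) 1"
  "dim_row (mat_to_col n m K) = n * m" "dim_col (mat_to_col n m K) = 1"
  "mat_to_col n m K \<in> carrier_mat (n * m) (Suc 0)"
  unfolding mat_to_col_def by auto

lemma mod_less_of_less_mult: "k < n * m \<Longrightarrow> k mod m < (m :: nat)"
  by (cases m) auto

lemma add_mult_less: "i < n \<Longrightarrow> j < m \<Longrightarrow> i * m + j < n * (m :: nat)"
proof -
  assume a: "i < n" "j < m"
  then have "i * m + j < Suc i * m" by simp
  also have "\<dots> \<le> n * m" using a by (intro mult_le_mono1) simp
  finally show ?thesis .
qed

lemma sum_div_mod: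
  "(\<Sum>k<n * m. g (k div m) (k mod m)) = (\<Sum>i<n. \<Sum>j<m. g i j)" for g :: "nat \<Rightarrow> nat \<Rightarrow> real"
proof -
  have "(\<Sum>i<n. \<Sum>j<m. g i j) = (\<Sum>(i,j)\<in>{..<n} \<times> {..<m}. g i j)" by (rule sum.cartesian_product)
  also have "\<dots> = (\<Sum>k<n * m. g (k div m) (k mod m))"
    by (rule sum.reindex_bij_witness[of _ "\<lambda>k. (k div m, k mod m)" "\<lambda>(i,j). i * m + j"])
      (auto simp: add_mult_less less_mult_imp_div_less mod_less_of_less_mult)
  finally show ?thesis ..
qed

lemma mat_to_col_inner:
  "K \<in> carrier_mat n m \<Longrightarrow> mat_inner (mat_to_col n m K) (mat_to_col n m L) = mat_inner K L"
  using sum_div_mod[where g = "\<lambda>i j. K $$ (i,j) * L $$ (i,j)" and n = n and m = m]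
  by (auto simp: mat_inner_def mat_to_col_def)

lemma mat_to_col_norm: "K \<in> carrier_mat n m \<Longrightarrow> fro_norm (mat_to_col n m K) = fro_norm K"
  by (simp add: fro_norm_def mat_to_col_inner)

lemma mat_to_col_smult: "K \<in> carrier_mat n m \<Longrightarrow> mat_to_col n m (c \<cdot>\<^sub>m K) = c \<cdot>\<^sub>m mat_to_col n m K"
  by (intro eq_matI) (auto simp: mat_to_col_def less_mult_imp_div_less mod_less_of_less_mult)

lemma mat_to_col_surj:
  assumes x: "x \<in> carrier_mat (n * m) 1"
  obtains K where "K \<in> carrier_mat n m" "mat_to_col n m K = x"
proof
  let ?K = "mat n m (\<lambda>(i,j). x $$ (i * m + j, 0))"
  show "?K \<in> carrier_mat n m" by simp
  show "mat_to_col n m ?K = x"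
  proof (rule eq_matI)
    fix k j assume kj: "k < dim_row x" "j < dim_col x"
    then have k: "k < n * m" "j = 0" using x by auto
    then have "0 < m" by (auto intro: gr0I)
    with k show "mat_to_col n m ?K $$ (k,j) = x $$ (k,j)"
      by (simp add: mat_to_col_def less_mult_imp_div_less)
  qed (use x in auto)
qed

lemma mat_to_col_inj:
  assumes "K \<in> carrier_mat n m" "L \<in> carrier_mat n m" "mat_to_col n m K = mat_to_col n m L"
  shows "K = L"
proof (rule eq_matI)
  fix i j assume "i < dim_row L" "j < dim_col L"
  then have ij: "i < n" "j < m" using assms by auto
  then have "mat_to_col n m K $$ (i * m + j, 0) = K $$ (i,j)" "mat_to_col n m L $$ (i * m + j, 0) = L $$ (i,j)"
    by (simp_all add: mat_to_col_def add_mult_less)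
  then show "K $$ (i,j) = L $$ (i,j)" using assms(3) by simp
qed (use assms in auto)

text \<open>Expansion in elementary matrices, by induction over the set \<open>S\<close> of entries
  retained: \<open>?R S\<close> agrees with \<open>K\<close> on \<open>S\<close> and vanishes
  elsewhere.\<close>

lemma linear_op_entries:
  assumes T: "linear_op n m T" and K: "K \<in> carrier_mat n m" and a: "a < n" and b: "b < m"
  shows "T K $$ (a,b) = (\<Sum>i<n. \<Sum>j<m. K $$ (i,j) * T (mat n m (\<lambda>q. if q = (i,j) then 1 else 0)) $$ (a,b))"
proof -
  let ?E = "\<lambda>p. mat n m (\<lambda>q. if q = p then 1 else 0 :: real)"
  let ?R = "\<lambda>S. mat n m (\<lambda>q. if q \<in> S then K $$ q else 0)"
  have Tc: "T A \<in> carrier_mat n m" if "A \<in> carrier_mat n m" for A using T that by (simp add: linear_op_def)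
  have "T (?R S) $$ (a,b) = (\<Sum>p\<in>S. K $$ p * T (?E p) $$ (a,b))" if "finite S" for S
    using that
  proof induction
    case empty
    have "?R {} = 0 \<cdot>\<^sub>m ?R {}" by (intro eq_matI) auto
    moreover have "T (0 \<cdot>\<^sub>m ?R {}) = 0 \<cdot>\<^sub>m T (?R {})" using T by (simp add: linear_op_def)
    ultimately have "T (?R {}) = 0 \<cdot>\<^sub>m T (?R {})" by (rule subst[where P = "\<lambda>Z. T Z = _", OF sym])
    moreover have "(0 \<cdot>\<^sub>m T (?R {})) $$ (a,b) = 0" using Tc[of "?R {}"] a b by simp
    ultimately show ?case by simp
  next
    case (insert p S)
    have "?R (insert p S) = ?R S + K $$ p \<cdot>\<^sub>m ?E p" using insert.hyps by (intro eq_matI) auto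
    then have "T (?R (insert p S)) = T (?R S) + K $$ p \<cdot>\<^sub>m T (?E p)" using T unfolding linear_op_def by auto
    then show ?case using insert Tc[of "?R S"] Tc[of "?E p"] a b by simp
  qed
  from this[of "{..<n} \<times> {..<m}"] have "T (?R ({..<n} \<times> {..<m})) $$ (a,b) = (\<Sum>p\<in>{..<n} \<times> {..<m}. K $$ p * T (?E p) $$ (a,b))" by simp
  moreover have "?R ({..<n} \<times> {..<m}) = K" using K by (intro eq_matI) auto
  ultimately show ?thesis by (simp add: sum.cartesian_product split_def)
qed

lemma linear_op_matrix:
  assumes T: "linear_op n m T"
  obtains A where "A \<in> carrier_mat (n * m) (n * m)"
    "\<And>K. K \<in> carrier_mat n m \<Longrightarrow> mat_to_col n m (T K) = A * mat_to_col n m K"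
proof
  let ?E = "\<lambda>i j. mat n m (\<lambda>q. if q = (i,j) then 1 else 0 :: real)"
  \<comment> \<open>Column \<open>l\<close> is the flattened image of the \<open>l\<close>-th
    elementary matrix, counted row by row.\<close>
  let ?A = "mat (n * m) (n * m) (\<lambda>(k,l). T (?E (l div m) (l mod m)) $$ (k div m, k mod m))"
  show "?A \<in> carrier_mat (n * m) (n * m)" by simp
  fix K :: "real mat" assume K: "K \<in> carrier_mat n m"
  show "mat_to_col n m (T K) = ?A * mat_to_col n m K"
  proof (rule eq_matI)
    fix k j assume "k < dim_row (?A * mat_to_col n m K)" "j < dim_col (?A * mat_to_col n m K)"
    then have k: "k < n * m" "j = 0" by auto
    then have "0 < m" by (auto intro: gr0I)
    then have km: "k div m < n" "k mod m < m" using k by (auto simp: less_mult_imp_div_less)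
    have "mat_to_col n m (T K) $$ (k,j) = T K $$ (k div m, k mod m)" using k by (simp add: mat_to_col_def)
    also have "\<dots> = (\<Sum>l<n * m. K $$ (l div m, l mod m) * T (?E (l div m) (l mod m)) $$ (k div m, k mod m))"
      unfolding linear_op_entries[OF T K km] by (rule sum_div_mod[symmetric])
    also have "\<dots> = (?A * mat_to_col n m K) $$ (k,j)"
      using k by (simp add: mat_to_col_def scalar_prod_def atLeast0LessThan mult.commute)
    finally show "mat_to_col n m (T K) $$ (k,j) = (?A * mat_to_col n m K) $$ (k,j)" .
  qed auto
qed

text \<open>The Frobenius norm of the representing matrix is such a constant. It is wanted for the
  Hessian of \<open>f\<close>, which is applied to the quadratic remainder
  \<open>K * K\<^sup>T\<close> in the chain rule.\<close>

lemma linear_op_bounded: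
  assumes T: "linear_op n m T"
  obtains C where "0 \<le> C" "\<And>K. K \<in> carrier_mat n m \<Longrightarrow> fro_norm (T K) \<le> C * fro_norm K"
proof -
  obtain A where A: "A \<in> carrier_mat (n * m) (n * m)"
    "\<And>K. K \<in> carrier_mat n m \<Longrightarrow> mat_to_col n m (T K) = A * mat_to_col n m K"
    using linear_op_matrix[OF T] by metis
  have "fro_norm (T K) \<le> fro_norm A * fro_norm K" if K: "K \<in> carrier_mat n m" for K
  proof -
    have TK: "T K \<in> carrier_mat n m" using T K by (simp add: linear_op_def)
    have "fro_norm (T K) = fro_norm (A * mat_to_col n m K)" using A(2)[OF K] mat_to_col_norm[OF TK] by simp
    also have "\<dots> \<le> fro_norm A * fro_norm (mat_to_col n m K)" using A(1) by (intro fro_norm_mult_le) simp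
    finally show ?thesis using mat_to_col_norm[OF K] by simp
  qed
  then show thesis using that[of "fro_norm A"] by simp
qed

text \<open>The minimum of the Rayleigh quotient of the flattened operator is attained at an
  eigenvector. It is therefore a member of the set under \<open>Min\<close> and lies above
  \<open>lambda_min\<close>, while it bounds the quadratic form from below.\<close>

lemma lambda_min_quadratic_form:
  assumes T: "linear_op n m T" and n: "0 < n" and m: "0 < m"
    and sym: "\<And>K L. K \<in> carrier_mat n m \<Longrightarrow> L \<in> carrier_mat n m \<Longrightarrow> mat_inner (T K) L = mat_inner (T L) K"
    and V: "V \<in> carrier_mat n m"
  shows "lambda_min n m T * mat_inner V V \<le> mat_inner (T V) V"
proof -
  let ?N = "n * m"
  obtain A where A: "A \<in> carrier_mat ?N ?N"
    "\<And>K. K \<in> carrier_mat n m \<Longrightarrow> mat_to_col n m (T K) = A * mat_to_col n m K"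
    using linear_op_matrix[OF T] by metis
  have Tc: "T K \<in> carrier_mat n m" if "K \<in> carrier_mat n m" for K using T that by (simp add: linear_op_def)
  define E where "E = {c. \<exists>V \<in> carrier_mat n m. V \<noteq> 0\<^sub>m n m \<and> T V = c \<cdot>\<^sub>m V}"
  have zero: "mat_to_col n m (0\<^sub>m n m) = 0\<^sub>m ?N 1"
    by (intro eq_matI) (auto simp: mat_to_col_def less_mult_imp_div_less m)
  \<comment> \<open>\<open>Min\<close> is meaningful only because there are finitely many eigenvalues.\<close>
  have "E \<subseteq> {c. poly (char_poly A) c = 0}"
  proof
    fix c assume "c \<in> E"
    then obtain V where V: "V \<in> carrier_mat n m" "V \<noteq> 0\<^sub>m n m" "T V = c \<cdot>\<^sub>m V" unfolding E_def by blast
    define x where "x = mat_to_col n m V"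
    have x: "x \<in> carrier_mat ?N 1" by (simp add: x_def)
    have Ax: "A * x = c \<cdot>\<^sub>m x" unfolding x_def using A(2)[OF V(1)] V mat_to_col_smult by simp
    have xn: "x \<noteq> 0\<^sub>m ?N 1" unfolding x_def using mat_to_col_inj[OF V(1), of "0\<^sub>m n m"] V(2) zero by auto
    have "eigenvector A (col x 0) c" unfolding eigenvector_def
    proof (intro conjI)
      show "col x 0 \<in> carrier_vec (dim_row A)" using col_carrier_vec[OF _ x, of 0] A by simp
      show "col x 0 \<noteq> 0\<^sub>v (dim_row A)"
      proof
        assume 0: "col x 0 = 0\<^sub>v (dim_row A)"
        have "x = 0\<^sub>m ?N 1"
        proof (rule eq_matI)
          fix i j assume "i < dim_row (0\<^sub>m ?N 1 :: real mat)" "j < dim_col (0\<^sub>m ?N 1 :: real mat)"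
          then have ij: "i < ?N" "j = 0" by auto
          then have "x $$ (i,j) = col x 0 $ i" using x by simp
          also have "\<dots> = 0" unfolding 0 using ij A by simp
          finally show "x $$ (i,j) = 0\<^sub>m ?N 1 $$ (i,j)" using ij by simp
        qed (use x in auto)
        with xn show False by simp
      qed
      have "A *\<^sub>v col x 0 = col (A * x) 0" using A x by (intro col_mult2[symmetric]) auto
      also have "\<dots> = c \<cdot>\<^sub>v col x 0" unfolding Ax using x by simp
      finally show "A *\<^sub>v col x 0 = c \<cdot>\<^sub>v col x 0" .
    qed
    then show "c \<in> {c. poly (char_poly A) c = 0}"
      using eigenvalue_root_char_poly[OF A(1)] by (auto simp: eigenvalue_def)
  qed
  moreover have "char_poly A \<noteq> 0" using degree_monic_char_poly[OF A(1)] by auto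
  ultimately have fin: "finite E" using poly_roots_finite finite_subset by blast
  have Asym: "mat_inner (A * x) y = mat_inner x (A * y)"
    if x: "x \<in> carrier_mat ?N 1" and y: "y \<in> carrier_mat ?N 1" for x y
  proof -
    obtain K where K: "K \<in> carrier_mat n m" "mat_to_col n m K = x" using mat_to_col_surj[OF x] by metis
    obtain L where L: "L \<in> carrier_mat n m" "mat_to_col n m L = y" using mat_to_col_surj[OF y] by metis
    have "mat_inner (A * x) y = mat_inner (T K) L"
      using A(2)[OF K(1)] K L mat_to_col_inner[OF Tc[OF K(1)]] by metis
    also have "\<dots> = mat_inner (T L) K" by (rule sym[OF K(1) L(1)])
    also have "\<dots> = mat_inner K (T L)" using K L Tc by (intro mat_inner_commute) (auto dest: carrier_matD)
    also have "\<dots> = mat_inner x (A * y)" using A(2)[OF L(1)] K L mat_to_col_inner[OF K(1)] by metis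
    finally show ?thesis .
  qed
  obtain c v where cv: "v \<in> carrier_mat ?N 1" "mat_inner v v = 1" "A * v = c \<cdot>\<^sub>m v"
    "\<And>x. x \<in> carrier_mat ?N 1 \<Longrightarrow> c * mat_inner x x \<le> mat_inner (A * x) x"
    using symmetric_min_eigenvector[OF A(1) _ Asym] n m by (metis nat_0_less_mult_iff)
  obtain K where K: "K \<in> carrier_mat n m" "mat_to_col n m K = v" using mat_to_col_surj[OF cv(1)] by metis
  have "mat_to_col n m (T K) = mat_to_col n m (c \<cdot>\<^sub>m K)"
    unfolding A(2)[OF K(1)] mat_to_col_smult[OF K(1)] K(2) by (rule cv(3))
  then have "T K = c \<cdot>\<^sub>m K" using mat_to_col_inj[OF Tc[OF K(1)]] K(1) by auto
  moreover have "K \<noteq> 0\<^sub>m n m" using cv(2) K mat_to_col_inner[OF K(1)] by auto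
  ultimately have "c \<in> E" unfolding E_def using K(1) by blast
  then have "lambda_min n m T \<le> c" unfolding lambda_min_def E_def[symmetric] using fin by simp
  then have "lambda_min n m T * mat_inner V V \<le> c * mat_inner V V" by (rule mult_right_mono) simp
  also have "\<dots> \<le> mat_inner (T V) V"
    using cv(4)[of "mat_to_col n m V"] A(2)[OF V] mat_to_col_inner[OF V] mat_to_col_inner[OF Tc[OF V]] by simp
  finally show ?thesis .
qed

subsection \<open>Rank and the spectral theorem\<close>

text \<open>Every column of \<open>A * B\<close> is \<open>A\<close> applied to a column of
  \<open>B\<close>, so the column spaces are nested.\<close>

lemma (in vec_space) rank_mult_le:
  assumes A: "A \<in> carrier_mat n k" and B: "B \<in> carrier_mat k m"
  shows "rank (A * B) \<le> rank A"
proof -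
  have AB: "A * B \<in> carrier_mat n m" using A B by simp
  have cA: "set (cols A) \<subseteq> carrier_vec n" and cAB: "set (cols (A * B)) \<subseteq> carrier_vec n"
    using cols_dim A AB carrier_matD(1) by blast+
  have "set (cols (A * B)) \<subseteq> span (set (cols A))"
  proof
    fix v assume "v \<in> set (cols (A * B))"
    then obtain j where j: "j < m" "v = col (A * B) j" using AB by (auto simp: in_set_conv_nth)
    have "col (A * B) j = A *\<^sub>v col B j" using A B j by (intro col_mult2) auto
    then have "v \<in> col_space A" unfolding col_space_eq[OF A] using A B j by (auto intro!: bexI[of _ "col B j"])
    then show "v \<in> span (set (cols A))" by (simp add: col_space_def)
  qed
  then have sub: "span (set (cols (A * B))) \<subseteq> span (set (cols A))" by (rule span_subsetI[OF cA])
  have W: "vectorspace class_ring (vs (span (set (cols A))))"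
    using span_is_subspace[OF cA] subspace_is_vs by auto
  have "VectorSpace.subspace class_ring (span (set (cols (A * B)))) (vs (span (set (cols A))))"
    using nested_subspaces[OF span_is_subspace[OF cA] span_is_subspace[OF cAB] sub] .
  moreover have "vectorspace.fin_dim class_ring (vs (span (set (cols A))))" using fin_dim_span_cols[OF A] by simp
  moreover have "vectorspace.fin_dim class_ring (vs (span (set (cols A)))\<lparr>carrier := span (set (cols (A * B)))\<rparr>)"
    using fin_dim_span_cols[OF AB] by simp
  ultimately have "vectorspace.dim class_ring (vs (span (set (cols A)))\<lparr>carrier := span (set (cols (A * B)))\<rparr>)
      \<le> vectorspace.dim class_ring (vs (span (set (cols A))))"
    by (rule vectorspace.subspace_dim[OF W])
  then show ?thesis unfolding rank_def by simp
qed

lemma (in vec_space) rank_mult_le_inner_dim: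
  assumes A: "A \<in> carrier_mat n k" and B: "B \<in> carrier_mat k m"
  shows "rank (A * B) \<le> k"
  using rank_mult_le[OF A B] rank_le_nc[OF A] by linarith

text \<open>Independence of the set of columns gives full rank only if no column is repeated.
  Repetition is excluded first: equal columns \<open>i\<close> and \<open>j\<close> would put the
  difference of two unit vectors into the kernel.\<close>

lemma (in vec_space) rank_eq_nc_if_injective:
  assumes A: "A \<in> carrier_mat n p"
    and inj: "\<And>v. v \<in> carrier_vec p \<Longrightarrow> A *\<^sub>v v = 0\<^sub>v n \<Longrightarrow> v = 0\<^sub>v p"
  shows "rank A = p"
proof -
  have d: "distinct (cols A)"
  proof (rule ccontr)
    assume "\<not> distinct (cols A)"
    then obtain i j where ij: "i < p" "j < p" "i \<noteq> j" "col A i = col A j"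
      using A by (auto simp: distinct_conv_nth)
    define v where "v = unit_vec p i - (unit_vec p j :: 'a vec)"
    have v: "v \<in> carrier_vec p" by (simp add: v_def)
    have "A *\<^sub>v v = A *\<^sub>v unit_vec p i - A *\<^sub>v unit_vec p j"
      unfolding v_def using A by (intro mult_minus_distrib_mat_vec) auto
    also have "A *\<^sub>v unit_vec p i = col A i" using A ij(1) by (intro eq_vecI) auto
    also have "A *\<^sub>v unit_vec p j = col A j" using A ij(2) by (intro eq_vecI) auto
    also have "col A i - col A j = 0\<^sub>v n" using ij A by auto
    finally have "v = 0\<^sub>v p" by (rule inj[OF v])
    then have "v $ i = 0" using ij by simp
    then show False using ij by (simp add: v_def)
  qed
  have "lin_indpt (set (cols A))"
  proof (rule ccontr)
    assume "\<not> lin_indpt (set (cols A))"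
    then obtain v where "v \<in> carrier_vec p" "v \<noteq> 0\<^sub>v p" "A *\<^sub>v v = 0\<^sub>v n" using lin_depE[OF A _ d] by auto
    then show False using inj by blast
  qed
  then show ?thesis by (rule lin_indpt_full_rank[OF A d])
qed

section \<open>Spectral theorem by deflation\<close>

lemma dim_mat_diag [simp]: "dim_row (mat_diag n f) = n" "dim_col (mat_diag n f) = n"
  by (simp_all add: mat_diag_def)

lemma transpose_mult_col:
  assumes "x \<in> carrier_mat n 1" "y \<in> carrier_mat n 1"
  shows "x\<^sup>T * y = mat_inner x y \<cdot>\<^sub>m 1\<^sub>m 1"
proof (rule eq_matI)
  fix i j assume "i < dim_row (mat_inner x y \<cdot>\<^sub>m 1\<^sub>m 1)" "j < dim_col (mat_inner x y \<cdot>\<^sub>m 1\<^sub>m 1)"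
  then have "i = 0" "j = 0" by auto
  then show "(x\<^sup>T * y) $$ (i,j) = (mat_inner x y \<cdot>\<^sub>m 1\<^sub>m 1) $$ (i,j)"
    using assms by (simp add: mat_inner_def scalar_prod_def atLeast0LessThan)
qed (use assms in auto)

text \<open>The reflection \<open>1 - 2 w w\<^sup>T / |w|\<^sup>2\<close> with
  \<open>w = e - v\<close> exchanges the unit vectors \<open>e\<close> and \<open>v\<close>. Being
  symmetric and its own inverse, it extends \<open>v\<close> to an orthonormal basis without any
  orthogonalization procedure. For \<open>v = e\<close> the vector \<open>w\<close> is zero and the
  identity takes its place.\<close>

lemma householder:
  assumes n: "0 < n" and v: "v \<in> carrier_mat n 1" "mat_inner v v = 1"
  obtains H where "H \<in> carrier_mat n n" "H\<^sup>T = H" "H * H = 1\<^sub>m n" "H * unit_col n 0 = v"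
proof (cases "v = unit_col n 0")
  case True
  show ?thesis by (rule that[of "1\<^sub>m n"]) (simp_all add: True)
next
  case False
  let ?e = "unit_col n 0"
  define w where "w = ?e - v"
  have w: "w \<in> carrier_mat n 1" using v by (simp add: w_def)
  have wn: "w \<noteq> 0\<^sub>m n 1" using False mat_minus_eq_0D[of ?e n 1 v] v by (auto simp: w_def)
  define s where "s = mat_inner w w"
  have s: "0 < s" using fro_norm_pos[OF w wn] unfolding s_def fro_norm_sq[symmetric] by simp
  have ee: "mat_inner ?e ?e = 1" using n by (subst mat_inner_unit_col) (auto simp: unit_col_def)
  have "mat_inner v ?e = mat_inner ?e v" using v by (intro mat_inner_commute) auto
  \<comment> \<open>Both sides equal \<open>2 - 2 * mat_inner ?e v\<close>, since \<open>e\<close>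
    and \<open>v\<close> have length one.\<close>
  then have we: "2 * mat_inner w ?e = s"
    unfolding s_def w_def using v ee by (simp add: mat_inner_expand)
  define P where "P = w * w\<^sup>T"
  have P: "P \<in> carrier_mat n n" using w by (simp add: P_def)
  have PP: "P * P = s \<cdot>\<^sub>m P"
  proof -
    have "P * P = w * (w\<^sup>T * w) * w\<^sup>T" unfolding P_def using w by (simp add: mat_mult_assoc)
    also have "\<dots> = s \<cdot>\<^sub>m P" unfolding transpose_mult_col[OF w w] s_def[symmetric] P_def
      using w by (simp add: mat_mult_smult mat_smult_mult)
    finally show ?thesis .
  qed
  define H where "H = 1\<^sub>m n - (2 / s) \<cdot>\<^sub>m P"
  have H: "H \<in> carrier_mat n n" using P by (simp add: H_def)
  have "H\<^sup>T = H"
    unfolding H_def P_def using w by (simp add: mat_transpose_minus mat_transpose_smult mat_transpose_mult)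
  moreover have "H * H = 1\<^sub>m n"
  proof -
    have "H * H = 1\<^sub>m n - (2 / s) \<cdot>\<^sub>m P - (2 / s) \<cdot>\<^sub>m (P - (2 / s) \<cdot>\<^sub>m (s \<cdot>\<^sub>m P))"
      unfolding H_def using P by (simp add: mat_minus_mult mat_mult_minus mat_smult_mult mat_mult_smult PP)
    also have "\<dots> = 1\<^sub>m n" using P s by (intro eq_matI) (auto simp: field_simps)
    finally show ?thesis .
  qed
  moreover have "H * ?e = v"
  proof -
    have "P * ?e = w * (w\<^sup>T * ?e)" unfolding P_def using w by (simp add: mat_mult_assoc)
    also have "\<dots> = mat_inner w ?e \<cdot>\<^sub>m w" using w by (subst transpose_mult_col[OF w]) (simp_all add: mat_mult_smult)
    finally have "H * ?e = ?e - (2 / s) \<cdot>\<^sub>m (mat_inner w ?e \<cdot>\<^sub>m w)"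
      unfolding H_def using P by (simp add: mat_minus_mult mat_smult_mult)
    also have "\<dots> = ?e - w" using w we s by (intro eq_matI) (auto simp: field_simps)
    also have "\<dots> = v" unfolding w_def using v by (intro eq_matI) auto
    finally show ?thesis .
  qed
  ultimately show ?thesis using that[OF H] by blast
qed

text \<open>Conjugation by the reflection that sends the first unit vector to an eigenvector clears
  the first column up to its diagonal entry, and by symmetry the first row. The induction hypothesis
  diagonalizes the remaining block.\<close>

lemma real_spectral_theorem:
  assumes "A \<in> carrier_mat n n" "A\<^sup>T = A"
  obtains Q d where "Q \<in> carrier_mat n n" "Q\<^sup>T * Q = 1\<^sub>m n" "Q * Q\<^sup>T = 1\<^sub>m n"
    "A = Q * mat_diag n d * (Q :: real mat)\<^sup>T"
proof -
  have "\<exists>Q d. Q \<in> carrier_mat n n \<and> Q\<^sup>T * Q = 1\<^sub>m n \<and> Q * Q\<^sup>T = 1\<^sub>m n \<and> A = Q * mat_diag n d * (Q :: real mat)\<^sup>T"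
    using assms
  proof (induction n arbitrary: A)
    case 0
    then show ?case by (intro exI[of _ "1\<^sub>m 0"] exI[of _ "\<lambda>_. 0"]) auto
  next
    case (Suc n A)
    note A = Suc.prems(1)
    have sym: "mat_inner (A * x) y = mat_inner x (A * y)"
      if "x \<in> carrier_mat (Suc n) 1" "y \<in> carrier_mat (Suc n) 1" for x y
      using that A Suc.prems(2) mat_inner_mult_right[of A x y] by simp
    obtain c v where v: "v \<in> carrier_mat (Suc n) 1" "mat_inner v v = 1" "A * v = c \<cdot>\<^sub>m v"
      using symmetric_min_eigenvector[OF A _ sym] by (metis zero_less_Suc)
    obtain H where H: "H \<in> carrier_mat (Suc n) (Suc n)" "H\<^sup>T = H" "H * H = 1\<^sub>m (Suc n)" "H * unit_col (Suc n) 0 = v"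
      using householder[OF _ v(1,2)] by blast
    let ?e = "unit_col (Suc n) 0"
    define B where "B = H * A * H"
    have B: "B \<in> carrier_mat (Suc n) (Suc n)" using A H by (simp add: B_def)
    have Bs: "B\<^sup>T = B" unfolding B_def using A H Suc.prems(2) by (simp add: mat_transpose_mult mat_mult_assoc)
    \<comment> \<open>\<open>H\<close> is an involution, so it also takes the eigenvector back to
      the first unit vector.\<close>
    have "H * v = ?e" using H by (simp add: H(4)[symmetric] mat_mult_assoc[symmetric])
    then have "B * ?e = c \<cdot>\<^sub>m ?e" unfolding B_def using A H v by (simp add: mat_mult_assoc mat_mult_smult)
    then have B0: "B $$ (i, 0) = (if i = 0 then c else 0)" if "i < Suc n" for i
      using that B index_mult_unit_col[of B "Suc n" i 0] by (simp add: unit_col_def split: if_splits)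
    then have B1: "B $$ (0, i) = (if i = 0 then c else 0)" if "i < Suc n" for i
      using that B arg_cong[OF Bs, of "\<lambda>M. M $$ (0, i)"] by simp
    define B' where "B' = mat n n (\<lambda>(i,j). B $$ (Suc i, Suc j))"
    have "B'\<^sup>T = B'"
    proof (rule eq_matI)
      fix i j assume "i < dim_row B'" "j < dim_col B'"
      then show "B'\<^sup>T $$ (i,j) = B' $$ (i,j)"
        using B arg_cong[OF Bs, of "\<lambda>M. M $$ (Suc i, Suc j)"] by (simp add: B'_def)
    qed (auto simp: B'_def)
    then obtain Q' d' where Q': "Q' \<in> carrier_mat n n" "Q'\<^sup>T * Q' = 1\<^sub>m n" "Q' * Q'\<^sup>T = 1\<^sub>m n"
      "B' = Q' * mat_diag n d' * Q'\<^sup>T"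
      using Suc.IH[of B'] by (auto simp: B'_def)
    let ?Z = "0\<^sub>m 1 n :: real mat" and ?Z' = "0\<^sub>m n 1 :: real mat"
    define P where "P = four_block_mat (1\<^sub>m 1) ?Z ?Z' Q'"
    define d where "d i = (if i = 0 then c else d' (i - 1))" for i
    have P: "P \<in> carrier_mat (Suc n) (Suc n)"
      unfolding P_def using four_block_carrier_mat[of "1\<^sub>m 1" 1 1 Q' n n] Q' by simp
    have PT: "P\<^sup>T = four_block_mat (1\<^sub>m 1) ?Z ?Z' Q'\<^sup>T"
      unfolding P_def using Q' by (subst transpose_four_block_mat[of _ 1 1 _ n _ n]) auto
    have D: "mat_diag (Suc n) d = four_block_mat (c \<cdot>\<^sub>m 1\<^sub>m 1) ?Z ?Z' (mat_diag n d')"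
      by (intro eq_matI) (auto simp: mat_diag_def d_def)
    have BB: "B = four_block_mat (c \<cdot>\<^sub>m 1\<^sub>m 1) ?Z ?Z' B'"
      using B by (intro eq_matI) (auto simp: B0 B1 B'_def)
    have one: "four_block_mat (1\<^sub>m 1) ?Z ?Z' (1\<^sub>m n) = 1\<^sub>m (Suc n)"
      using four_block_one_mat[of 1 n, where ?'a = real] by simp
    have PTP: "P\<^sup>T * P = 1\<^sub>m (Suc n)" "P * P\<^sup>T = 1\<^sub>m (Suc n)"
      unfolding PT unfolding P_def using Q'
      by (subst mult_four_block_mat[of _ 1 1 _ n _ n _ _ 1 _ n], auto simp: one)+
    have "P * mat_diag (Suc n) d * P\<^sup>T = B"
    proof -
      have PD: "P * mat_diag (Suc n) d = four_block_mat (c \<cdot>\<^sub>m 1\<^sub>m 1) ?Z ?Z' (Q' * mat_diag n d')"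
        unfolding P_def D using Q'(1)
        by (subst mult_four_block_mat[of _ 1 1 _ n _ n _ _ 1 _ n]) auto
      show ?thesis
        unfolding PD PT BB Q'(4) using Q'(1)
        by (subst mult_four_block_mat[of _ 1 1 _ n _ n _ _ 1 _ n]) auto
    qed
    define Q where "Q = H * P"
    have D': "mat_diag (Suc n) d \<in> carrier_mat (Suc n) (Suc n)" by simp
    have QT: "Q\<^sup>T = P\<^sup>T * H" unfolding Q_def using H P by (simp add: mat_transpose_mult)
    have Q: "Q \<in> carrier_mat (Suc n) (Suc n)" using H P by (simp add: Q_def)
    have "Q\<^sup>T * Q = P\<^sup>T * (H * H) * P" unfolding QT unfolding Q_def using H(1) P by (simp add: mat_mult_assoc)
    then have 1: "Q\<^sup>T * Q = 1\<^sub>m (Suc n)" using H P PTP by simp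
    have "Q * Q\<^sup>T = H * (P * P\<^sup>T) * H" unfolding QT unfolding Q_def using H(1) P by (simp add: mat_mult_assoc)
    then have 2: "Q * Q\<^sup>T = 1\<^sub>m (Suc n)" using H PTP by simp
    have "Q * mat_diag (Suc n) d * Q\<^sup>T = H * (P * mat_diag (Suc n) d * P\<^sup>T) * H"
      unfolding QT unfolding Q_def using H(1) P D' by (simp add: mat_mult_assoc)
    also have "\<dots> = H * (H * A * H) * H" unfolding \<open>P * mat_diag (Suc n) d * P\<^sup>T = B\<close> B_def ..
    also have "\<dots> = (H * H) * A * (H * H)" using H(1) A by (simp add: mat_mult_assoc)
    also have "\<dots> = A" unfolding H(3) using A by simp
    finally have "A = Q * mat_diag (Suc n) d * Q\<^sup>T" ..
    with 1 2 Q show ?case by blast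
  qed
  then show ?thesis using that by blast
qed

subsection \<open>Positive semidefinite and polar factorizations\<close>

lemma proots_prod_linear: "proots (\<Prod>a\<leftarrow>as. [:- a, 1:]) = mset (as :: real list)"
proof (induction as)
  case (Cons a as)
  have "(\<Prod>a\<leftarrow>as. [:- a, 1:]) \<noteq> 0" by (auto simp: prod_list_zero_iff)
  then have "proots ([:- a, 1:] * (\<Prod>a\<leftarrow>as. [:- a, 1:])) = proots [:- a, 1:] + proots (\<Prod>a\<leftarrow>as. [:- a, 1:])"
    by (intro proots_mult) auto
  then show ?case using Cons by simp
qed simp

text \<open>The positive entries of a decreasing list form an initial segment; if there are
  \<open>r\<close> of them, the least one stands at index \<open>r - 1\<close>. This identifies the
  \<open>r\<close>-th singular value of a rank \<open>r\<close> matrix with its smallest positive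
  one.\<close>

lemma nth_of_decreasing_list:
  fixes L :: "real list"
  assumes s: "sorted (rev L)" and len: "length (filter (\<lambda>x. 0 < x) L) = r" and r: "1 \<le> r"
  shows "0 < L ! (r - 1)" "\<And>x. x \<in> set L \<Longrightarrow> 0 < x \<Longrightarrow> L ! (r - 1) \<le> x"
proof -
  define I where "I = {i. i < length L \<and> 0 < L ! i}"
  have cI: "card I = r" using len unfolding I_def length_filter_conv_card .
  have fI: "finite I" by (simp add: I_def)
  have mono: "L ! j \<le> L ! i" if "i \<le> j" "j < length L" for i j
    using sorted_rev_nth_mono[OF s that] .
  show pos: "0 < L ! (r - 1)"
  proof (rule ccontr)
    assume np: "\<not> 0 < L ! (r - 1)"
    have "i < r - 1" if i: "i \<in> I" for i
    proof (rule ccontr)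
      assume "\<not> i < r - 1"
      then have "L ! i \<le> L ! (r - 1)" using i by (intro mono) (auto simp: I_def)
      with np i show False by (auto simp: I_def)
    qed
    then have "I \<subseteq> {..<r - 1}" by auto
    then have "card I \<le> r - 1" using card_mono[of "{..<r - 1}" I] by simp
    with cI r show False by simp
  qed
  have rl: "r \<le> length L" unfolding len[symmetric] by (rule length_filter_le)
  have "{..<r} \<subseteq> I"
  proof
    fix i assume "i \<in> {..<r}"
    then have "i \<le> r - 1" "i < length L" using rl by auto
    then have "L ! (r - 1) \<le> L ! i" using rl r by (intro mono) auto
    then show "i \<in> I" using pos \<open>i < length L\<close> by (auto simp: I_def)
  qed
  then have I: "I = {..<r}" using card_seteq[OF fI, of "{..<r}"] cI by auto
  fix x assume x: "x \<in> set L" "0 < x"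
  then obtain i where i: "i < length L" "L ! i = x" by (auto simp: in_set_conv_nth)
  then have "i < r" using x I by (auto simp: I_def)
  then show "L ! (r - 1) \<le> x" using mono[of i "r - 1"] i rl r by auto
qed

lemma mat_inner_mat_diag:
  assumes "x \<in> carrier_mat n 1"
  shows "mat_inner (mat_diag n f * x) x = (\<Sum>i<n. f i * (x $$ (i,0))\<^sup>2)"
  using assms by (simp add: mat_diag_mult_left[OF assms] mat_inner_def power2_eq_square mult.assoc)

lemma mat_inner_col_sum:
  "x \<in> carrier_mat n 1 \<Longrightarrow> mat_inner x x = (\<Sum>i<n. (x $$ (i,0))\<^sup>2)"
  by (simp add: mat_inner_def power2_eq_square)

lemma psd_mat_inner:
  assumes A: "psd_mat n A" and x: "x \<in> carrier_mat n 1"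
  shows "0 \<le> mat_inner (A * x) x"
proof -
  have Ac: "A \<in> carrier_mat n n" using A by (simp add: psd_mat_def)
  have cx: "col x 0 \<in> carrier_vec n" by (rule col_carrier_vec[OF _ x]) simp
  have "0 \<le> col x 0 \<bullet> (A *\<^sub>v col x 0)" using A cx by (auto simp: psd_mat_def)
  also have "A *\<^sub>v col x 0 = col (A * x) 0" using Ac x by (intro col_mult2[symmetric]) auto
  also have "col x 0 \<bullet> col (A * x) 0 = mat_inner (A * x) x"
    using Ac x by (simp add: mat_inner_def scalar_prod_def atLeast0LessThan mult.commute)
  finally show ?thesis .
qed

text \<open>In the spectral decomposition only the columns with nonzero eigenvalue are kept, scaled
  by the square roots. Then \<open>Z\<^sup>T * Z\<close> is diagonal with exactly the positive
  eigenvalues of \<open>A\<close>, the smallest of which is the \<open>r\<close>-th singular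
  value.\<close>

lemma psd_factorization:
  assumes A: "psd_mat n A" and rk: "mat_rank A = r" and r: "1 \<le> r"
  obtains Z where "Z \<in> carrier_mat n r" "A = Z * Z\<^sup>T" "0 < singular_value r A"
    "\<And>x. x \<in> carrier_mat r 1 \<Longrightarrow> singular_value r A * mat_inner x x \<le> mat_inner (Z * x) (Z * x)"
proof -
  have Ac: "A \<in> carrier_mat n n" and As: "A\<^sup>T = A" using A by (auto simp: psd_mat_def symmetric_mat_def)
  obtain Q d where Q: "Q \<in> carrier_mat n n" "Q\<^sup>T * Q = 1\<^sub>m n" "Q * Q\<^sup>T = 1\<^sub>m n" and AQ: "A = Q * mat_diag n d * Q\<^sup>T"
    using real_spectral_theorem[OF Ac As] by metis
  let ?D = "mat_diag n d"
  have QAQ: "Q\<^sup>T * A * Q = ?D"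
  proof -
    have "Q\<^sup>T * A * Q = (Q\<^sup>T * Q) * ?D * (Q\<^sup>T * Q)" unfolding AQ using Q(1) by (simp add: mat_mult_assoc)
    then show ?thesis unfolding Q(2) by simp
  qed
  \<comment> \<open>\<open>d i\<close> is the value of the quadratic form of \<open>A\<close> at the
    \<open>i\<close>-th column of \<open>Q\<close>.\<close>
  have dnn: "0 \<le> d i" if i: "i < n" for i
  proof -
    let ?e = "unit_col n i"
    have "0 \<le> mat_inner (A * (Q * ?e)) (Q * ?e)" using Q by (intro psd_mat_inner[OF A]) simp
    also have "\<dots> = mat_inner (Q * ?e) (A * (Q * ?e))" using Q Ac by (intro mat_inner_commute) auto
    also have "\<dots> = mat_inner ?e (Q\<^sup>T * (A * (Q * ?e)))" using Q Ac by (intro mat_inner_mult_right) auto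
    also have "Q\<^sup>T * (A * (Q * ?e)) = ?D * ?e" unfolding QAQ[symmetric] using Q(1) Ac by (simp add: mat_mult_assoc)
    also have "mat_inner ?e (?D * ?e) = mat_inner (?D * ?e) ?e" by (intro mat_inner_commute) auto
    also have "\<dots> = (\<Sum>k<n. d k * (?e $$ (k,0))\<^sup>2)" by (intro mat_inner_mat_diag) simp
    also have "\<dots> = (\<Sum>k<n. if k = i then d k else 0)" by (intro sum.cong) (auto simp: unit_col_def)
    also have "\<dots> = d i" using i by simp
    finally show ?thesis .
  qed
  define I where "I = {i. i < n \<and> d i \<noteq> 0}"
  define p where "p = card I"
  have fI: "finite I" by (simp add: I_def)
  obtain g where g: "bij_betw g {0..<p} I" using ex_bij_betw_nat_finite[OF fI] p_def by auto
  have gI: "g j < n" "d (g j) \<noteq> 0" if "j < p" for j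
    using bij_betwE[OF g] that by (auto simp: I_def)
  have ginj: "g j = g k \<longleftrightarrow> j = k" if "j < p" "k < p" for j k
    using bij_betw_imp_inj_on[OF g] that by (auto simp: inj_on_def)
  \<comment> \<open>The nonzero columns of the square root of the diagonal matrix; \<open>g\<close>
    enumerates their positions.\<close>
  define N where "N = mat n p (\<lambda>(i,j). if i = g j then sqrt (d i) else 0)"
  have N: "N \<in> carrier_mat n p" by (simp add: N_def)
  have NTN: "N\<^sup>T * N = mat_diag p (\<lambda>j. d (g j))"
  proof (rule eq_matI)
    fix j k assume "j < dim_row (mat_diag p (\<lambda>j. d (g j)))" "k < dim_col (mat_diag p (\<lambda>j. d (g j)))"
    then have jk: "j < p" "k < p" by auto
    have "(N\<^sup>T * N) $$ (j,k) = (\<Sum>i<n. N $$ (i,j) * N $$ (i,k))"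
      using N jk by (simp add: scalar_prod_def atLeast0LessThan)
    also have "\<dots> = (\<Sum>i<n. if i = g j then (if j = k then d (g j) else 0) else 0)"
      using jk ginj[OF jk] dnn gI by (intro sum.cong) (auto simp: N_def)
    also have "\<dots> = (if j = k then d (g j) else 0)" using gI jk by simp
    finally show "(N\<^sup>T * N) $$ (j,k) = mat_diag p (\<lambda>j. d (g j)) $$ (j,k)" using jk by (simp add: mat_diag_def)
  qed (use N in auto)
  have NNT: "N * N\<^sup>T = ?D"
  proof (rule eq_matI)
    fix i k assume "i < dim_row ?D" "k < dim_col ?D"
    then have ik: "i < n" "k < n" by auto
    have "(N * N\<^sup>T) $$ (i,k) = (\<Sum>j<p. N $$ (i,j) * N $$ (k,j))"
      using N ik by (simp add: scalar_prod_def atLeast0LessThan)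
    also have "\<dots> = (\<Sum>j<p. if i = g j then (if i = k then d (g j) else 0) else 0)"
      using ik dnn by (intro sum.cong) (auto simp: N_def)
    also have "\<dots> = (\<Sum>j\<in>{0..<p}. (\<lambda>l. if i = l then (if i = k then d l else 0) else 0) (g j))"
      by (simp add: atLeast0LessThan)
    also have "\<dots> = (\<Sum>l\<in>I. if i = l then (if i = k then d l else 0) else 0)"
      by (rule sum.reindex_bij_betw[OF g])
    also have "\<dots> = (if i = k then d i else 0)" using fI ik by (auto simp: I_def)
    finally show "(N * N\<^sup>T) $$ (i,k) = ?D $$ (i,k)" using ik by (simp add: mat_diag_def)
  qed (use N in auto)
  define Z where "Z = Q * N"
  have Z: "Z \<in> carrier_mat n p" using Q N by (simp add: Z_def)
  have ZZT: "A = Z * Z\<^sup>T"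
  proof -
    have "Z * Z\<^sup>T = Q * (N * N\<^sup>T) * Q\<^sup>T" unfolding Z_def using Q(1) N by (simp add: mat_expand)
    then show ?thesis unfolding NNT AQ by simp
  qed
  have ZTZ: "Z\<^sup>T * Z = mat_diag p (\<lambda>j. d (g j))"
  proof -
    have "Z\<^sup>T * Z = N\<^sup>T * (Q\<^sup>T * Q) * N" unfolding Z_def using Q(1) N by (simp add: mat_expand)
    then show ?thesis using N NTN by (simp add: Q(2))
  qed
  have rA: "vec_space.rank n A = r" using rk Ac by simp
  \<comment> \<open>\<open>Z\<^sup>T * (A * Z)\<close> is diagonal with nonzero entries, so
    \<open>A * Z\<close> is injective and \<open>p\<close> is at most the rank of \<open>A\<close>;
    conversely \<open>A = Z * Z\<^sup>T\<close> has rank at most \<open>p\<close>.\<close>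
  have "p = r"
  proof (rule antisym)
    have AZ: "A * Z \<in> carrier_mat n p" using Ac Z by simp
    have "Z\<^sup>T * (A * Z) = (Z\<^sup>T * Z) * (Z\<^sup>T * Z)" unfolding ZZT using Z by (simp add: mat_mult_assoc)
    then have ZAZ: "Z\<^sup>T * (A * Z) = mat_diag p (\<lambda>j. d (g j) * d (g j))" unfolding ZTZ by simp
    have "vec_space.rank n (A * Z) = p"
    proof (rule vec_space.rank_eq_nc_if_injective[OF AZ])
      fix v assume v: "v \<in> carrier_vec p" "(A * Z) *\<^sub>v v = 0\<^sub>v n"
      have "mat_diag p (\<lambda>j. d (g j) * d (g j)) *\<^sub>v v = Z\<^sup>T *\<^sub>v ((A * Z) *\<^sub>v v)"
        unfolding ZAZ[symmetric] using Z AZ v by (intro assoc_mult_mat_vec) auto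
      also have "\<dots> = 0\<^sub>v p" unfolding v(2) using Z by (intro eq_vecI) auto
      finally have 0: "mat_diag p (\<lambda>j. d (g j) * d (g j)) *\<^sub>v v = 0\<^sub>v p" .
      show "v = 0\<^sub>v p"
      proof (rule eq_vecI)
        fix j assume "j < dim_vec (0\<^sub>v p :: real vec)"
        then have j: "j < p" by simp
        have "0 = (mat_diag p (\<lambda>j. d (g j) * d (g j)) *\<^sub>v v) $ j" unfolding 0 using j by simp
        also have "\<dots> = (\<Sum>i<p. (if j = i then d (g i) * d (g i) else 0) * v $ i)"
          using v j by (simp add: mat_diag_def scalar_prod_def atLeast0LessThan)
        also have "\<dots> = (\<Sum>i<p. if i = j then d (g j) * d (g j) * v $ i else 0)"
          by (intro sum.cong) auto
        also have "\<dots> = d (g j) * d (g j) * v $ j" using j by simp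
        finally show "v $ j = 0\<^sub>v p $ j" using gI(2)[OF j] j by simp
      qed (use v in auto)
    qed
    then show "p \<le> r" using vec_space.rank_mult_le[OF Ac Z] rA by simp
    show "r \<le> p" using vec_space.rank_mult_le_inner_dim[OF Z, of "Z\<^sup>T" n] Z rA ZZT by simp
  qed
  define L where "L = singular_values A"
  have ATA: "A\<^sup>T * A = Q * mat_diag n (\<lambda>i. d i * d i) * Q\<^sup>T"
  proof -
    have "A\<^sup>T * A = Q * (?D * (Q\<^sup>T * Q) * ?D) * Q\<^sup>T"
      unfolding As unfolding AQ using Q(1) by (simp add: mat_mult_assoc)
    then show ?thesis unfolding Q(2) by simp
  qed
  have "similar_mat (A\<^sup>T * A) (mat_diag n (\<lambda>i. d i * d i))"
    by (rule similar_matI[where n = n and P = Q and Q = "Q\<^sup>T"]) (use Q Ac ATA in auto)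
  then have "char_poly (A\<^sup>T * A) = char_poly (mat_diag n (\<lambda>i. d i * d i))" by (rule char_poly_similar)
  also have "\<dots> = (\<Prod>a\<leftarrow>diag_mat (mat_diag n (\<lambda>i. d i * d i)). [:- a, 1:])"
    by (rule char_poly_upper_triangular[of _ n]) (auto simp: mat_diag_def)
  also have "diag_mat (mat_diag n (\<lambda>i. d i * d i)) = map (\<lambda>i. d i * d i) [0..<n]"
    by (auto simp: diag_mat_def mat_diag_def)
  finally have "proots (char_poly (A\<^sup>T * A)) = mset (map (\<lambda>i. d i * d i) [0..<n])"
    by (simp only: proots_prod_linear)
  then have "image_mset sqrt (proots (char_poly (A\<^sup>T * A))) = mset (map (\<lambda>i. sqrt (d i * d i)) [0..<n])"
    by (simp only: mset_map[symmetric] map_map o_def)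
  \<comment> \<open>Semidefiniteness enters here: the singular values are the eigenvalues
    themselves.\<close>
  also have "map (\<lambda>i. sqrt (d i * d i)) [0..<n] = map d [0..<n]" using dnn by (intro map_cong) auto
  finally have Ldef: "L = rev (sort (map d [0..<n]))" unfolding L_def singular_values_def
    by (simp only: sorted_list_of_multiset_mset)
  have len: "length (filter (\<lambda>x. 0 < x) L) = r"
  proof -
    have "length (filter (\<lambda>x. 0 < x) L) = size (filter_mset (\<lambda>x. 0 < x) (mset L))" by (metis mset_filter size_mset)
    also have "mset L = mset (map d [0..<n])" by (simp add: Ldef)
    also have "size (filter_mset (\<lambda>x. 0 < x) (mset (map d [0..<n]))) = length (filter (\<lambda>x. 0 < x) (map d [0..<n]))"
      by (metis mset_filter size_mset)
    also have "\<dots> = length (filter (\<lambda>i. 0 < d i) [0..<n])" by (simp add: filter_map o_def)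
    also have "\<dots> = card (set (filter (\<lambda>i. 0 < d i) [0..<n]))" by (intro distinct_card[symmetric]) simp
    also have "set (filter (\<lambda>i. 0 < d i) [0..<n]) = I" using dnn by (auto simp: I_def less_le)
    finally show ?thesis using \<open>p = r\<close> p_def by simp
  qed
  have srt: "sorted (rev L)" by (simp add: Ldef)
  have s: "singular_value r A = L ! (r - 1)" by (simp add: singular_value_def L_def)
  have spos: "0 < singular_value r A" unfolding s by (rule nth_of_decreasing_list(1)[OF srt len r])
  have sle: "singular_value r A \<le> d (g j)" if "j < r" for j
  proof -
    have "g j < n" "0 < d (g j)" using gI[of j] dnn[of "g j"] that \<open>p = r\<close> by auto
    then show ?thesis unfolding s by (intro nth_of_decreasing_list(2)[OF srt len r]) (auto simp: Ldef)
  qed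
  have "singular_value r A * mat_inner x x \<le> mat_inner (Z * x) (Z * x)" if x: "x \<in> carrier_mat r 1" for x
  proof -
    have "singular_value r A * mat_inner x x = (\<Sum>i<r. singular_value r A * (x $$ (i,0))\<^sup>2)"
      by (simp add: mat_inner_col_sum[OF x] sum_distrib_left)
    also have "\<dots> \<le> (\<Sum>i<r. d (g i) * (x $$ (i,0))\<^sup>2)" using sle by (intro sum_mono mult_right_mono) auto
    also have "\<dots> = mat_inner (Z\<^sup>T * Z * x) x" unfolding ZTZ \<open>p = r\<close> using mat_inner_mat_diag[OF x] by simp
    also have "Z\<^sup>T * Z * x = Z\<^sup>T * (Z * x)" using Z x \<open>p = r\<close> by (intro mat_mult_assoc) auto
    also have "mat_inner (Z\<^sup>T * (Z * x)) x = mat_inner (Z * x) (Z * x)"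
      using Z x \<open>p = r\<close> by (subst mat_inner_mult_right) auto
    finally show ?thesis .
  qed
  with that[of Z] Z ZZT spos \<open>p = r\<close> show thesis by blast
qed

section \<open>Orthogonal invariance and the polar factor\<close>

lemma fro_norm_orthogonal_left:
  assumes Q: "Q \<in> carrier_mat n m" "Q\<^sup>T * Q = 1\<^sub>m m" and X: "X \<in> carrier_mat m k"
  shows "fro_norm (Q * X) = fro_norm X"
proof -
  have "mat_inner (Q * X) (Q * X) = mat_inner X (Q\<^sup>T * (Q * X))" using Q X by (intro mat_inner_mult_right) auto
  also have "Q\<^sup>T * (Q * X) = (Q\<^sup>T * Q) * X" using Q(1) X by (simp add: mat_mult_assoc)
  finally show ?thesis using X by (simp add: fro_norm_def Q(2))
qed

lemma fro_norm_orthogonal_right: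
  assumes Q: "Q \<in> carrier_mat n m" "Q * Q\<^sup>T = 1\<^sub>m n" and X: "X \<in> carrier_mat k n"
  shows "fro_norm (X * Q) = fro_norm X"
proof -
  have "mat_inner (X * Q) (X * Q) = mat_inner X (X * Q * Q\<^sup>T)" using Q X by (intro mat_inner_mult_left) auto
  also have "X * Q * Q\<^sup>T = X * (Q * Q\<^sup>T)" using Q(1) X by (simp add: mat_mult_assoc)
  finally show ?thesis using X by (simp add: fro_norm_def Q(2))
qed

lemma fro_norm_sq_mat_diag: "(fro_norm (mat_diag n f))\<^sup>2 = (\<Sum>i<n. (f i)\<^sup>2)"
proof -
  have "(\<Sum>j<n. mat_diag n f $$ (i,j) * mat_diag n f $$ (i,j)) = (f i)\<^sup>2" if "i < n" for i
  proof -
    have "(\<Sum>j<n. mat_diag n f $$ (i,j) * mat_diag n f $$ (i,j)) = (\<Sum>j<n. if j = i then (f i)\<^sup>2 else 0)"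
      using that by (intro sum.cong) (auto simp: mat_diag_def power2_eq_square)
    then show ?thesis using that by simp
  qed
  then show ?thesis by (simp add: fro_norm_sq mat_inner_def)
qed

text \<open>\<open>R\<close> is \<open>(W W\<^sup>T)\<^sup>-\<^sup>1\<^sup>/\<^sup>2 W\<close>, and
  \<open>W - R\<close> is the square root of \<open>W W\<^sup>T\<close> minus the identity, times
  \<open>R\<close>. Orthogonality of \<open>R\<close> removes it from the norm, and what remains is
  a comparison of eigenvalues.\<close>

lemma polar_factor:
  assumes W: "W \<in> carrier_mat r r" and le: "fro_norm (1\<^sub>m r - W * W\<^sup>T) \<le> 1 / 2"
  obtains R where "R \<in> carrier_mat r r" "R * R\<^sup>T = 1\<^sub>m r" "fro_norm (W - R) \<le> fro_norm (1\<^sub>m r - W * W\<^sup>T)"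
proof -
  define S where "S = W * W\<^sup>T"
  have S: "S \<in> carrier_mat r r" "S\<^sup>T = S" using W by (auto simp: S_def mat_transpose_mult)
  obtain Q d where Q: "Q \<in> carrier_mat r r" "Q\<^sup>T * Q = 1\<^sub>m r" "Q * Q\<^sup>T = 1\<^sub>m r" and SQ: "S = Q * mat_diag r d * Q\<^sup>T"
    using real_spectral_theorem[OF S] by metis
  have conj: "fro_norm (Q * X * Q\<^sup>T) = fro_norm X" if X: "X \<in> carrier_mat r r" for X
  proof -
    have "fro_norm (Q * X * Q\<^sup>T) = fro_norm (Q * X)"
      using Q X by (intro fro_norm_orthogonal_right[where n = r and m = r]) auto
    then show ?thesis using fro_norm_orthogonal_left[OF Q(1,2) X] by simp
  qed
  have "1\<^sub>m r - S = Q * mat_diag r (\<lambda>i. 1 - d i) * Q\<^sup>T"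
  proof -
    have "mat_diag r (\<lambda>i. 1 - d i) = 1\<^sub>m r - mat_diag r d" by (intro eq_matI) (auto simp: mat_diag_def)
    then show ?thesis unfolding SQ using Q by (simp add: mat_mult_minus mat_minus_mult)
  qed
  then have nS: "fro_norm (1\<^sub>m r - S) = fro_norm (mat_diag r (\<lambda>i. 1 - d i))" using conj[of "mat_diag r (\<lambda>i. 1 - d i)"] by simp
  \<comment> \<open>The hypothesis on the norm keeps the eigenvalues of \<open>W * W\<^sup>T\<close>
    away from zero, so that inverse square roots exist.\<close>
  have d: "1 / 2 \<le> d i" if i: "i < r" for i
  proof -
    have "(1 - d i)\<^sup>2 \<le> (\<Sum>i<r. (1 - d i)\<^sup>2)" using i by (intro member_le_sum) auto
    also have "\<dots> = (fro_norm (1\<^sub>m r - S))\<^sup>2" unfolding nS by (rule fro_norm_sq_mat_diag[symmetric])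
    also have "\<dots> \<le> (1 / 2)\<^sup>2" using le unfolding S_def by (intro power_mono) auto
    finally have "\<bar>1 - d i\<bar> \<le> \<bar>1 / 2\<bar>" unfolding abs_le_square_iff .
    then show ?thesis by linarith
  qed
  define E where "E = mat_diag r (\<lambda>i. 1 / sqrt (d i))"
  define F where "F = mat_diag r (\<lambda>i. sqrt (d i))"
  have E: "E \<in> carrier_mat r r" and F: "F \<in> carrier_mat r r" by (simp_all add: E_def F_def)
  have EDE: "E * (mat_diag r d * E) = 1\<^sub>m r"
    unfolding E_def by (intro eq_matI, simp_all, simp_all add: mat_diag_def) (use d in \<open>force simp: field_simps\<close>)
  have FE: "F * E = 1\<^sub>m r"
    unfolding E_def F_def by (intro eq_matI, simp_all, simp_all add: mat_diag_def) (use d in \<open>force simp: field_simps\<close>)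
  have ET: "E\<^sup>T = E" unfolding E_def by (intro eq_matI) (auto simp: mat_diag_def)
  define P where "P = Q * E * Q\<^sup>T"
  have P: "P \<in> carrier_mat r r" using Q E by (simp add: P_def)
  have PT: "P\<^sup>T = P" unfolding P_def using Q(1) E ET by (simp add: mat_expand)
  define R where "R = P * W"
  have R: "R \<in> carrier_mat r r" using P W by (simp add: R_def)
  have RR: "R * R\<^sup>T = 1\<^sub>m r"
  proof -
    have "R * R\<^sup>T = P * S * P" unfolding R_def S_def using P W PT by (simp add: mat_expand)
    also have "\<dots> = Q * (E * (Q\<^sup>T * Q) * mat_diag r d * (Q\<^sup>T * Q) * E) * Q\<^sup>T"
      unfolding P_def SQ using Q(1) E by (simp add: mat_mult_assoc)
    also have "\<dots> = Q * (E * (mat_diag r d * E)) * Q\<^sup>T" unfolding Q(2) using E by (simp add: mat_mult_assoc)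
    also have "\<dots> = 1\<^sub>m r" unfolding EDE using Q by simp
    finally show ?thesis .
  qed
  have "(Q * F * Q\<^sup>T) * R = W"
  proof -
    have "(Q * F * Q\<^sup>T) * R = Q * (F * (Q\<^sup>T * Q) * E) * Q\<^sup>T * W"
      unfolding R_def P_def using Q(1) E F W by (simp add: mat_mult_assoc)
    also have "F * (Q\<^sup>T * Q) * E = 1\<^sub>m r" unfolding Q(2) using F FE by simp
    finally show ?thesis using Q W by simp
  qed
  moreover have "Q * (F - 1\<^sub>m r) * Q\<^sup>T = Q * F * Q\<^sup>T - 1\<^sub>m r"
    using Q F by (simp add: mat_mult_minus mat_minus_mult)
  ultimately have "W - R = Q * (F - 1\<^sub>m r) * Q\<^sup>T * R"
    using Q(1) F R by (simp add: mat_minus_mult)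
  moreover have F1: "F - 1\<^sub>m r \<in> carrier_mat r r" using F by simp
  then have "Q * (F - 1\<^sub>m r) * Q\<^sup>T \<in> carrier_mat r r"
    using Q(1) by (intro mult_carrier_mat[OF mult_carrier_mat[OF Q(1)]]) auto
  ultimately have "fro_norm (W - R) = fro_norm (Q * (F - 1\<^sub>m r) * Q\<^sup>T)"
    using fro_norm_orthogonal_right[OF R RR] by simp
  also have "\<dots> = fro_norm (F - 1\<^sub>m r)" by (rule conj[OF F1])
  also have "F - 1\<^sub>m r = mat_diag r (\<lambda>i. sqrt (d i) - 1)" unfolding F_def by (intro eq_matI) (auto simp: mat_diag_def)
  also have "fro_norm \<dots> \<le> fro_norm (mat_diag r (\<lambda>i. 1 - d i))"
  proof (rule power2_le_imp_le)
    have "(sqrt (d i) - 1)\<^sup>2 \<le> (1 - d i)\<^sup>2" if i: "i < r" for i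
    proof -
      \<comment> \<open>The second factor \<open>sqrt (d i) + 1\<close> is at least one.\<close>
      have "1 - d i = - ((sqrt (d i) - 1) * (sqrt (d i) + 1))" using d[OF i] by (simp add: algebra_simps)
      then have "(1 - d i)\<^sup>2 = (sqrt (d i) - 1)\<^sup>2 * (sqrt (d i) + 1)\<^sup>2" by (simp add: power_mult_distrib)
      moreover have "1 \<le> (sqrt (d i) + 1)\<^sup>2" using d[OF i] by (intro one_le_power) simp
      ultimately show ?thesis using mult_left_mono[of 1 "(sqrt (d i) + 1)\<^sup>2" "(sqrt (d i) - 1)\<^sup>2"] by simp
    qed
    then show "(fro_norm (mat_diag r (\<lambda>i. sqrt (d i) - 1)))\<^sup>2 \<le> (fro_norm (mat_diag r (\<lambda>i. 1 - d i)))\<^sup>2"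
      unfolding fro_norm_sq_mat_diag by (intro sum_mono) auto
  qed simp
  finally show thesis using that[OF R RR] nS by (simp add: S_def)
qed

subsection \<open>Comparison of Gram matrices\<close>

text \<open>Traces are written as inner products with the identity; this is the trace of
  \<open>Y\<^sup>T * Y\<close>.\<close>

lemma mat_inner_one_transpose_mult:
  assumes "Y \<in> carrier_mat n r"
  shows "mat_inner (1\<^sub>m r) (Y\<^sup>T * Y) = mat_inner Y Y"
proof -
  have "mat_inner (1\<^sub>m r) (Y\<^sup>T * Y) = mat_inner (Y\<^sup>T * Y) (1\<^sub>m r)" using assms by (intro mat_inner_commute) auto
  also have "\<dots> = mat_inner Y Y" using assms by (subst mat_inner_mult_right) auto
  finally show ?thesis .
qed

text \<open>Expanding the squares leaves only the trace of the Gram matrix and of its square, and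
  these agree for \<open>W\<^sup>T * W\<close> and \<open>W * W\<^sup>T\<close>.\<close>

lemma fro_norm_one_minus_gram:
  assumes W: "W \<in> carrier_mat r r"
  shows "fro_norm (1\<^sub>m r - W\<^sup>T * W) = fro_norm (1\<^sub>m r - W * W\<^sup>T)"
proof -
  have "mat_inner (1\<^sub>m r - W\<^sup>T * W) (1\<^sub>m r - W\<^sup>T * W)
      = mat_inner (1\<^sub>m r) (1\<^sub>m r) - 2 * mat_inner W W + mat_inner (W\<^sup>T * W) (W\<^sup>T * W)"
    using mat_inner_one_transpose_mult[OF W] mat_inner_commute[of "W\<^sup>T * W" "1\<^sub>m r"] W
    by (simp add: mat_inner_expand)
  moreover have "mat_inner (1\<^sub>m r - W * W\<^sup>T) (1\<^sub>m r - W * W\<^sup>T)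
      = mat_inner (1\<^sub>m r) (1\<^sub>m r) - 2 * mat_inner W W + mat_inner (W * W\<^sup>T) (W * W\<^sup>T)"
    using mat_inner_one_transpose_mult[of "W\<^sup>T" r r] mat_inner_commute[of "W * W\<^sup>T" "1\<^sub>m r"] W mat_inner_transpose[of W W]
    by (simp add: mat_inner_expand)
  ultimately show ?thesis using mat_inner_self_transpose_mult[of W] by (simp add: fro_norm_def)
qed

lemma fro_norm_lower_bound_mult:
  assumes A: "A \<in> carrier_mat n r" and X: "X \<in> carrier_mat r k"
    and lb: "\<And>x. x \<in> carrier_mat r 1 \<Longrightarrow> c * mat_inner x x \<le> mat_inner (A * x) (A * x)"
  shows "c * mat_inner X X \<le> mat_inner (A * X) (A * X)"
proof -
  have eq: "mat_inner (A\<^sup>T * A * y) y = mat_inner (A * y) (A * y)" if "y \<in> carrier_mat r m" for y m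
  proof -
    have "A\<^sup>T * A * y = A\<^sup>T * (A * y)" using A that by (intro mat_mult_assoc) auto
    then show ?thesis using A that by (simp add: mat_inner_mult_right)
  qed
  have "c * mat_inner X X \<le> mat_inner (A\<^sup>T * A * X) X"
  proof (rule quadratic_form_lower_bound[where m = r and k = k])
    fix x :: "real mat" assume x: "x \<in> carrier_mat r 1"
    show "c * mat_inner x x \<le> mat_inner (A\<^sup>T * A * x) x" unfolding eq[OF x] by (rule lb[OF x])
  qed (use A X in auto)
  then show ?thesis unfolding eq[OF X] .
qed

text \<open>\<open>A * W\<close> is the orthogonal projection of \<open>B\<close> to the column
  space of \<open>A\<close>. Relative to this space and its complement,
  \<open>A * A\<^sup>T - B * B\<^sup>T\<close> falls into four mutually orthogonal blocks, whose
  norms add up. It is applied in both roles: \<open>Z\<close> along \<open>U\<close> for the main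
  estimate, \<open>U\<close> along \<open>Z\<close> to find the nearby minimizer.\<close>

lemma orthogonal_decomposition:
  assumes A: "A \<in> carrier_mat n r" and B: "B \<in> carrier_mat n r" and c: "0 < c"
    and lb: "\<And>x. x \<in> carrier_mat r 1 \<Longrightarrow> c * mat_inner x x \<le> mat_inner (A * x) (A * x)"
  obtains W Y where "W \<in> carrier_mat r r" "Y \<in> carrier_mat n r" "B = A * W + Y" "A\<^sup>T * Y = 0\<^sub>m r r"
    "c\<^sup>2 * (fro_norm (1\<^sub>m r - W * W\<^sup>T))\<^sup>2 \<le> (fro_norm (A * A\<^sup>T - B * B\<^sup>T))\<^sup>2"
    "2 * c * (fro_norm Y)\<^sup>2 \<le> (fro_norm (A * A\<^sup>T - B * B\<^sup>T))\<^sup>2"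
    "c * (fro_norm W)\<^sup>2 \<le> (fro_norm B)\<^sup>2" "(fro_norm Y)\<^sup>2 \<le> (fro_norm B)\<^sup>2"
proof -
  note LB = fro_norm_lower_bound_mult[OF A _ lb]
  have ATA: "A\<^sup>T * A \<in> carrier_mat r r" using A by simp
  obtain J where J: "J \<in> carrier_mat r r" "A\<^sup>T * A * J = 1\<^sub>m r"
  proof (rule mat_one_cases[OF ATA])
    fix x assume x: "x \<in> carrier_mat r 1" "x \<noteq> 0\<^sub>m r 1" "A\<^sup>T * A * x = 0\<^sub>m r 1"
    have "A\<^sup>T * (A * x) = A\<^sup>T * A * x" using A x by (intro mat_mult_assoc[symmetric]) auto
    then have "mat_inner (A * x) (A * x) = 0" using A x by (simp add: mat_inner_mult_right)
    then have "c * mat_inner x x \<le> 0" using lb[OF x(1)] by simp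
    moreover have "0 < mat_inner x x" using fro_norm_pos[OF x(1,2)] by (simp add: fro_norm_sq[symmetric])
    ultimately show thesis using c by (simp add: mult_le_0_iff)
  qed (use that in auto)
  \<comment> \<open>The solution of the normal equations \<open>A\<^sup>T A W = A\<^sup>T B\<close>,
    with \<open>J\<close> the inverse of \<open>A\<^sup>T A\<close>.\<close>
  define W where "W = J * (A\<^sup>T * B)"
  define Y where "Y = B - A * W"
  have W: "W \<in> carrier_mat r r" using J A B by (simp add: W_def)
  have Y: "Y \<in> carrier_mat n r" using A B W by (simp add: Y_def)
  have BW: "B = A * W + Y" unfolding Y_def using A B W by (intro eq_matI) auto
  have AY: "A\<^sup>T * Y = 0\<^sub>m r r"
  proof -
    have "A\<^sup>T * (A * W) = (A\<^sup>T * A * J) * (A\<^sup>T * B)" unfolding W_def using A B J(1) by (simp add: mat_mult_assoc)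
    also have "\<dots> = A\<^sup>T * B" unfolding J(2) using A B by simp
    finally have "A\<^sup>T * Y = A\<^sup>T * B - A\<^sup>T * B" unfolding Y_def using A B W by (simp add: mat_mult_minus)
    then show ?thesis using A B by (simp add: minus_r_inv_mat[of _ r r])
  qed
  have YA: "Y\<^sup>T * A = 0\<^sub>m r r"
  proof -
    have "Y\<^sup>T * A = (A\<^sup>T * Y)\<^sup>T" using A Y by (simp add: mat_transpose_mult)
    then show ?thesis unfolding AY by simp
  qed
  have right: "mat_inner (X * A\<^sup>T) (V * Y\<^sup>T) = 0" if "X \<in> carrier_mat n r" "V \<in> carrier_mat n r" for X V
  proof -
    have "mat_inner (X * A\<^sup>T) (V * Y\<^sup>T) = mat_inner X (V * Y\<^sup>T * A\<^sup>T\<^sup>T)" using that A Y by (intro mat_inner_mult_left) auto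
    also have "V * Y\<^sup>T * A\<^sup>T\<^sup>T = V * (Y\<^sup>T * A)" using that A Y by (simp add: mat_mult_assoc)
    finally show ?thesis unfolding YA using that by simp
  qed
  have left: "mat_inner (A * X) (Y * V) = 0" if "X \<in> carrier_mat r k" "V \<in> carrier_mat r k" for X V k
  proof -
    have "mat_inner (A * X) (Y * V) = mat_inner X (A\<^sup>T * (Y * V))" using that A Y by (intro mat_inner_mult_right) auto
    also have "A\<^sup>T * (Y * V) = (A\<^sup>T * Y) * V" using that A Y by (simp add: mat_mult_assoc)
    finally show ?thesis unfolding AY using that by simp
  qed
  define S where "S = 1\<^sub>m r - W * W\<^sup>T"
  have S: "S \<in> carrier_mat r r" "S\<^sup>T = S" using W by (auto simp: S_def mat_transpose_minus mat_transpose_mult)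
  define T1 where "T1 = A * S * A\<^sup>T"
  define T2 where "T2 = A * W * Y\<^sup>T"
  define T3 where "T3 = Y * W\<^sup>T * A\<^sup>T"
  define T4 where "T4 = Y * Y\<^sup>T"
  have T: "T1 \<in> carrier_mat n n" "T2 \<in> carrier_mat n n" "T3 \<in> carrier_mat n n" "T4 \<in> carrier_mat n n"
    using A S W Y by (auto simp: T1_def T2_def T3_def T4_def)
  have T1': "T1 = A * (S * A\<^sup>T)" and T2': "T2 = A * (W * Y\<^sup>T)" and T3': "T3 = Y * (W\<^sup>T * A\<^sup>T)"
    unfolding T1_def T2_def T3_def using A S W Y by (simp_all add: mat_mult_assoc)
  define E where "E = A * A\<^sup>T - B * B\<^sup>T"
  have E: "E = T1 - T2 - T3 - T4"
  proof -
    have "B * B\<^sup>T = A * (W * (W\<^sup>T * A\<^sup>T)) + T2 + T3 + T4"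
      unfolding BW T2_def T3_def T4_def using A W Y by (simp add: mat_expand) (intro eq_matI, auto)
    moreover have "T1 = A * A\<^sup>T - A * (W * (W\<^sup>T * A\<^sup>T))"
      unfolding T1_def S_def using A W by (simp add: mat_expand)
    ultimately show ?thesis unfolding E_def using A W T by simp (intro eq_matI, auto)
  qed
  have o12: "mat_inner T1 T2 = 0" unfolding T1_def T2_def using A S W by (intro right) auto
  have o13: "mat_inner T1 T3 = 0" unfolding T1' T3' using A S W by (intro left[of _ n]) auto
  have o14: "mat_inner T1 T4 = 0" unfolding T1_def T4_def using A S Y by (intro right) auto
  have o23: "mat_inner T2 T3 = 0" unfolding T2' T3' using A W Y by (intro left[of _ n]) auto
  have o24: "mat_inner T2 T4 = 0" unfolding T2' T4_def using W Y by (intro left[of _ n]) auto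
  have o34: "mat_inner T3 T4 = 0" unfolding T3_def T4_def using W Y by (intro right) auto
  note com = mat_inner_commute[of T2 T1] mat_inner_commute[of T3 T1] mat_inner_commute[of T4 T1]
    mat_inner_commute[of T3 T2] mat_inner_commute[of T4 T2] mat_inner_commute[of T4 T3]
  have nE: "mat_inner E E = mat_inner T1 T1 + mat_inner T2 T2 + mat_inner T3 T3 + mat_inner T4 T4"
    unfolding E using T o12 o13 o14 o23 o24 o34 com by (simp add: mat_inner_expand)
  have "T3 = T2\<^sup>T" unfolding T2_def T3_def using A W Y by (simp add: mat_expand)
  then have n3: "mat_inner T3 T3 = mat_inner T2 T2" by (simp add: mat_inner_transpose)
  have n2: "c * mat_inner (W * Y\<^sup>T) (W * Y\<^sup>T) \<le> mat_inner T2 T2" unfolding T2' using W Y by (intro LB[where k = n]) auto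
  \<comment> \<open>The lower bound for \<open>A\<close> is used on both sides of \<open>S\<close>,
    whence the square of \<open>c\<close>.\<close>
  have n1: "c\<^sup>2 * mat_inner S S \<le> mat_inner T1 T1"
  proof -
    have "S * A\<^sup>T = (A * S)\<^sup>T" using A S by (simp add: mat_transpose_mult)
    then have "mat_inner (S * A\<^sup>T) (S * A\<^sup>T) = mat_inner (A * S) (A * S)" by (simp add: mat_inner_transpose)
    also have "\<dots> \<ge> c * mat_inner S S" using S by (intro LB[where k = r]) auto
    finally have "c * (c * mat_inner S S) \<le> c * mat_inner (S * A\<^sup>T) (S * A\<^sup>T)" using c by simp
    also have "\<dots> \<le> mat_inner T1 T1" unfolding T1' using A S by (intro LB[where k = n]) auto
    finally show ?thesis by (simp add: power2_eq_square mult.assoc)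
  qed
  define b where "b = mat_inner (W * Y\<^sup>T) (W * Y\<^sup>T)"
  define t where "t = mat_inner T4 T4"
  have t0: "0 \<le> t" "0 \<le> b" by (simp_all add: t_def b_def)
  have key: "c\<^sup>2 * mat_inner S S + 2 * c * b + t \<le> mat_inner E E"
    using nE n3 n2 n1 by (simp add: b_def t_def)
  have YY: "Y\<^sup>T * Y \<in> carrier_mat r r" and WW: "W\<^sup>T * W \<in> carrier_mat r r" using Y W by auto
  have tY: "mat_inner (Y\<^sup>T * Y) (Y\<^sup>T * Y) = t" unfolding t_def T4_def by (rule mat_inner_self_transpose_mult[symmetric])
  have bW: "mat_inner (W\<^sup>T * W) (Y\<^sup>T * Y) = b"
  proof -
    have "mat_inner (W\<^sup>T * W) (Y\<^sup>T * Y) = mat_inner W (W * (Y\<^sup>T * Y))" using W Y by (subst mat_inner_mult_right) auto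
    also have "W * (Y\<^sup>T * Y) = (W * Y\<^sup>T) * Y" using W Y by (simp add: mat_mult_assoc)
    also have "mat_inner W (W * Y\<^sup>T * Y) = mat_inner (W * Y\<^sup>T * Y) W" using W Y by (intro mat_inner_commute) auto
    also have "\<dots> = b" unfolding b_def using W Y by (subst mat_inner_mult_left) auto
    finally show ?thesis .
  qed
  define S' where "S' = 1\<^sub>m r - W\<^sup>T * W"
  have S': "S' \<in> carrier_mat r r" using WW by (simp add: S'_def)
  have SS: "mat_inner S' S' = mat_inner S S"
    using fro_norm_one_minus_gram[OF W] by (simp add: S_def S'_def fro_norm_def)
  \<comment> \<open>The term \<open>b\<close> that is subtracted here is what the two off-diagonal
    blocks contribute to \<open>key\<close>, with the same factor \<open>2 * c\<close>; the two
    cancel below.\<close>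
  have cross: "mat_inner S' (Y\<^sup>T * Y) = mat_inner Y Y - b"
    unfolding S'_def using W Y YY WW mat_inner_one_transpose_mult[OF Y] bW by (simp add: mat_inner_expand)
  \<comment> \<open>The bound on \<open>Y\<close> is the nonnegativity of the square of \<open>c (1 - W\<^sup>T W) - Y\<^sup>T Y\<close>.\<close>
  have "0 \<le> mat_inner (c \<cdot>\<^sub>m S' - Y\<^sup>T * Y) (c \<cdot>\<^sub>m S' - Y\<^sup>T * Y)" by simp
  also have "\<dots> = c\<^sup>2 * mat_inner S S - 2 * c * mat_inner S' (Y\<^sup>T * Y) + t"
    using S' Y tY SS mat_inner_commute[of "Y\<^sup>T * Y" S'] by (simp add: mat_inner_expand power2_eq_square algebra_simps)
  finally have "2 * c * mat_inner Y Y \<le> mat_inner E E" using key unfolding cross by (simp add: algebra_simps)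
  moreover have "c\<^sup>2 * mat_inner S S \<le> mat_inner E E" using key t0 c by (smt (verit) mult_nonneg_nonneg)
  moreover have nB: "mat_inner B B = mat_inner (A * W) (A * W) + mat_inner Y Y"
  proof -
    have "mat_inner (A * W) Y = 0" using left[OF W, of "1\<^sub>m r"] Y by simp
    then show ?thesis unfolding BW using A W Y mat_inner_commute[of Y "A * W"] by (simp add: mat_inner_expand)
  qed
  moreover have "c * mat_inner W W \<le> mat_inner (A * W) (A * W)" by (rule LB[OF W])
  ultimately show thesis
    using that[OF W Y BW AY] mat_inner_nonneg[of Y] mat_inner_nonneg[of "A * W"]
    unfolding fro_norm_sq S_def[symmetric] E_def[symmetric] by linarith
qed

text \<open>The trace of \<open>U\<^sup>T * U\<close> is at most its norm times that of the
  \<open>r\<close> by \<open>r\<close> identity, which is \<open>sqrt r\<close>, rounded up to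
  \<open>r\<close>.\<close>

lemma fro_norm_sq_le_gram:
  assumes U: "U \<in> carrier_mat n r"
  shows "(fro_norm U)\<^sup>2 \<le> real r * fro_norm (U * U\<^sup>T)"
proof -
  have "(fro_norm (1\<^sub>m r))\<^sup>2 = real r" using fro_norm_sq_mat_diag[of r "\<lambda>_. 1"] by simp
  also have "\<dots> \<le> (real r)\<^sup>2" by (cases r) (auto simp: power2_eq_square)
  finally have r: "fro_norm (1\<^sub>m r) \<le> real r" by (rule power2_le_imp_le) simp
  have "(fro_norm U)\<^sup>2 = mat_inner (1\<^sub>m r) (U\<^sup>T * U)"
    unfolding mat_inner_one_transpose_mult[OF U] fro_norm_sq ..
  also have "\<dots> \<le> fro_norm (1\<^sub>m r) * fro_norm (U\<^sup>T * U)" using U by (intro mat_inner_le) auto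
  also have "\<dots> \<le> real r * fro_norm (U\<^sup>T * U)" using r by (rule mult_right_mono) simp
  also have "fro_norm (U\<^sup>T * U) = fro_norm (U * U\<^sup>T)" by (simp add: fro_norm_def mat_inner_self_transpose_mult)
  finally show ?thesis .
qed

text \<open>With \<open>U = Z W + Y\<close>, the threshold \<open>s / 2\<close> makes
  \<open>W W\<^sup>T\<close> differ from the identity by at most \<open>1 / 2\<close>. This serves
  two purposes: \<open>W\<^sup>T W\<close> is bounded below by \<open>1 / 2\<close>, which will
  exclude a small eigenvalue of \<open>U\<^sup>T U\<close>, and \<open>W\<close> has a polar
  factor.\<close>

lemma gram_close_imp_factor_close:
  assumes Z: "Z \<in> carrier_mat n r" and U: "U \<in> carrier_mat n r" and s: "0 < s"
    and lb: "\<And>x. x \<in> carrier_mat r 1 \<Longrightarrow> s * mat_inner x x \<le> mat_inner (Z * x) (Z * x)"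
  defines "E \<equiv> fro_norm (U * U\<^sup>T - Z * Z\<^sup>T)"
  assumes E: "E \<le> s / 2"
  shows "\<And>x. x \<in> carrier_mat r 1 \<Longrightarrow> s / 2 * mat_inner x x \<le> mat_inner (U * x) (U * x)"
    and "\<exists>R \<in> carrier_mat r r. R * R\<^sup>T = 1\<^sub>m r \<and> fro_norm (U - Z * R) \<le> E * (fro_norm Z / s + 1 / sqrt (2 * s))"
proof -
  have E0: "0 \<le> E" by (simp add: E_def)
  have "fro_norm (Z * Z\<^sup>T - U * U\<^sup>T) = E" unfolding E_def using Z U by (intro fro_norm_minus_commute) auto
  then obtain W Y where W: "W \<in> carrier_mat r r" and Y: "Y \<in> carrier_mat n r" and UZ: "U = Z * W + Y"
    and ZY: "Z\<^sup>T * Y = 0\<^sub>m r r" and bW: "s\<^sup>2 * (fro_norm (1\<^sub>m r - W * W\<^sup>T))\<^sup>2 \<le> E\<^sup>2"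
    and bY: "2 * s * (fro_norm Y)\<^sup>2 \<le> E\<^sup>2"
    using orthogonal_decomposition[OF Z U s lb] by metis
  have "(fro_norm (1\<^sub>m r - W * W\<^sup>T))\<^sup>2 \<le> (E / s)\<^sup>2" using bW s by (simp add: power_divide field_simps)
  then have nW: "fro_norm (1\<^sub>m r - W * W\<^sup>T) \<le> E / s" by (rule power2_le_imp_le) (use s E0 in simp)
  also have "\<dots> \<le> 1 / 2" using E s by (simp add: field_simps)
  finally have nW2: "fro_norm (1\<^sub>m r - W * W\<^sup>T) \<le> 1 / 2" .
  have "(fro_norm Y)\<^sup>2 \<le> (E / sqrt (2 * s))\<^sup>2" using bY s by (simp add: power_divide field_simps)
  then have nY: "fro_norm Y \<le> E / sqrt (2 * s)" by (rule power2_le_imp_le) (use s E0 in simp)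
  show "s / 2 * mat_inner x x \<le> mat_inner (U * x) (U * x)" if x: "x \<in> carrier_mat r 1" for x
  proof -
    have Wx: "W * x \<in> carrier_mat r 1" and Yx: "Y * x \<in> carrier_mat n 1" using W Y x by auto
    have WW: "W\<^sup>T * W \<in> carrier_mat r r" using W by simp
    have cross: "mat_inner (Z * (W * x)) (Y * x) = 0"
    proof -
      have "mat_inner (Z * (W * x)) (Y * x) = mat_inner (W * x) (Z\<^sup>T * (Y * x))" using Z Wx Yx by (intro mat_inner_mult_right) auto
      also have "Z\<^sup>T * (Y * x) = (Z\<^sup>T * Y) * x" using Z Y x by (simp add: mat_mult_assoc)
      also have "mat_inner (W * x) \<dots> = 0" unfolding ZY using W x by simp
      finally show ?thesis .
    qed
    have "U * x = Z * (W * x) + Y * x" unfolding UZ using Z W Y x by (simp add: mat_add_mult mat_mult_assoc)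
    then have "mat_inner (U * x) (U * x) = mat_inner (Z * (W * x)) (Z * (W * x)) + mat_inner (Y * x) (Y * x)"
      using Z Wx Yx cross mat_inner_commute[of "Y * x" "Z * (W * x)"] W Y x by (simp add: mat_inner_expand)
    then have 1: "s * mat_inner (W * x) (W * x) \<le> mat_inner (U * x) (U * x)"
      using lb[OF Wx] mat_inner_nonneg[of "Y * x"] by linarith
    have "mat_inner ((1\<^sub>m r - W\<^sup>T * W) * x) x \<le> fro_norm ((1\<^sub>m r - W\<^sup>T * W) * x) * fro_norm x"
      using W x by (intro mat_inner_le) auto
    also have "\<dots> \<le> fro_norm (1\<^sub>m r - W\<^sup>T * W) * fro_norm x * fro_norm x"
      using W x by (intro mult_right_mono fro_norm_mult_le) auto
    also have "\<dots> \<le> 1 / 2 * fro_norm x * fro_norm x"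
      using nW2 unfolding fro_norm_one_minus_gram[OF W] by (intro mult_right_mono) auto
    also have "\<dots> = 1 / 2 * mat_inner x x" by (simp add: fro_norm_sq[symmetric] power2_eq_square)
    also have "mat_inner ((1\<^sub>m r - W\<^sup>T * W) * x) x = mat_inner x x - mat_inner (W\<^sup>T * (W * x)) x"
      using W x by (simp add: mat_minus_mult mat_mult_assoc mat_inner_expand)
    also have "mat_inner (W\<^sup>T * (W * x)) x = mat_inner (W * x) (W * x)" using W x by (simp add: mat_inner_mult_right)
    finally have "1 / 2 * mat_inner x x \<le> mat_inner (W * x) (W * x)" by simp
    then have "s * (1 / 2 * mat_inner x x) \<le> s * mat_inner (W * x) (W * x)" using s by (intro mult_left_mono) auto
    then show ?thesis using 1 by simp
  qed
  obtain R where R: "R \<in> carrier_mat r r" "R * R\<^sup>T = 1\<^sub>m r" "fro_norm (W - R) \<le> fro_norm (1\<^sub>m r - W * W\<^sup>T)"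
    using polar_factor[OF W nW2] by blast
  have WR: "W - R \<in> carrier_mat r r" using R by simp
  \<comment> \<open>The two errors are the distance of \<open>W\<close> to its polar factor and the
    part of \<open>U\<close> orthogonal to \<open>Z\<close>.\<close>
  have "U - Z * R = Z * (W - R) + Y"
    unfolding UZ using Z W Y R by (simp add: mat_mult_minus) (intro eq_matI, auto)
  then have "fro_norm (U - Z * R) \<le> fro_norm (Z * (W - R)) + fro_norm Y"
    using fro_norm_add_le[of "Z * (W - R)" Y] Z WR R Y by simp
  also have "fro_norm (Z * (W - R)) \<le> fro_norm Z * fro_norm (W - R)" using Z R by (intro fro_norm_mult_le) auto
  also have "\<dots> \<le> fro_norm Z * (E / s)" using R(3) nW by (intro mult_left_mono) auto
  finally have "fro_norm (U - Z * R) \<le> E * (fro_norm Z / s + 1 / sqrt (2 * s))"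
    using nY by (simp add: algebra_simps)
  then show "\<exists>R \<in> carrier_mat r r. R * R\<^sup>T = 1\<^sub>m r \<and> fro_norm (U - Z * R) \<le> E * (fro_norm Z / s + 1 / sqrt (2 * s))"
    using R by blast
qed

subsection \<open>Gradients and Hessians\<close>

lemma has_gradient_unique:
  assumes G: "has_gradient n m F X G" and H: "has_gradient n m F X H"
  shows "G = H"
proof (rule ccontr)
  assume "G \<noteq> H"
  have c: "G \<in> carrier_mat n m" "H \<in> carrier_mat n m" using G H by (auto simp: has_gradient_def)
  define D where "D = G - H"
  have D: "D \<in> carrier_mat n m" using c by (auto simp: D_def)
  have "D \<noteq> 0\<^sub>m n m" using mat_minus_eq_0D[OF c] \<open>G \<noteq> H\<close> by (auto simp: D_def)
  then have nD: "0 < fro_norm D" using fro_norm_pos[OF D] by simp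
  \<comment> \<open>Two approximation errors of this size stay together below the norm of
    \<open>D\<close>.\<close>
  define e where "e = fro_norm D / 3"
  have e: "e > 0" using nD by (simp add: e_def)
  obtain d1 where d1: "d1 > 0" "\<And>K. K \<in> carrier_mat n m \<Longrightarrow> fro_norm K < d1 \<Longrightarrow>
      \<bar>F (X + K) - F X - mat_inner G K\<bar> \<le> e * fro_norm K"
    using G e unfolding has_gradient_def by blast
  obtain d2 where d2: "d2 > 0" "\<And>K. K \<in> carrier_mat n m \<Longrightarrow> fro_norm K < d2 \<Longrightarrow>
      \<bar>F (X + K) - F X - mat_inner H K\<bar> \<le> e * fro_norm K"
    using H e unfolding has_gradient_def by blast
  define t where "t = min d1 d2 / (2 * fro_norm D)"
  have t: "t > 0" using d1 d2 nD by (simp add: t_def)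
  define K where "K = t \<cdot>\<^sub>m D"
  have K: "K \<in> carrier_mat n m" using D by (simp add: K_def)
  have nK: "fro_norm K = t * fro_norm D" using t by (simp add: K_def fro_norm_smult)
  have "fro_norm K = min d1 d2 / 2" using nD by (simp add: nK t_def)
  then have "fro_norm K < d1" "fro_norm K < d2" using d1 d2 by auto
  from d1(2)[OF K this(1)] d2(2)[OF K this(2)]
  have "mat_inner G K - mat_inner H K \<le> 2 * e * fro_norm K" by linarith
  also have "mat_inner G K - mat_inner H K = t * (fro_norm D)\<^sup>2"
    using c D by (simp add: K_def D_def fro_norm_sq mat_inner_expand algebra_simps)
  finally have "t * (fro_norm D)\<^sup>2 \<le> 2 / 3 * (t * (fro_norm D)\<^sup>2)"
    by (simp add: nK e_def power2_eq_square)
  moreover have "t * (fro_norm D)\<^sup>2 > 0" using t nD by simp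
  ultimately show False by linarith
qed

lemma gradient_eqI: "has_gradient n m F X G \<Longrightarrow> gradient n m F X = G"
  unfolding gradient_def using has_gradient_unique by blast

text \<open>\<open>hessian\<close> is a \<open>SOME\<close>; this determines its values on the
  carrier, so that an operator computed by hand can replace it.\<close>

lemma has_hessian_unique:
  assumes S: "has_hessian n m F X S" and T: "has_hessian n m F X T" and K: "K \<in> carrier_mat n m"
    and gc: "\<And>Y. Y \<in> carrier_mat n m \<Longrightarrow> gradient n m F Y \<in> carrier_mat n m" and X: "X \<in> carrier_mat n m"
  shows "S K = T K"
proof (rule ccontr)
  assume ne: "S K \<noteq> T K"
  have c: "S K \<in> carrier_mat n m" "T K \<in> carrier_mat n m"
    using S T K by (auto simp: has_hessian_def linear_op_def)
  define D where "D = S K - T K"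
  have D: "D \<in> carrier_mat n m" using c by (auto simp: D_def)
  have "D \<noteq> 0\<^sub>m n m" using mat_minus_eq_0D[OF c] ne by (auto simp: D_def)
  then have nD: "0 < fro_norm D" using fro_norm_pos[OF D] by simp
  \<comment> \<open>One is added so that division is safe even if \<open>K\<close> is zero.\<close>
  define k where "k = fro_norm K + 1"
  have K1: "0 < k" "fro_norm K < k" by (simp_all add: k_def add_nonneg_pos)
  define e where "e = fro_norm D / (3 * k)"
  have e: "e > 0" using nD K1 by (simp add: e_def)
  obtain d1 where d1: "d1 > 0" "\<And>K. K \<in> carrier_mat n m \<Longrightarrow> fro_norm K < d1 \<Longrightarrow>
      fro_norm (gradient n m F (X + K) - gradient n m F X - S K) \<le> e * fro_norm K"
    using S e unfolding has_hessian_def by blast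
  obtain d2 where d2: "d2 > 0" "\<And>K. K \<in> carrier_mat n m \<Longrightarrow> fro_norm K < d2 \<Longrightarrow>
      fro_norm (gradient n m F (X + K) - gradient n m F X - T K) \<le> e * fro_norm K"
    using T e unfolding has_hessian_def by blast
  define t where "t = min d1 d2 / (2 * k)"
  have t: "t > 0" using d1 d2 K1 by (simp add: t_def)
  define L where "L = t \<cdot>\<^sub>m K"
  have L: "L \<in> carrier_mat n m" using K by (simp add: L_def)
  have nL: "fro_norm L = t * fro_norm K" using t by (simp add: L_def fro_norm_smult)
  have "t * k = min d1 d2 / 2" using K1 by (simp add: t_def)
  moreover have "fro_norm L < t * k" unfolding nL using K1(2) t by simp
  ultimately have l: "fro_norm L < d1" "fro_norm L < d2" using d1(1) d2(1) by linarith+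
  have SL: "S L = t \<cdot>\<^sub>m S K" "T L = t \<cdot>\<^sub>m T K"
    using S T K by (auto simp: L_def has_hessian_def linear_op_def)
  define g where "g = gradient n m F (X + L) - gradient n m F X"
  have g: "g \<in> carrier_mat n m" using gc[of "X + L"] gc[OF X] X L by (auto simp: g_def)
  have "t * fro_norm D = fro_norm ((g - T L) - (g - S L))"
  proof -
    have "(g - T L) - (g - S L) = t \<cdot>\<^sub>m D"
      unfolding SL D_def using g c by (intro eq_matI) (auto simp: algebra_simps)
    then show ?thesis using t by (simp add: fro_norm_smult)
  qed
  also have "\<dots> \<le> fro_norm (g - T L) + fro_norm (g - S L)"
    unfolding SL using g c by (intro fro_norm_diff_le) auto
  also have "\<dots> \<le> 2 * e * fro_norm L" using d1(2)[OF L l(1)] d2(2)[OF L l(2)] by (simp add: g_def)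
  also have "\<dots> = t * (2 * e * fro_norm K)" by (simp add: nL)
  finally have "fro_norm D \<le> 2 * e * fro_norm K" using t by simp
  also have "\<dots> \<le> 2 * e * k" using e K1 by simp
  also have "\<dots> = 2 / 3 * fro_norm D" using K1 by (simp add: e_def)
  finally show False using nD by simp
qed

section \<open>Derivatives along lines\<close>

lemma real_derivative_epsI:
  fixes f :: "real \<Rightarrow> real"
  assumes "\<And>e. 0 < e \<Longrightarrow> \<exists>d>0. \<forall>y. \<bar>y - t\<bar> < d \<longrightarrow> \<bar>f y - f t - D * (y - t)\<bar> \<le> e * \<bar>y - t\<bar>"
  shows "(f has_real_derivative D) (at t)"
proof -
  have "(\<lambda>h. (f (t + h) - f t) / h) \<midarrow>0\<rightarrow> D"
    unfolding LIM_eq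
  proof (intro allI impI)
    fix r :: real assume r: "0 < r"
    then obtain d where d: "d > 0" "\<And>y. \<bar>y - t\<bar> < d \<Longrightarrow> \<bar>f y - f t - D * (y - t)\<bar> \<le> r / 2 * \<bar>y - t\<bar>"
      using assms[of "r / 2"] by auto
    show "\<exists>s>0. \<forall>h. h \<noteq> 0 \<and> norm (h - 0) < s \<longrightarrow> norm ((f (t + h) - f t) / h - D) < r"
    proof (intro exI[of _ d] conjI allI impI)
      fix h :: real assume h: "h \<noteq> 0 \<and> norm (h - 0) < d"
      have "(f (t + h) - f t) / h - D = (f (t + h) - f t - D * h) / h" using h by (simp add: field_simps)
      also have "\<bar>\<dots>\<bar> \<le> r / 2" using d(2)[of "t + h"] h by (simp add: abs_divide divide_le_eq)
      finally show "norm ((f (t + h) - f t) / h - D) < r" using r by simp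
    qed (rule d)
  qed
  then show ?thesis by (simp add: DERIV_def)
qed

lemma gradient_line_derivative:
  assumes g: "has_gradient n m F (X + t \<cdot>\<^sub>m K) G" and X: "X \<in> carrier_mat n m" and K: "K \<in> carrier_mat n m"
  shows "((\<lambda>s. F (X + s \<cdot>\<^sub>m K)) has_real_derivative mat_inner G K) (at t)"
proof (rule real_derivative_epsI)
  fix e :: real assume "0 < e"
  have K1: "0 < fro_norm K + 1" by (simp add: add_nonneg_pos)
  define e' where "e' = e / (fro_norm K + 1)"
  have e': "0 < e'" using \<open>0 < e\<close> K1 by (simp add: e'_def)
  have Gc: "G \<in> carrier_mat n m" using g by (simp add: has_gradient_def)
  obtain d where d: "d > 0" "\<And>L. L \<in> carrier_mat n m \<Longrightarrow> fro_norm L < d \<Longrightarrow>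
      \<bar>F (X + t \<cdot>\<^sub>m K + L) - F (X + t \<cdot>\<^sub>m K) - mat_inner G L\<bar> \<le> e' * fro_norm L"
    using g e' unfolding has_gradient_def by blast
  show "\<exists>d>0. \<forall>y. \<bar>y - t\<bar> < d \<longrightarrow> \<bar>F (X + y \<cdot>\<^sub>m K) - F (X + t \<cdot>\<^sub>m K) - mat_inner G K * (y - t)\<bar> \<le> e * \<bar>y - t\<bar>"
  proof (intro exI[of _ "d / (fro_norm K + 1)"] conjI allI impI)
    show "0 < d / (fro_norm K + 1)" using d K1 by simp
    fix y assume y: "\<bar>y - t\<bar> < d / (fro_norm K + 1)"
    define L where "L = (y - t) \<cdot>\<^sub>m K"
    have L: "L \<in> carrier_mat n m" using K by (simp add: L_def)
    have "fro_norm L = \<bar>y - t\<bar> * fro_norm K" by (simp add: L_def fro_norm_smult)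
    also have "\<dots> \<le> \<bar>y - t\<bar> * (fro_norm K + 1)" by (simp add: mult_left_mono)
    finally have nL: "fro_norm L \<le> \<bar>y - t\<bar> * (fro_norm K + 1)" .
    also have "\<dots> < d" using y K1 by (simp add: field_simps)
    finally have "\<bar>F (X + t \<cdot>\<^sub>m K + L) - F (X + t \<cdot>\<^sub>m K) - mat_inner G L\<bar> \<le> e' * fro_norm L"
      using d(2)[OF L] by simp
    also have "X + t \<cdot>\<^sub>m K + L = X + y \<cdot>\<^sub>m K" using X K unfolding L_def by (intro eq_matI) (auto simp: algebra_simps)
    also have "mat_inner G L = mat_inner G K * (y - t)" using Gc K by (simp add: L_def mat_inner_expand)
    also have "e' * fro_norm L \<le> e' * (\<bar>y - t\<bar> * (fro_norm K + 1))" using nL e' by simp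
    also have "\<dots> = e * \<bar>y - t\<bar>" using K1 by (simp add: e'_def)
    finally show "\<bar>F (X + y \<cdot>\<^sub>m K) - F (X + t \<cdot>\<^sub>m K) - mat_inner G K * (y - t)\<bar> \<le> e * \<bar>y - t\<bar>" by simp
  qed
qed

lemma hessian_line_derivative:
  assumes h: "has_hessian n m F (X + t \<cdot>\<^sub>m K) T" and X: "X \<in> carrier_mat n m" and K: "K \<in> carrier_mat n m"
    and N: "N \<in> carrier_mat n m"
    and gc: "\<And>Y. Y \<in> carrier_mat n m \<Longrightarrow> gradient n m F Y \<in> carrier_mat n m"
  shows "((\<lambda>s. mat_inner (gradient n m F (X + s \<cdot>\<^sub>m K)) N) has_real_derivative mat_inner (T K) N) (at t)"
proof (rule real_derivative_epsI)
  fix e :: real assume "0 < e"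
  have K1: "0 < fro_norm K + 1" "0 < fro_norm N + 1" by (simp_all add: add_nonneg_pos)
  define e' where "e' = e / ((fro_norm K + 1) * (fro_norm N + 1))"
  have e': "0 < e'" using \<open>0 < e\<close> K1 by (simp add: e'_def)
  obtain d where d: "d > 0" "\<And>L. L \<in> carrier_mat n m \<Longrightarrow> fro_norm L < d \<Longrightarrow>
      fro_norm (gradient n m F (X + t \<cdot>\<^sub>m K + L) - gradient n m F (X + t \<cdot>\<^sub>m K) - T L) \<le> e' * fro_norm L"
    using h e' unfolding has_hessian_def by blast
  let ?g = "\<lambda>y. gradient n m F (X + y \<cdot>\<^sub>m K)"
  show "\<exists>d>0. \<forall>y. \<bar>y - t\<bar> < d \<longrightarrow> \<bar>mat_inner (?g y) N - mat_inner (?g t) N - mat_inner (T K) N * (y - t)\<bar> \<le> e * \<bar>y - t\<bar>"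
  proof (intro exI[of _ "d / (fro_norm K + 1)"] conjI allI impI)
    show "0 < d / (fro_norm K + 1)" using d K1 by simp
    fix y assume y: "\<bar>y - t\<bar> < d / (fro_norm K + 1)"
    define L where "L = (y - t) \<cdot>\<^sub>m K"
    have L: "L \<in> carrier_mat n m" using K by (simp add: L_def)
    have TL: "T L = (y - t) \<cdot>\<^sub>m T K" "T K \<in> carrier_mat n m"
      using h K by (auto simp: L_def has_hessian_def linear_op_def)
    have gy: "?g y \<in> carrier_mat n m" "?g t \<in> carrier_mat n m" using X K by (auto intro!: gc)
    have "fro_norm L = \<bar>y - t\<bar> * fro_norm K" by (simp add: L_def fro_norm_smult)
    also have "\<dots> \<le> \<bar>y - t\<bar> * (fro_norm K + 1)" by (simp add: mult_left_mono)
    finally have nL: "fro_norm L \<le> \<bar>y - t\<bar> * (fro_norm K + 1)" .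
    also have "\<dots> < d" using y K1 by (simp add: field_simps)
    finally have "fro_norm (gradient n m F (X + t \<cdot>\<^sub>m K + L) - ?g t - T L) \<le> e' * fro_norm L"
      using d(2)[OF L] by simp
    also have "X + t \<cdot>\<^sub>m K + L = X + y \<cdot>\<^sub>m K" using X K unfolding L_def by (intro eq_matI) (auto simp: algebra_simps)
    also have "e' * fro_norm L \<le> e' * (\<bar>y - t\<bar> * (fro_norm K + 1))" using nL e' by simp
    finally have le: "fro_norm (?g y - ?g t - T L) \<le> e' * (\<bar>y - t\<bar> * (fro_norm K + 1))" .
    have "mat_inner (?g y) N - mat_inner (?g t) N - mat_inner (T K) N * (y - t) = mat_inner (?g y - ?g t - T L) N"
      using gy TL N by (simp add: mat_inner_expand)
    then have "\<bar>mat_inner (?g y) N - mat_inner (?g t) N - mat_inner (T K) N * (y - t)\<bar> \<le> fro_norm (?g y - ?g t - T L) * fro_norm N"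
      using gy TL N mat_inner_Cauchy_Schwarz[of "?g y - ?g t - T L" N] by simp
    also have "\<dots> \<le> e' * (\<bar>y - t\<bar> * (fro_norm K + 1)) * (fro_norm N + 1)"
      using le e' by (intro mult_mono) auto
    also have "\<dots> = e * \<bar>y - t\<bar>" using K1 by (simp add: e'_def)
    finally show "\<bar>mat_inner (?g y) N - mat_inner (?g t) N - mat_inner (T K) N * (y - t)\<bar> \<le> e * \<bar>y - t\<bar>" by simp
  qed
qed

text \<open>The second difference is a first difference, in direction \<open>L\<close>, of
  \<open>F\<close> along two parallel segments. One mean value step turns it into a difference of
  gradients, and both gradients are expanded around \<open>X\<close> with the same operator
  \<open>T\<close>.\<close>

lemma second_difference:
  assumes grad: "\<And>Y. Y \<in> carrier_mat n m \<Longrightarrow> has_gradient n m F Y (gradient n m F Y)"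
    and T: "has_hessian n m F X T"
    and X: "X \<in> carrier_mat n m" and K: "K \<in> carrier_mat n m" and L: "L \<in> carrier_mat n m" and e: "0 < e"
  shows "\<exists>d>0. \<forall>h. 0 < h \<and> h < d \<longrightarrow>
    \<bar>F (X + h \<cdot>\<^sub>m K + h \<cdot>\<^sub>m L) - F (X + h \<cdot>\<^sub>m K) - F (X + h \<cdot>\<^sub>m L) + F X - h\<^sup>2 * mat_inner (T K) L\<bar> \<le> e * h\<^sup>2"
proof -
  let ?g = "gradient n m F"
  have gc: "?g Y \<in> carrier_mat n m" if "Y \<in> carrier_mat n m" for Y
    using grad[OF that] by (simp add: has_gradient_def)
  have Tc: "T Y \<in> carrier_mat n m" if "Y \<in> carrier_mat n m" for Y
    using T that by (simp add: has_hessian_def linear_op_def)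
  define a where "a = fro_norm K + fro_norm L + 1"
  have a: "0 < a" "fro_norm L \<le> a" "fro_norm K + fro_norm L \<le> a"
    unfolding a_def using fro_norm_nonneg[of K] fro_norm_nonneg[of L] by linarith+
  \<comment> \<open>Two remainders of size \<open>e' * (h * a)\<close> are paired with a vector of
    norm at most \<open>h * a\<close>, which adds up to \<open>e * h\<^sup>2\<close>.\<close>
  define e' where "e' = e / (2 * a * a)"
  have e': "0 < e'" using e a by (simp add: e'_def)
  obtain d0 where d0: "d0 > 0" "\<And>P. P \<in> carrier_mat n m \<Longrightarrow> fro_norm P < d0 \<Longrightarrow>
      fro_norm (?g (X + P) - ?g X - T P) \<le> e' * fro_norm P"
    using T e' unfolding has_hessian_def by blast
  show ?thesis
  proof (intro exI[of _ "d0 / a"] conjI allI impI)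
    show "0 < d0 / a" using d0 a by simp
    fix h assume h: "0 < h \<and> h < d0 / a"
    then have ha: "h * a < d0" using a by (simp add: field_simps)
    let ?hL = "h \<cdot>\<^sub>m L" and ?XK = "X + h \<cdot>\<^sub>m K"
    define \<phi> where "\<phi> t = F (?XK + t \<cdot>\<^sub>m ?hL) - F (X + t \<cdot>\<^sub>m ?hL)" for t
    have "\<exists>z>0. z < 1 \<and> \<phi> 1 - \<phi> 0
        = (1 - 0) * (mat_inner (?g (?XK + z \<cdot>\<^sub>m ?hL)) ?hL - mat_inner (?g (X + z \<cdot>\<^sub>m ?hL)) ?hL)"
    proof (rule MVT2)
      fix t :: real
      show "(\<phi> has_real_derivative mat_inner (?g (?XK + t \<cdot>\<^sub>m ?hL)) ?hL - mat_inner (?g (X + t \<cdot>\<^sub>m ?hL)) ?hL) (at t)"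
        unfolding \<phi>_def using X K L
        by (intro DERIV_diff gradient_line_derivative[OF grad]) auto
    qed simp
    then obtain z where z: "0 < z" "z < 1" and
      \<phi>: "\<phi> 1 - \<phi> 0 = mat_inner (?g (?XK + z \<cdot>\<^sub>m ?hL)) ?hL - mat_inner (?g (X + z \<cdot>\<^sub>m ?hL)) ?hL"
      by auto
    define P where "P = h \<cdot>\<^sub>m K + z \<cdot>\<^sub>m ?hL"
    define Q where "Q = z \<cdot>\<^sub>m ?hL"
    have PQ: "P \<in> carrier_mat n m" "Q \<in> carrier_mat n m" using K L by (auto simp: P_def Q_def)
    have hz: "h * z \<le> h" using z h by (simp add: mult_left_le)
    have nQ: "fro_norm Q \<le> h * fro_norm L"
      using z h hz by (simp add: Q_def fro_norm_smult mult.assoc[symmetric] mult_right_mono mult.commute[of z])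
    have "fro_norm P \<le> fro_norm (h \<cdot>\<^sub>m K) + fro_norm Q" unfolding P_def Q_def using K L by (intro fro_norm_add_le) auto
    also have "fro_norm (h \<cdot>\<^sub>m K) = h * fro_norm K" using h by (simp add: fro_norm_smult)
    finally have nP: "fro_norm P \<le> h * (fro_norm K + fro_norm L)" using nQ by (simp add: distrib_left)
    have "fro_norm P \<le> h * a" "fro_norm Q \<le> h * a"
      using nP nQ h a by (meson order_trans mult_left_mono less_imp_le)+
    then have nPd: "fro_norm P < d0" "fro_norm Q < d0" using ha by auto
    define R where "R = ?g (X + P) - ?g X - T P"
    define S where "S = ?g (X + Q) - ?g X - T Q"
    have RS: "R \<in> carrier_mat n m" "S \<in> carrier_mat n m"
      unfolding R_def S_def using X PQ by (auto intro!: minus_carrier_mat gc Tc)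
    have nR: "fro_norm R \<le> e' * (h * a)"
      unfolding R_def using d0(2)[OF PQ(1) nPd(1)] \<open>fro_norm P \<le> h * a\<close> e' by (meson order_trans mult_left_mono less_imp_le)
    have nS: "fro_norm S \<le> e' * (h * a)"
      unfolding S_def using d0(2)[OF PQ(2) nPd(2)] \<open>fro_norm Q \<le> h * a\<close> e' by (meson order_trans mult_left_mono less_imp_le)
    have TP: "T P = h \<cdot>\<^sub>m T K + T Q"
      using T K L unfolding P_def Q_def has_hessian_def linear_op_def by auto
    have XP: "?XK + Q = X + P" unfolding P_def Q_def using X K L by (intro eq_matI) auto
    have c: "?g (X + P) \<in> carrier_mat n m" "?g (X + Q) \<in> carrier_mat n m" "?g X \<in> carrier_mat n m"
      "T P \<in> carrier_mat n m" "T Q \<in> carrier_mat n m" "T K \<in> carrier_mat n m"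
      using X PQ K by (auto intro!: gc Tc)
    have "\<phi> 1 - \<phi> 0 - h\<^sup>2 * mat_inner (T K) L = h * mat_inner (R - S) L"
      unfolding \<phi> Q_def[symmetric] unfolding XP R_def S_def TP using c L
      by (simp add: mat_inner_expand power2_eq_square algebra_simps)
    then have "\<bar>\<phi> 1 - \<phi> 0 - h\<^sup>2 * mat_inner (T K) L\<bar> = h * \<bar>mat_inner (R - S) L\<bar>" using h by (simp add: abs_mult)
    also have "\<dots> \<le> h * (fro_norm (R - S) * fro_norm L)"
      using h RS L by (intro mult_left_mono mat_inner_Cauchy_Schwarz) auto
    also have "\<dots> \<le> h * ((e' * (h * a) + e' * (h * a)) * a)"
    proof (intro mult_left_mono mult_mono)
      show "fro_norm (R - S) \<le> e' * (h * a) + e' * (h * a)"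
        using fro_norm_diff_le[of R S] carrier_matD[OF RS(1)] carrier_matD[OF RS(2)] nR nS by linarith
    qed (use h a e' in auto)
    also have "\<dots> = (e' * (2 * a * a)) * h\<^sup>2" by (simp add: power2_eq_square)
    also have "\<dots> = e * h\<^sup>2" using a by (simp add: e'_def)
    finally have "\<bar>\<phi> 1 - \<phi> 0 - h\<^sup>2 * mat_inner (T K) L\<bar> \<le> e * h\<^sup>2" .
    moreover have "1 \<cdot>\<^sub>m ?hL = ?hL" "?XK + 0 \<cdot>\<^sub>m ?hL = ?XK" "X + 0 \<cdot>\<^sub>m ?hL = X"
      using X K L by (auto intro!: eq_matI)
    ultimately show "\<bar>F (?XK + ?hL) - F ?XK - F (X + ?hL) + F X - h\<^sup>2 * mat_inner (T K) L\<bar> \<le> e * h\<^sup>2"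
      by (simp add: \<phi>_def algebra_simps)
  qed
qed

text \<open>The second difference is symmetric in \<open>K\<close> and \<open>L\<close>, so its two
  leading terms agree in the limit.\<close>

lemma hessian_self_adjoint:
  assumes grad: "\<And>Y. Y \<in> carrier_mat n m \<Longrightarrow> has_gradient n m F Y (gradient n m F Y)"
    and T: "has_hessian n m F X T"
    and X: "X \<in> carrier_mat n m" and K: "K \<in> carrier_mat n m" and L: "L \<in> carrier_mat n m"
  shows "mat_inner (T K) L = mat_inner (T L) K"
proof (rule ccontr)
  assume ne: "mat_inner (T K) L \<noteq> mat_inner (T L) K"
  define e where "e = \<bar>mat_inner (T K) L - mat_inner (T L) K\<bar> / 3"
  have e: "0 < e" using ne by (simp add: e_def)
  obtain d1 where d1: "d1 > 0" "\<And>h. 0 < h \<and> h < d1 \<Longrightarrow>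
    \<bar>F (X + h \<cdot>\<^sub>m K + h \<cdot>\<^sub>m L) - F (X + h \<cdot>\<^sub>m K) - F (X + h \<cdot>\<^sub>m L) + F X - h\<^sup>2 * mat_inner (T K) L\<bar> \<le> e * h\<^sup>2"
    using second_difference[OF grad T X K L e] by blast
  obtain d2 where d2: "d2 > 0" "\<And>h. 0 < h \<and> h < d2 \<Longrightarrow>
    \<bar>F (X + h \<cdot>\<^sub>m L + h \<cdot>\<^sub>m K) - F (X + h \<cdot>\<^sub>m L) - F (X + h \<cdot>\<^sub>m K) + F X - h\<^sup>2 * mat_inner (T L) K\<bar> \<le> e * h\<^sup>2"
    using second_difference[OF grad T X L K e] by blast
  define h where "h = min d1 d2 / 2"
  have h: "0 < h" "h < d1" "h < d2" using d1 d2 by (auto simp: h_def)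
  have sw: "X + h \<cdot>\<^sub>m L + h \<cdot>\<^sub>m K = X + h \<cdot>\<^sub>m K + h \<cdot>\<^sub>m L" using X K L by (intro eq_matI) auto
  have "\<bar>h\<^sup>2 * mat_inner (T K) L - h\<^sup>2 * mat_inner (T L) K\<bar> \<le> 2 * e * h\<^sup>2"
    using d1(2)[of h] d2(2)[of h] h unfolding sw by linarith
  also have "h\<^sup>2 * mat_inner (T K) L - h\<^sup>2 * mat_inner (T L) K = h\<^sup>2 * (mat_inner (T K) L - mat_inner (T L) K)"
    by (simp add: right_diff_distrib)
  also have "\<bar>\<dots>\<bar> = 3 * e * h\<^sup>2" by (simp add: abs_mult e_def)
  finally have "e * h\<^sup>2 \<le> 0" by simp
  moreover have "0 < e * h\<^sup>2" using e h by simp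
  ultimately show False by simp
qed

text \<open>Between symmetric points the gradient changes by a symmetric matrix, and
  \<open>H S\<close> is the limit of such changes. Quantitatively, the skew part of the remainder
  \<open>R\<close> would be linear in the step, while \<open>R\<close> is of smaller order.\<close>

lemma hessian_preserves_symmetric:
  assumes sg: "symmetric_gradient n f" and H: "has_hessian n n f M H"
    and gc: "\<And>Y. Y \<in> carrier_mat n n \<Longrightarrow> gradient n n f Y \<in> carrier_mat n n"
    and M: "M \<in> carrier_mat n n" "symmetric_mat M" and S: "S \<in> carrier_mat n n" "symmetric_mat S"
  shows "(H S)\<^sup>T = H S"
proof (rule ccontr)
  assume ne: "(H S)\<^sup>T \<noteq> H S"
  have HS: "H S \<in> carrier_mat n n" using H S by (simp add: has_hessian_def linear_op_def)
  define D where "D = (H S)\<^sup>T - H S"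
  have D: "D \<in> carrier_mat n n" using HS by (simp add: D_def)
  have "D \<noteq> 0\<^sub>m n n" using mat_minus_eq_0D[of "(H S)\<^sup>T" n n "H S"] HS ne by (auto simp: D_def)
  then have nD: "0 < fro_norm D" using fro_norm_pos[OF D] by simp
  define k where "k = fro_norm S + 1"
  have k: "0 < k" "fro_norm S < k" by (simp_all add: k_def add_nonneg_pos)
  define e where "e = fro_norm D / (3 * k)"
  have e: "0 < e" using nD k by (simp add: e_def)
  obtain d where d: "d > 0" "\<And>K. K \<in> carrier_mat n n \<Longrightarrow> fro_norm K < d \<Longrightarrow>
      fro_norm (gradient n n f (M + K) - gradient n n f M - H K) \<le> e * fro_norm K"
    using H e unfolding has_hessian_def by blast
  define t where "t = d / k"
  have t: "0 < t" using d k by (simp add: t_def)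
  define K where "K = t \<cdot>\<^sub>m S"
  have K: "K \<in> carrier_mat n n" using S by (simp add: K_def)
  have nK: "fro_norm K = t * fro_norm S" using t by (simp add: K_def fro_norm_smult)
  have "fro_norm K < t * k" unfolding nK using t k by simp
  also have "t * k = d" using k by (simp add: t_def)
  finally have Kd: "fro_norm K < d" .
  let ?g1 = "gradient n n f (M + K)" and ?g0 = "gradient n n f M"
  have g: "?g1 \<in> carrier_mat n n" "?g0 \<in> carrier_mat n n" using M K by (auto intro!: gc)
  have "(M + K)\<^sup>T = M + K" using M S K by (simp add: mat_transpose_add mat_transpose_smult symmetric_mat_def K_def)
  then have gs: "?g1\<^sup>T = ?g1" "?g0\<^sup>T = ?g0"
    using sg M K by (auto simp: symmetric_gradient_def symmetric_mat_def)
  have HK: "H K = t \<cdot>\<^sub>m H S" using H S by (simp add: has_hessian_def linear_op_def K_def)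
  define R where "R = ?g1 - ?g0 - H K"
  have R: "R \<in> carrier_mat n n" unfolding R_def HK using g HS by simp
  have "R - R\<^sup>T = t \<cdot>\<^sub>m D"
  proof -
    have "R\<^sup>T = ?g1 - ?g0 - t \<cdot>\<^sub>m (H S)\<^sup>T" unfolding R_def HK using g HS gs
      by (simp add: mat_transpose_minus mat_transpose_smult)
    then show ?thesis unfolding R_def HK D_def using g HS by (intro eq_matI) (auto simp: algebra_simps)
  qed
  then have "t * fro_norm D = fro_norm (R - R\<^sup>T)" using t by (simp add: fro_norm_smult)
  also have "\<dots> \<le> fro_norm R + fro_norm R\<^sup>T" using R by (intro fro_norm_diff_le) auto
  also have "\<dots> \<le> 2 * (e * fro_norm K)" using d(2)[OF K Kd] by (simp add: R_def)
  also have "\<dots> \<le> t * (2 * e * k)" using t e k by (simp add: nK)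
  finally have "fro_norm D \<le> 2 * e * k" using t by simp
  also have "\<dots> = 2 / 3 * fro_norm D" using k by (simp add: e_def)
  finally show False using nD by simp
qed

subsection \<open>The factored objective\<close>

text \<open>For symmetric \<open>G\<close> the two first-order terms of
  \<open>(U + K) * (U + K)\<^sup>T\<close> contribute equally. This is where the factor 2 in the
  gradient of the factored objective comes from.\<close>

lemma mat_inner_symmetric_factor:
  assumes G: "G \<in> carrier_mat n n" "G\<^sup>T = G" and U: "U \<in> carrier_mat n r" and K: "K \<in> carrier_mat n r"
  shows "mat_inner G (U * K\<^sup>T) = mat_inner (G * U) K" "mat_inner G (K * U\<^sup>T) = mat_inner (G * U) K"
proof -
  have "mat_inner G (K * U\<^sup>T) = mat_inner (K * U\<^sup>T) G" using G U K by (intro mat_inner_commute) auto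
  also have "\<dots> = mat_inner K (G * U)" using G U K by (subst mat_inner_mult_left) auto
  also have "\<dots> = mat_inner (G * U) K" using G U K by (intro mat_inner_commute) auto
  finally show 1: "mat_inner G (K * U\<^sup>T) = mat_inner (G * U) K" .
  have "mat_inner G (U * K\<^sup>T) = mat_inner G\<^sup>T (U * K\<^sup>T)\<^sup>T\<^sup>T" using G by simp
  also have "\<dots> = mat_inner G (U * K\<^sup>T)\<^sup>T" using G U K by (intro mat_inner_transpose) auto
  also have "(U * K\<^sup>T)\<^sup>T = K * U\<^sup>T" using U K by (simp add: mat_transpose_mult)
  finally show "mat_inner G (U * K\<^sup>T) = mat_inner (G * U) K" using 1 by simp
qed

lemma factored_increment:
  assumes "U \<in> carrier_mat n r" "K \<in> carrier_mat n r"
  shows "(U + K) * (U + K)\<^sup>T = U * U\<^sup>T + (U * K\<^sup>T + K * U\<^sup>T + K * (K :: real mat)\<^sup>T)"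
  using assms by (simp add: mat_expand) (intro eq_matI, auto)

text \<open>For \<open>K\<close> in the unit ball the quadratic term is absorbed into a linear
  bound.\<close>

lemma factored_increment_norm:
  assumes U: "U \<in> carrier_mat n r" and K: "K \<in> carrier_mat n r" "fro_norm K \<le> 1"
  shows "fro_norm (U * K\<^sup>T + K * U\<^sup>T + K * K\<^sup>T) \<le> (2 * fro_norm U + 1) * fro_norm K"
proof -
  have 1: "fro_norm (U * K\<^sup>T) \<le> fro_norm U * fro_norm K" using U K fro_norm_mult_le[of U "K\<^sup>T"] by simp
  have 2: "fro_norm (K * U\<^sup>T) \<le> fro_norm U * fro_norm K" using U K fro_norm_mult_le[of K "U\<^sup>T"] by (simp add: mult.commute)
  have "fro_norm (K * K\<^sup>T) \<le> fro_norm K * fro_norm K" using fro_norm_mult_le[of K "K\<^sup>T"] by simp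
  also have "\<dots> \<le> 1 * fro_norm K" using K by (intro mult_right_mono) auto
  finally have 3: "fro_norm (K * K\<^sup>T) \<le> fro_norm K" by simp
  have "fro_norm (U * K\<^sup>T + K * U\<^sup>T + K * K\<^sup>T) \<le> fro_norm (U * K\<^sup>T + K * U\<^sup>T) + fro_norm (K * K\<^sup>T)"
    using U K by (intro fro_norm_add_le) auto
  also have "fro_norm (U * K\<^sup>T + K * U\<^sup>T) \<le> fro_norm (U * K\<^sup>T) + fro_norm (K * U\<^sup>T)"
    using U K by (intro fro_norm_add_le) auto
  finally show ?thesis using 1 2 3 by (simp add: algebra_simps)
qed

lemma has_gradient_factored:
  assumes G: "has_gradient n n f (U * U\<^sup>T) G" "G\<^sup>T = G" and U: "U \<in> carrier_mat n r"
  shows "has_gradient n r (\<lambda>U. f (U * U\<^sup>T)) U (2 \<cdot>\<^sub>m (G * U))"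
  unfolding has_gradient_def
proof (intro conjI allI impI)
  have Gc: "G \<in> carrier_mat n n" using G by (simp add: has_gradient_def)
  show "2 \<cdot>\<^sub>m (G * U) \<in> carrier_mat n r" using Gc U by simp
  fix e :: real assume e: "0 < e"
  define u where "u = 2 * fro_norm U + 1"
  have u: "0 < u" unfolding u_def using fro_norm_nonneg[of U] by linarith
  define g where "g = fro_norm G + 1"
  have g: "0 < g" "fro_norm G \<le> g" unfolding g_def using fro_norm_nonneg[of G] by linarith+
  \<comment> \<open>Half of the error is reserved for the remainder of \<open>f\<close>, the other
    half for the second-order term \<open>mat_inner G (K * K\<^sup>T)\<close>.\<close>
  define e1 where "e1 = e / (2 * u)"
  have e1: "0 < e1" using e u by (simp add: e1_def)
  obtain d1 where d1: "d1 > 0" "\<And>L. L \<in> carrier_mat n n \<Longrightarrow> fro_norm L < d1 \<Longrightarrow>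
      \<bar>f (U * U\<^sup>T + L) - f (U * U\<^sup>T) - mat_inner G L\<bar> \<le> e1 * fro_norm L"
    using G(1) e1 unfolding has_gradient_def by blast
  show "\<exists>d>0. \<forall>K\<in>carrier_mat n r. fro_norm K < d \<longrightarrow>
      \<bar>f ((U + K) * (U + K)\<^sup>T) - f (U * U\<^sup>T) - mat_inner (2 \<cdot>\<^sub>m (G * U)) K\<bar> \<le> e * fro_norm K"
  proof (intro exI[of _ "min 1 (min (d1 / u) (e / (2 * g)))"] conjI ballI impI)
    show "0 < min 1 (min (d1 / u) (e / (2 * g)))" using d1 u e g by simp
    fix K :: "real mat" assume K: "K \<in> carrier_mat n r" and nK: "fro_norm K < min 1 (min (d1 / u) (e / (2 * g)))"
    define L where "L = U * K\<^sup>T + K * U\<^sup>T + K * K\<^sup>T"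
    have L: "L \<in> carrier_mat n n" using U K by (simp add: L_def)
    have nL: "fro_norm L \<le> u * fro_norm K" unfolding L_def u_def using nK by (intro factored_increment_norm[OF U K]) simp
    have "u * fro_norm K < d1" using nK u by (simp add: field_simps)
    then have 1: "\<bar>f (U * U\<^sup>T + L) - f (U * U\<^sup>T) - mat_inner G L\<bar> \<le> e1 * fro_norm L" using nL d1(2)[OF L] by simp
    have "e1 * fro_norm L \<le> e1 * (u * fro_norm K)" using nL e1 by simp
    also have "\<dots> = e / 2 * fro_norm K" using u by (simp add: e1_def)
    finally have 2: "e1 * fro_norm L \<le> e / 2 * fro_norm K" .
    have "\<bar>mat_inner G (K * K\<^sup>T)\<bar> \<le> fro_norm G * fro_norm (K * K\<^sup>T)" using Gc K by (intro mat_inner_Cauchy_Schwarz) auto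
    also have "\<dots> \<le> g * (fro_norm K * fro_norm K)"
      using g fro_norm_mult_le[of K "K\<^sup>T"] by (intro mult_mono) auto
    also have "\<dots> = (g * fro_norm K) * fro_norm K" by simp
    also have "\<dots> \<le> e / 2 * fro_norm K" using nK g by (intro mult_right_mono) (simp_all add: field_simps)
    finally have 3: "\<bar>mat_inner G (K * K\<^sup>T)\<bar> \<le> e / 2 * fro_norm K" .
    have "mat_inner G L = mat_inner (2 \<cdot>\<^sub>m (G * U)) K + mat_inner G (K * K\<^sup>T)"
      unfolding L_def using Gc U K mat_inner_symmetric_factor[OF Gc G(2) U K] by (simp add: mat_inner_expand)
    with 1 2 3 show "\<bar>f ((U + K) * (U + K)\<^sup>T) - f (U * U\<^sup>T) - mat_inner (2 \<cdot>\<^sub>m (G * U)) K\<bar> \<le> e * fro_norm K"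
      unfolding factored_increment[OF U K] L_def[symmetric] by linarith
  qed
qed

lemma symmetric_mat_self_transpose: "symmetric_mat (U * U\<^sup>T)"
  unfolding symmetric_mat_def by (simp add: mat_transpose_mult)

lemma gradient_factored:
  assumes grad: "\<And>Y. Y \<in> carrier_mat n n \<Longrightarrow> has_gradient n n f Y (gradient n n f Y)"
    and sg: "symmetric_gradient n f" and U: "U \<in> carrier_mat n r"
  shows "has_gradient n r (\<lambda>U. f (U * U\<^sup>T)) U (2 \<cdot>\<^sub>m (gradient n n f (U * U\<^sup>T) * U))"
    "gradient n r (\<lambda>U. f (U * U\<^sup>T)) U = 2 \<cdot>\<^sub>m (gradient n n f (U * U\<^sup>T) * U)"
proof -
  have "U * U\<^sup>T \<in> carrier_mat n n" using U by simp
  then show 1: "has_gradient n r (\<lambda>U. f (U * U\<^sup>T)) U (2 \<cdot>\<^sub>m (gradient n n f (U * U\<^sup>T) * U))"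
    using sg symmetric_mat_self_transpose[of U] unfolding symmetric_gradient_def
    by (intro has_gradient_factored[OF grad _ U]) (auto simp: symmetric_mat_def)
  then show "gradient n r (\<lambda>U. f (U * U\<^sup>T)) U = 2 \<cdot>\<^sub>m (gradient n n f (U * U\<^sup>T) * U)"
    by (rule gradient_eqI)
qed

text \<open>Product rule for the gradient map \<open>2 G(U U\<^sup>T) U\<close>: one term from the
  change of the gradient of \<open>f\<close>, one from the change of the factor
  \<open>U\<close>.\<close>

lemma has_hessian_factored:
  assumes grad: "\<And>Y. Y \<in> carrier_mat n n \<Longrightarrow> has_gradient n n f Y (gradient n n f Y)"
    and sg: "symmetric_gradient n f" and U: "U \<in> carrier_mat n r"
    and H: "has_hessian n n f (U * U\<^sup>T) H"
  shows "has_hessian n r (\<lambda>U. f (U * U\<^sup>T)) U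
    (\<lambda>K. 2 \<cdot>\<^sub>m (H (U * K\<^sup>T + K * U\<^sup>T) * U + gradient n n f (U * U\<^sup>T) * K))"
  unfolding has_hessian_def
proof (intro conjI allI impI)
  let ?M = "U * U\<^sup>T" and ?g = "gradient n n f"
  have M: "?M \<in> carrier_mat n n" using U by simp
  have lin: "linear_op n n H" using H by (simp add: has_hessian_def)
  have gc: "?g Y \<in> carrier_mat n n" if "Y \<in> carrier_mat n n" for Y
    using grad[OF that] by (simp add: has_gradient_def)
  have Hc: "H Y \<in> carrier_mat n n" if "Y \<in> carrier_mat n n" for Y
    using lin that by (simp add: linear_op_def)
  have Hadd: "H (X + Y) = H X + H Y" if "X \<in> carrier_mat n n" "Y \<in> carrier_mat n n" for X Y
    using lin that by (simp add: linear_op_def)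
  have Hsm: "H (c \<cdot>\<^sub>m X) = c \<cdot>\<^sub>m H X" if "X \<in> carrier_mat n n" for c X
    using lin that by (simp add: linear_op_def)
  let ?T = "\<lambda>K. 2 \<cdot>\<^sub>m (H (U * K\<^sup>T + K * U\<^sup>T) * U + ?g ?M * K)"
  show "linear_op n r ?T" unfolding linear_op_def
  proof (intro conjI ballI allI)
    fix K :: "real mat" assume K: "K \<in> carrier_mat n r"
    have S: "U * K\<^sup>T + K * U\<^sup>T \<in> carrier_mat n n" using U K by simp
    show "?T K \<in> carrier_mat n r" using Hc[OF S] gc[OF M] U K by simp
    { fix L :: "real mat" assume L: "L \<in> carrier_mat n r"
      have S': "U * L\<^sup>T + L * U\<^sup>T \<in> carrier_mat n n" using U L by simp
      have eq: "U * (K + L)\<^sup>T + (K + L) * U\<^sup>T = (U * K\<^sup>T + K * U\<^sup>T) + (U * L\<^sup>T + L * U\<^sup>T)"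
        using U K L by (simp add: mat_expand) (intro eq_matI, auto)
      show "?T (K + L) = ?T K + ?T L" unfolding eq Hadd[OF S S']
        using Hc[OF S] Hc[OF S'] gc[OF M] U K L by (simp add: mat_add_mult mat_mult_add) (intro eq_matI, auto simp: algebra_simps) }
    fix c :: real
    have eq: "U * (c \<cdot>\<^sub>m K)\<^sup>T + (c \<cdot>\<^sub>m K) * U\<^sup>T = c \<cdot>\<^sub>m (U * K\<^sup>T + K * U\<^sup>T)"
      using U K by (simp add: mat_expand) (intro eq_matI, auto simp: algebra_simps)
    show "?T (c \<cdot>\<^sub>m K) = c \<cdot>\<^sub>m ?T K" unfolding eq Hsm[OF S]
      using Hc[OF S] gc[OF M] U K by (simp add: mat_mult_smult mat_smult_mult) (intro eq_matI, auto simp: algebra_simps)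
  qed
  fix e :: real assume e: "0 < e"
  obtain C where C: "0 \<le> C" "\<And>K. K \<in> carrier_mat n n \<Longrightarrow> fro_norm (H K) \<le> C * fro_norm K"
    using linear_op_bounded[OF lin] by blast
  define u where "u = 2 * fro_norm U + 1"
  have u: "1 \<le> u" "fro_norm U \<le> u" unfolding u_def using fro_norm_nonneg[of U] by linarith+
  \<comment> \<open>The cap at \<open>1\<close> serves the product \<open>R * K\<close>, where a
    bounded factor in front of the second-order term is enough.\<close>
  define e1 where "e1 = min 1 (e / (4 * u * u))"
  have e1: "0 < e1" "e1 \<le> 1" "e1 * (4 * u * u) \<le> e" using e u by (auto simp: e1_def min_def field_simps)
  \<comment> \<open>Collects the coefficients of the remainder terms that are quadratic in
    \<open>K\<close>.\<close>
  define b where "b = C * u + (1 + C) * u"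
  have b: "0 < b" unfolding b_def using C u by (intro add_nonneg_pos) auto
  obtain d1 where d1: "d1 > 0" "\<And>L. L \<in> carrier_mat n n \<Longrightarrow> fro_norm L < d1 \<Longrightarrow>
      fro_norm (?g (?M + L) - ?g ?M - H L) \<le> e1 * fro_norm L"
    using H e1(1) unfolding has_hessian_def by blast
  show "\<exists>d>0. \<forall>K\<in>carrier_mat n r. fro_norm K < d \<longrightarrow>
      fro_norm (gradient n r (\<lambda>U. f (U * U\<^sup>T)) (U + K) - gradient n r (\<lambda>U. f (U * U\<^sup>T)) U - ?T K) \<le> e * fro_norm K"
  proof (intro exI[of _ "min 1 (min (d1 / u) (e / (4 * b)))"] conjI ballI impI)
    show "0 < min 1 (min (d1 / u) (e / (4 * b)))" using d1 u e b by simp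
    fix K :: "real mat" assume K: "K \<in> carrier_mat n r" and nK: "fro_norm K < min 1 (min (d1 / u) (e / (4 * b)))"
    define S where "S = U * K\<^sup>T + K * U\<^sup>T"
    define L where "L = S + K * K\<^sup>T"
    have S: "S \<in> carrier_mat n n" and KK: "K * K\<^sup>T \<in> carrier_mat n n" and L: "L \<in> carrier_mat n n"
      using U K by (simp_all add: L_def S_def)
    have nL: "fro_norm L \<le> u * fro_norm K"
      unfolding L_def S_def u_def using nK by (intro factored_increment_norm[OF U K]) simp
    have "u * fro_norm K < d1" using nK u by (simp add: field_simps)
    define R where "R = ?g (?M + L) - ?g ?M - H L"
    have Mc: "?M + L \<in> carrier_mat n n" using M L by simp
    have R: "R \<in> carrier_mat n n" unfolding R_def using gc[OF Mc] gc[OF M] Hc[OF L] by simp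
    have "fro_norm R \<le> e1 * fro_norm L" unfolding R_def using nL \<open>u * fro_norm K < d1\<close> d1(2)[OF L] by simp
    also have "\<dots> \<le> e1 * (u * fro_norm K)" using nL e1 by simp
    finally have nR: "fro_norm R \<le> e1 * (u * fro_norm K)" .
    have "fro_norm (H L) \<le> C * fro_norm L" by (rule C(2)[OF L])
    also have "\<dots> \<le> C * (u * fro_norm K)" using nL C by (intro mult_left_mono) auto
    finally have nHL: "fro_norm (H L) \<le> C * (u * fro_norm K)" .
    have "fro_norm (H (K * K\<^sup>T)) \<le> C * fro_norm (K * K\<^sup>T)" by (rule C(2)[OF KK])
    also have "\<dots> \<le> C * (fro_norm K * fro_norm K)" using fro_norm_mult_le[of K "K\<^sup>T"] C by (intro mult_left_mono) auto
    finally have nHK: "fro_norm (H (K * K\<^sup>T)) \<le> C * (fro_norm K * fro_norm K)" .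
    have UK: "U + K \<in> carrier_mat n r" using U K by simp
    \<comment> \<open>An exact identity: \<open>R * U\<close> is small by differentiability, the
      other terms are of second order in \<open>K\<close>.\<close>
    have "gradient n r (\<lambda>U. f (U * U\<^sup>T)) (U + K) - gradient n r (\<lambda>U. f (U * U\<^sup>T)) U - ?T K
        = 2 \<cdot>\<^sub>m (R * U + H (K * K\<^sup>T) * U + (R + H L) * K)"
    proof -
      have HL: "H L = H S + H (K * K\<^sup>T)" unfolding L_def by (rule Hadd[OF S KK])
      have g1: "gradient n r (\<lambda>U. f (U * U\<^sup>T)) (U + K) = 2 \<cdot>\<^sub>m (?g (?M + L) * (U + K))"
        using gradient_factored(2)[OF grad sg UK] unfolding factored_increment[OF U K] L_def S_def .
      have g0: "gradient n r (\<lambda>U. f (U * U\<^sup>T)) U = 2 \<cdot>\<^sub>m (?g ?M * U)"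
        by (rule gradient_factored(2)[OF grad sg U])
      show ?thesis
        unfolding g1 g0 S_def[symmetric] R_def HL
        using gc[OF Mc] gc[OF M] Hc[OF S] Hc[OF KK] U K
        by (simp add: mat_add_mult mat_mult_add mat_minus_mult del: index_mult_mat(1))
          (intro eq_matI, auto simp: algebra_simps simp del: index_mult_mat(1))
    qed
    then have "fro_norm (gradient n r (\<lambda>U. f (U * U\<^sup>T)) (U + K) - gradient n r (\<lambda>U. f (U * U\<^sup>T)) U - ?T K)
        = 2 * fro_norm (R * U + H (K * K\<^sup>T) * U + (R + H L) * K)"
      by (simp add: fro_norm_smult)
    also have "fro_norm (R * U + H (K * K\<^sup>T) * U + (R + H L) * K)
        \<le> fro_norm (R * U + H (K * K\<^sup>T) * U) + fro_norm ((R + H L) * K)"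
      using R Hc[OF KK] Hc[OF L] U K by (intro fro_norm_add_le) auto
    also have "fro_norm (R * U + H (K * K\<^sup>T) * U) \<le> fro_norm (R * U) + fro_norm (H (K * K\<^sup>T) * U)"
      using R Hc[OF KK] U by (intro fro_norm_add_le) auto
    also have "fro_norm (R * U) \<le> fro_norm R * fro_norm U" using R U by (intro fro_norm_mult_le) auto
    also have "\<dots> \<le> e1 * (u * fro_norm K) * u" using nR u e1 by (intro mult_mono) auto
    also have "fro_norm (H (K * K\<^sup>T) * U) \<le> fro_norm (H (K * K\<^sup>T)) * fro_norm U"
      using Hc[OF KK] U by (intro fro_norm_mult_le) auto
    also have "\<dots> \<le> C * (fro_norm K * fro_norm K) * u" using nHK u C by (intro mult_mono) auto
    also have "fro_norm ((R + H L) * K) \<le> fro_norm (R + H L) * fro_norm K"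
      using R Hc[OF L] K by (intro fro_norm_mult_le) auto
    also have "fro_norm (R + H L) \<le> fro_norm R + fro_norm (H L)"
      using R Hc[OF L] by (intro fro_norm_add_le) auto
    also have "\<dots> \<le> e1 * (u * fro_norm K) + C * (u * fro_norm K)" using nR nHL by simp
    also have "\<dots> \<le> 1 * (u * fro_norm K) + C * (u * fro_norm K)" using e1 u by (intro add_right_mono mult_right_mono) auto
    finally have "fro_norm (gradient n r (\<lambda>U. f (U * U\<^sup>T)) (U + K) - gradient n r (\<lambda>U. f (U * U\<^sup>T)) U - ?T K)
        \<le> 2 * (e1 * (u * fro_norm K) * u + C * (fro_norm K * fro_norm K) * u + (1 * (u * fro_norm K) + C * (u * fro_norm K)) * fro_norm K)"
      by (simp add: mult_right_mono)
    also have "\<dots> = (e1 * (4 * u * u)) / 2 * fro_norm K + 2 * (b * fro_norm K) * fro_norm K"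
      by (simp add: b_def algebra_simps)
    also have "\<dots> \<le> e / 2 * fro_norm K + e / 2 * fro_norm K"
    proof (intro add_mono mult_right_mono)
      have "fro_norm K < e / (4 * b)" using nK by simp
      then show "2 * (b * fro_norm K) \<le> e / 2" using b by (simp add: field_simps)
    qed (use e1 in auto)
    finally show "fro_norm (gradient n r (\<lambda>U. f (U * U\<^sup>T)) (U + K) - gradient n r (\<lambda>U. f (U * U\<^sup>T)) U - ?T K) \<le> e * fro_norm K"
      by simp
  qed
qed

subsection \<open>Approximate second-order critical points\<close>

lemma twice_cont_diff_gradient:
  "twice_cont_diff n n f \<Longrightarrow> Y \<in> carrier_mat n n \<Longrightarrow> has_gradient n n f Y (gradient n n f Y)"
  unfolding twice_cont_diff_def using gradient_eqI by metis

lemma twice_cont_diff_hessian: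
  "twice_cont_diff n n f \<Longrightarrow> Y \<in> carrier_mat n n \<Longrightarrow> has_hessian n n f Y (hessian n n f Y)"
  unfolding twice_cont_diff_def hessian_def by (metis someI_ex)

lemma mat_rank_mult_le:
  assumes "X \<in> carrier_mat n k" "Y \<in> carrier_mat k m"
  shows "mat_rank (X * Y) \<le> k"
  using vec_space.rank_mult_le_inner_dim[OF assms] assms by simp

lemma mat_rank_add_le:
  assumes "A \<in> carrier_mat n m" "B \<in> carrier_mat n m"
  shows "mat_rank (A + B) \<le> mat_rank A + mat_rank B"
  using vec_space.rank_subadditive[OF assms] assms by simp

lemma mat_rank_add_mult_le:
  assumes X: "X \<in> carrier_mat n k" "X' \<in> carrier_mat k n" and Y: "Y \<in> carrier_mat n l" "Y' \<in> carrier_mat l n"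
  shows "mat_rank (X * X' + Y * Y') \<le> k + l"
  using mat_rank_add_le[of "X * X'" n n "Y * Y'"] mat_rank_mult_le[OF X] mat_rank_mult_le[OF Y] X Y by simp

text \<open>The line through \<open>Z Z\<^sup>T\<close> and \<open>U U\<^sup>T\<close> consists of
  matrices \<open>t U U\<^sup>T + (1 - t) Z Z\<^sup>T\<close>, so the isometry bound holds at all
  its points and in its direction. The mean value theorem for the gradient gives the first claim;
  applied once more, to \<open>f\<close>, it gives the global minimality of the critical point among
  factored matrices.\<close>

lemma restricted_strong_monotonicity:
  assumes tcd: "twice_cont_diff n n f" and rip: "RIP n (2 * r) \<delta> f" and \<delta>: "\<delta> < 1"
    and U: "U \<in> carrier_mat n r" and Z: "Z \<in> carrier_mat n r" and crit: "gradient n n f (Z * Z\<^sup>T) = 0\<^sub>m n n"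
  shows "(1 - \<delta>) * (fro_norm (U * U\<^sup>T - Z * Z\<^sup>T))\<^sup>2 \<le> mat_inner (gradient n n f (U * U\<^sup>T)) (U * U\<^sup>T - Z * Z\<^sup>T)"
    and "f (Z * Z\<^sup>T) \<le> f (U * U\<^sup>T)"
proof -
  let ?g = "gradient n n f" and ?H = "hessian n n f"
  define K where "K = U * U\<^sup>T - Z * Z\<^sup>T"
  define N where "N = Z * Z\<^sup>T"
  have N: "N \<in> carrier_mat n n" and K: "K \<in> carrier_mat n n" using U Z by (simp_all add: N_def K_def)
  note grad = twice_cont_diff_gradient[OF tcd] and hess = twice_cont_diff_hessian[OF tcd]
  have gc: "?g Y \<in> carrier_mat n n" if "Y \<in> carrier_mat n n" for Y using grad[OF that] by (simp add: has_gradient_def)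
  define q where "q = (1 - \<delta>) * (fro_norm K)\<^sup>2"
  have q: "0 \<le> q" using \<delta> by (simp add: q_def)
  have P: "N + t \<cdot>\<^sub>m K \<in> carrier_mat n n" for t using N K by simp
  have "mat_rank (U * U\<^sup>T + ((- 1) \<cdot>\<^sub>m Z) * Z\<^sup>T) \<le> r + r" using U Z by (intro mat_rank_add_mult_le) auto
  also have "U * U\<^sup>T + ((- 1) \<cdot>\<^sub>m Z) * Z\<^sup>T = K" unfolding K_def using U Z
    by (simp add: mat_smult_mult) (intro eq_matI, auto)
  finally have rK: "mat_rank K \<le> 2 * r" by simp
  have rP: "mat_rank (N + t \<cdot>\<^sub>m K) \<le> 2 * r" for t
  proof -
    have "mat_rank ((t \<cdot>\<^sub>m U) * U\<^sup>T + ((1 - t) \<cdot>\<^sub>m Z) * Z\<^sup>T) \<le> r + r" using U Z by (intro mat_rank_add_mult_le) auto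
    also have "(t \<cdot>\<^sub>m U) * U\<^sup>T + ((1 - t) \<cdot>\<^sub>m Z) * Z\<^sup>T = N + t \<cdot>\<^sub>m K" unfolding K_def N_def using U Z
      by (simp add: mat_smult_mult) (intro eq_matI, auto simp: algebra_simps)
    finally show ?thesis by simp
  qed
  have low: "q \<le> mat_inner (?H (N + t \<cdot>\<^sub>m K) K) K" for t
    unfolding q_def using rip[unfolded RIP_def] P[of t] K rK rP[of t] by blast
  define \<phi> where "\<phi> t = mat_inner (?g (N + t \<cdot>\<^sub>m K)) K" for t
  have d\<phi>: "(\<phi> has_real_derivative mat_inner (?H (N + t \<cdot>\<^sub>m K) K) K) (at t)" for t
    unfolding \<phi>_def by (rule hessian_line_derivative[OF hess[OF P] N K K gc])
  have N0: "N + 0 \<cdot>\<^sub>m K = N" using N K by (intro eq_matI) auto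
  have N1: "N + 1 \<cdot>\<^sub>m K = U * U\<^sup>T" unfolding N_def K_def using U Z by (intro eq_matI) auto
  have \<phi>0: "\<phi> 0 = 0" unfolding \<phi>_def N0 using crit by (simp add: N_def)
  have \<phi>: "t * q \<le> \<phi> t" if t: "0 < t" for t
  proof -
    obtain z where "\<phi> t - \<phi> 0 = (t - 0) * mat_inner (?H (N + z \<cdot>\<^sub>m K) K) K"
      using MVT2[OF t, of \<phi> "\<lambda>z. mat_inner (?H (N + z \<cdot>\<^sub>m K) K) K"] d\<phi> by blast
    then show ?thesis using \<phi>0 low[of z] t by (simp add: mult_left_mono)
  qed
  show "(1 - \<delta>) * (fro_norm (U * U\<^sup>T - Z * Z\<^sup>T))\<^sup>2 \<le> mat_inner (?g (U * U\<^sup>T)) (U * U\<^sup>T - Z * Z\<^sup>T)"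
  proof -
    have "q \<le> \<phi> 1" using \<phi>[of 1] by simp
    then show ?thesis unfolding \<phi>_def N1 q_def unfolding K_def .
  qed
  have df: "((\<lambda>t. f (N + t \<cdot>\<^sub>m K)) has_real_derivative \<phi> t) (at t)" for t
    unfolding \<phi>_def by (rule gradient_line_derivative[OF grad[OF P] N K])
  obtain z where z: "0 < z" "f (N + 1 \<cdot>\<^sub>m K) - f (N + 0 \<cdot>\<^sub>m K) = (1 - 0) * \<phi> z"
    using MVT2[of 0 1 "\<lambda>t. f (N + t \<cdot>\<^sub>m K)" \<phi>] df by auto
  have "0 \<le> z * q" using z q by simp
  also have "\<dots> \<le> \<phi> z" by (rule \<phi>[OF z(1)])
  finally show "f (Z * Z\<^sup>T) \<le> f (U * U\<^sup>T)" using z(2) unfolding N0 N1 unfolding N_def by simp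
qed

text \<open>The explicit Hessian of the factored objective is evaluated on \<open>V\<close>. Since
  the Hessian of \<open>f\<close> takes the symmetric \<open>S\<close> to a symmetric matrix, the
  two halves of \<open>S\<close> contribute equally and the form closes up to
  \<open>mat_inner (H S) S\<close>.\<close>

lemma hessian_quadratic_form_lower_bound:
  assumes tcd: "twice_cont_diff n n f" and sg: "symmetric_gradient n f"
    and U: "U \<in> carrier_mat n r" and V: "V \<in> carrier_mat n r" and n: "0 < n" and r: "0 < r"
    and lmin: "- c \<le> lambda_min n r (hessian n r (\<lambda>U. f (U * U\<^sup>T)) U)"
  defines "S \<equiv> U * V\<^sup>T + V * U\<^sup>T"
  shows "- c * mat_inner V V \<le> 2 * mat_inner (gradient n n f (U * U\<^sup>T) * V) V
    + mat_inner (hessian n n f (U * U\<^sup>T) S) S"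
proof -
  let ?F = "\<lambda>U. f (U * U\<^sup>T)" and ?M = "U * U\<^sup>T"
  let ?H = "hessian n n f ?M" and ?G = "gradient n n f ?M"
  define T' where "T' K = 2 \<cdot>\<^sub>m (?H (U * K\<^sup>T + K * U\<^sup>T) * U + ?G * K)" for K
  define T where "T = hessian n r ?F U"
  note grad = twice_cont_diff_gradient[OF tcd] and hess = twice_cont_diff_hessian[OF tcd]
  have gc: "gradient n n f Y \<in> carrier_mat n n" if "Y \<in> carrier_mat n n" for Y
    using grad[OF that] by (simp add: has_gradient_def)
  have M: "?M \<in> carrier_mat n n" using U by simp
  have gradF: "has_gradient n r ?F Y (gradient n r ?F Y)" if "Y \<in> carrier_mat n r" for Y
    using gradient_factored[OF grad sg that] by simp
  have gcF: "gradient n r ?F Y \<in> carrier_mat n r" if "Y \<in> carrier_mat n r" for Y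
    using gradF[OF that] by (simp add: has_gradient_def)
  have T': "has_hessian n r ?F U T'"
    unfolding T'_def by (rule has_hessian_factored[OF grad sg U hess[OF M]])
  then have T: "has_hessian n r ?F U T" unfolding T_def hessian_def by (rule someI[of "has_hessian n r ?F U"])
  \<comment> \<open>Eigenvalues are taken of the \<open>SOME\<close> operator \<open>T\<close>, the
    computation uses \<open>T'\<close>.\<close>
  have TV: "T V = T' V" by (rule has_hessian_unique[OF T T' V gcF U])
  have "- c * mat_inner V V \<le> lambda_min n r T * mat_inner V V"
    using lmin unfolding T_def by (intro mult_right_mono) auto
  also have "\<dots> \<le> mat_inner (T V) V"
    using T hessian_self_adjoint[OF gradF T U]
    by (intro lambda_min_quadratic_form n r V) (auto simp: has_hessian_def)
  also have "mat_inner (T V) V = 2 * mat_inner (?G * V) V + mat_inner (?H S) S"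
  proof -
    have S: "S \<in> carrier_mat n n" "S\<^sup>T = S" unfolding S_def using U V
      by (auto simp: mat_expand intro!: comm_add_mat)
    have HS: "?H S \<in> carrier_mat n n" using hess[OF M] S by (simp add: has_hessian_def linear_op_def)
    have HST: "(?H S)\<^sup>T = ?H S"
      by (rule hessian_preserves_symmetric[OF sg hess[OF M] gc M symmetric_mat_self_transpose S(1)])
        (simp_all add: S(2) symmetric_mat_def)
    have e: "mat_inner (?H S) (U * V\<^sup>T) = mat_inner (?H S * U) V" "mat_inner (?H S) (V * U\<^sup>T) = mat_inner (?H S * U) V"
      using mat_inner_symmetric_factor[OF HS HST U V] by auto
    have "mat_inner (?H S) S = 2 * mat_inner (?H S * U) V"
      using HS U V e unfolding S_def by (simp add: mat_inner_expand)
    then show ?thesis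
      unfolding TV T'_def S_def[symmetric] using HS gc[OF M] U V by (simp add: mat_inner_expand)
  qed
  finally show ?thesis .
qed

text \<open>In the direction \<open>y v\<^sup>T\<close> the increment \<open>S\<close> is
  \<open>a y\<^sup>T + y a\<^sup>T\<close> with \<open>a = U v\<close>. Its rank is at most 2, hence
  at most \<open>2 r\<close>, so the upper isometry bound applies. The last term vanishes for
  \<open>y\<close> orthogonal to the columns of \<open>U\<close>.\<close>

lemma rank_one_direction:
  assumes tcd: "twice_cont_diff n n f" and sg: "symmetric_gradient n f" and rip: "RIP n (2 * r) \<delta> f"
    and U: "U \<in> carrier_mat n r" and n: "0 < n" and r: "0 < r"
    and lmin: "- (2 * c) \<le> lambda_min n r (hessian n r (\<lambda>U. f (U * U\<^sup>T)) U)"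
    and v: "v \<in> carrier_mat r 1" "mat_inner v v = 1" and y: "y \<in> carrier_mat n 1"
  shows "- mat_inner (gradient n n f (U * U\<^sup>T) * y) y
    \<le> c * mat_inner y y + (1 + \<delta>) * (mat_inner (U * v) (U * v) * mat_inner y y + (mat_inner (U * v) y)\<^sup>2)"
proof -
  let ?G = "gradient n n f (U * U\<^sup>T)"
  have M: "U * U\<^sup>T \<in> carrier_mat n n" using U by simp
  have G: "?G \<in> carrier_mat n n" using twice_cont_diff_gradient[OF tcd M] by (simp add: has_gradient_def)
  define a where "a = U * v"
  have a: "a \<in> carrier_mat n 1" using U v by (simp add: a_def)
  define V where "V = y * v\<^sup>T"
  have V: "V \<in> carrier_mat n r" using y v by (simp add: V_def)
  define S where "S = U * V\<^sup>T + V * U\<^sup>T"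
  have S': "S = a * y\<^sup>T + y * a\<^sup>T" unfolding S_def V_def a_def using U v y by (simp add: mat_expand)
  have S: "S \<in> carrier_mat n n" unfolding S' using a y by simp
  have prod: "mat_inner (p * x\<^sup>T) (q * z\<^sup>T) = mat_inner z x * mat_inner p q"
    if "p \<in> carrier_mat n 1" "q \<in> carrier_mat n 1" "x \<in> carrier_mat k 1" "z \<in> carrier_mat k 1" for p q x z k
  proof -
    have "mat_inner (p * x\<^sup>T) (q * z\<^sup>T) = mat_inner p (q * z\<^sup>T * x\<^sup>T\<^sup>T)" using that by (intro mat_inner_mult_left) auto
    also have "q * z\<^sup>T * x\<^sup>T\<^sup>T = q * (z\<^sup>T * x)" using that by (simp add: mat_mult_assoc)
    also have "\<dots> = mat_inner z x \<cdot>\<^sub>m q" using that by (subst transpose_mult_col[of z k]) (simp_all add: mat_mult_smult)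
    finally show ?thesis using that by (simp add: mat_inner_expand)
  qed
  have nV: "mat_inner V V = mat_inner y y" unfolding V_def using prod[OF y y v(1) v(1)] v(2) by simp
  have GV: "mat_inner (?G * V) V = mat_inner (?G * y) y"
  proof -
    have "?G * V = (?G * y) * v\<^sup>T" unfolding V_def using G y v by (simp add: mat_mult_assoc)
    then have "mat_inner (?G * V) V = mat_inner ((?G * y) * v\<^sup>T) (y * v\<^sup>T)" by (simp only: V_def)
    also have "\<dots> = mat_inner v v * mat_inner (?G * y) y" using G y v by (intro prod) auto
    finally show ?thesis using v(2) by simp
  qed
  have ya: "mat_inner y a = mat_inner a y" using y a by (intro mat_inner_commute) auto
  have nS: "mat_inner S S = 2 * (mat_inner a a * mat_inner y y + (mat_inner a y)\<^sup>2)"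
    unfolding S' using a y prod[of a a y n y] prod[of a y y n a] prod[of y a a n y] prod[of y y a n a] ya
    by (simp add: mat_inner_expand power2_eq_square)
  have "mat_rank S \<le> 1 + 1" unfolding S' using a y by (intro mat_rank_add_mult_le) auto
  then have rS: "mat_rank S \<le> 2 * r" using r by simp
  have rM: "mat_rank (U * U\<^sup>T) \<le> 2 * r" using mat_rank_mult_le[of U n r "U\<^sup>T" n] U by simp
  have "mat_inner (hessian n n f (U * U\<^sup>T) S) S \<le> (1 + \<delta>) * (fro_norm S)\<^sup>2"
    using rip[unfolded RIP_def] M S rS rM by blast
  then have "- (2 * c) * mat_inner y y \<le> 2 * mat_inner (?G * y) y + (1 + \<delta>) * mat_inner S S"
    using hessian_quadratic_form_lower_bound[OF tcd sg U V n r lmin] unfolding S_def[symmetric] nV GV fro_norm_sq by linarith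
  then show ?thesis unfolding nS a_def[symmetric] by (simp add: algebra_simps)
qed

text \<open>The bound is demanded only at the columns of \<open>X\<close> themselves, because it
  will hold only for vectors orthogonal to the columns of \<open>U\<close>.\<close>

lemma neg_quadratic_form_cols:
  assumes Q: "Q \<in> carrier_mat n n" and X: "X \<in> carrier_mat n k"
    and le: "\<And>j. j < k \<Longrightarrow> - mat_inner (Q * (X * unit_col k j)) (X * unit_col k j)
      \<le> q * mat_inner (X * unit_col k j) (X * unit_col k j)"
  shows "- mat_inner (Q * X) X \<le> q * mat_inner X X"
proof -
  have "- mat_inner (Q * X) X = (\<Sum>j<k. - mat_inner (Q * X * unit_col k j) (X * unit_col k j))"
    using X Q by (subst mat_inner_sum_unit_cols[of "Q * X" X k]) (auto simp: sum_negf)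
  also have "\<dots> = (\<Sum>j<k. - mat_inner (Q * (X * unit_col k j)) (X * unit_col k j))"
    using X Q by (intro sum.cong refl, subst mat_mult_assoc) auto
  also have "\<dots> \<le> (\<Sum>j<k. q * mat_inner (X * unit_col k j) (X * unit_col k j))" by (intro sum_mono le) auto
  also have "\<dots> = q * mat_inner X X"
    using X by (subst mat_inner_sum_unit_cols[of X X k]) (auto simp: sum_distrib_left)
  finally show ?thesis .
qed

text \<open>\<open>c\<close> is the smallest eigenvalue of \<open>U\<^sup>T U\<close>, exposed
  through its maximality as a lower bound. The first estimate is crude but meaningful for
  \<open>c = 0\<close>; the second is the sharp one and degenerates as \<open>c\<close> tends to
  zero.\<close>

lemma approximate_critical_point_bounds:
  assumes tcd: "twice_cont_diff n n f" and sg: "symmetric_gradient n f" and rip: "RIP n (2 * r) \<delta> f"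
    and \<delta>: "0 \<le> \<delta>" "\<delta> < 1" and n: "0 < n" and r: "0 < r"
    and U: "U \<in> carrier_mat n r" and Z: "Z \<in> carrier_mat n r" and crit: "gradient n n f (Z * Z\<^sup>T) = 0\<^sub>m n n"
    and small: "fro_norm (gradient n r (\<lambda>U. f (U * U\<^sup>T)) U) \<le> lam"
    and lmin: "- (2 * lam) \<le> lambda_min n r (hessian n r (\<lambda>U. f (U * U\<^sup>T)) U)"
  defines "E \<equiv> fro_norm (U * U\<^sup>T - Z * Z\<^sup>T)"
  obtains c where "0 \<le> c" "c \<le> (fro_norm U)\<^sup>2"
    "\<And>k. (\<And>x. x \<in> carrier_mat r 1 \<Longrightarrow> k * mat_inner x x \<le> mat_inner (U * x) (U * x)) \<Longrightarrow> k \<le> c"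
    "(1 - \<delta>) * E\<^sup>2 \<le> lam / 2 * fro_norm U + (lam + 2 * (1 + \<delta>) * c) * (fro_norm Z)\<^sup>2"
    "0 < c \<Longrightarrow> (1 - 3 * \<delta>) / 2 * E\<^sup>2 \<le> lam * (fro_norm U / 2 + (fro_norm Z)\<^sup>2 / sqrt c + (fro_norm Z)\<^sup>2)"
proof -
  let ?G = "gradient n n f (U * U\<^sup>T)"
  note grad = twice_cont_diff_gradient[OF tcd]
  have M: "U * U\<^sup>T \<in> carrier_mat n n" using U by simp
  have G: "?G \<in> carrier_mat n n" using grad[OF M] by (simp add: has_gradient_def)
  have GT: "?G\<^sup>T = ?G" using sg M symmetric_mat_self_transpose[of U]
    by (auto simp: symmetric_gradient_def symmetric_mat_def)
  have lam: "0 \<le> lam" using small fro_norm_nonneg order_trans by blast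
  have gU: "gradient n r (\<lambda>U. f (U * U\<^sup>T)) U = 2 \<cdot>\<^sub>m (?G * U)"
    by (rule gradient_factored(2)[OF grad sg U])
  \<comment> \<open>The gradient of the factored objective is twice \<open>G * U\<close>.\<close>
  have GU: "fro_norm (?G * U) \<le> lam / 2"
    using small unfolding gU by (simp add: fro_norm_smult)
  have UTU: "U\<^sup>T * U \<in> carrier_mat r r" using U by simp
  have UU: "mat_inner (U\<^sup>T * U * x) y = mat_inner (U * x) (U * y)" "mat_inner x (U\<^sup>T * U * y) = mat_inner (U * x) (U * y)"
    if "x \<in> carrier_mat r 1" "y \<in> carrier_mat r 1" for x y
  proof -
    have "U\<^sup>T * U * x = U\<^sup>T * (U * x)" "U\<^sup>T * U * y = U\<^sup>T * (U * y)" using U that by (simp_all add: mat_mult_assoc)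
    then show "mat_inner (U\<^sup>T * U * x) y = mat_inner (U * x) (U * y)" "mat_inner x (U\<^sup>T * U * y) = mat_inner (U * x) (U * y)"
      using U that by (simp_all add: mat_inner_mult_right)
  qed
  have "mat_inner (U\<^sup>T * U * x) y = mat_inner x (U\<^sup>T * U * y)"
    if "x \<in> carrier_mat r 1" "y \<in> carrier_mat r 1" for x y using UU[OF that] by simp
  then obtain c v where v: "v \<in> carrier_mat r 1" "mat_inner v v = 1" "U\<^sup>T * U * v = c \<cdot>\<^sub>m v"
    and c: "\<And>x. x \<in> carrier_mat r 1 \<Longrightarrow> c * mat_inner x x \<le> mat_inner (U\<^sup>T * U * x) x"
    using symmetric_min_eigenvector[OF UTU r] by metis
  have lb: "c * mat_inner x x \<le> mat_inner (U * x) (U * x)" if "x \<in> carrier_mat r 1" for x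
    using c[OF that] UU(1)[OF that that] by simp
  have cv: "mat_inner (U * v) (U * v) = c"
    using UU(1)[OF v(1) v(1)] v by (simp add: mat_inner_expand)
  have c0: "0 \<le> c" unfolding cv[symmetric] by simp
  have "c = (fro_norm (U * v))\<^sup>2" by (simp add: fro_norm_sq cv)
  also have "\<dots> \<le> (fro_norm U * fro_norm v)\<^sup>2" using U v by (intro power_mono fro_norm_mult_le) auto
  also have "fro_norm v = 1" using v by (simp add: fro_norm_def)
  finally have cU: "c \<le> (fro_norm U)\<^sup>2" by simp
  note dir = rank_one_direction[OF tcd sg rip U n r lmin v(1,2), unfolded cv]
  have "(1 - \<delta>) * E\<^sup>2 \<le> mat_inner ?G (U * U\<^sup>T - Z * Z\<^sup>T)"
    unfolding E_def by (rule restricted_strong_monotonicity(1)[OF tcd rip \<delta>(2) U Z crit])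
  also have "\<dots> = mat_inner (?G * U) U - mat_inner (?G * Z) Z"
    using G U Z mat_inner_symmetric_factor(1)[OF G GT U U] mat_inner_symmetric_factor(1)[OF G GT Z Z]
    by (simp add: mat_inner_expand)
  also have "mat_inner (?G * U) U \<le> lam / 2 * fro_norm U"
  proof -
    have "mat_inner (?G * U) U \<le> fro_norm (?G * U) * fro_norm U" using G U by (intro mat_inner_le) auto
    also have "\<dots> \<le> lam / 2 * fro_norm U" using GU by (rule mult_right_mono) simp
    finally show ?thesis .
  qed
  finally have base: "(1 - \<delta>) * E\<^sup>2 \<le> lam / 2 * fro_norm U - mat_inner (?G * Z) Z" by simp
  have "- mat_inner (?G * Z) Z \<le> (lam + 2 * (1 + \<delta>) * c) * mat_inner Z Z"
  proof (rule neg_quadratic_form_cols[OF G Z])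
    fix j assume "j < r"
    let ?y = "Z * unit_col r j"
    have y: "?y \<in> carrier_mat n 1" using Z by simp
    \<comment> \<open>Columns of \<open>Z\<close> need not be orthogonal to \<open>U\<close>; the
      cross term is as large as the main one at worst, which doubles the factor of
      \<open>c\<close>.\<close>
    have "(mat_inner (U * v) ?y)\<^sup>2 \<le> mat_inner (U * v) (U * v) * mat_inner ?y ?y"
      using U v y by (intro mat_inner_Cauchy_Schwarz_sq) auto
    then have "(1 + \<delta>) * (c * mat_inner ?y ?y + (mat_inner (U * v) ?y)\<^sup>2) \<le> (1 + \<delta>) * (2 * (c * mat_inner ?y ?y))"
      using \<delta> by (intro mult_left_mono) (auto simp: cv)
    then show "- mat_inner (?G * ?y) ?y \<le> (lam + 2 * (1 + \<delta>) * c) * mat_inner ?y ?y"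
      using dir[OF y] by (simp add: algebra_simps)
  qed
  then have 1: "(1 - \<delta>) * E\<^sup>2 \<le> lam / 2 * fro_norm U + (lam + 2 * (1 + \<delta>) * c) * (fro_norm Z)\<^sup>2"
    using base by (simp add: fro_norm_sq)
  have 2: "(1 - 3 * \<delta>) / 2 * E\<^sup>2 \<le> lam * (fro_norm U / 2 + (fro_norm Z)\<^sup>2 / sqrt c + (fro_norm Z)\<^sup>2)" if cp: "0 < c"
  proof -
    obtain W Y where W: "W \<in> carrier_mat r r" and Y: "Y \<in> carrier_mat n r" and ZWY: "Z = U * W + Y"
      and UY: "U\<^sup>T * Y = 0\<^sub>m r r" and bY: "2 * c * (fro_norm Y)\<^sup>2 \<le> E\<^sup>2"
      and bW: "c * (fro_norm W)\<^sup>2 \<le> (fro_norm Z)\<^sup>2" and YZ: "(fro_norm Y)\<^sup>2 \<le> (fro_norm Z)\<^sup>2"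
      using orthogonal_decomposition[OF U Z cp lb] unfolding E_def by metis
    have YZ': "fro_norm Y \<le> fro_norm Z" using YZ by (simp add: power_mono_iff)
    have "(fro_norm W)\<^sup>2 \<le> (fro_norm Z / sqrt c)\<^sup>2" using bW cp by (simp add: power_divide field_simps)
    then have nW: "fro_norm W \<le> fro_norm Z / sqrt c" by (rule power2_le_imp_le) (use cp in simp)
    have negY: "- mat_inner (?G * Y) Y \<le> (lam + (1 + \<delta>) * c) * mat_inner Y Y"
    proof (rule neg_quadratic_form_cols[OF G Y])
      fix j assume "j < r"
      let ?y = "Y * unit_col r j"
      have y: "?y \<in> carrier_mat n 1" using Y by simp
      have "mat_inner (U * v) ?y = mat_inner v (U\<^sup>T * ?y)" using U v y by (intro mat_inner_mult_right) auto
      also have "U\<^sup>T * ?y = (U\<^sup>T * Y) * unit_col r j" using U Y by (simp add: mat_mult_assoc)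
      also have "mat_inner v \<dots> = 0" unfolding UY using v by simp
      finally show "- mat_inner (?G * ?y) ?y \<le> (lam + (1 + \<delta>) * c) * mat_inner ?y ?y"
        using dir[OF y] by (simp add: algebra_simps)
    qed
    \<comment> \<open>Arranged so that every term except the last contains the small product
      \<open>G * U\<close>.\<close>
    have splitZ: "mat_inner (?G * Z) Z = mat_inner (?G * U * W) Z + mat_inner (?G * U * W) Y + mat_inner (?G * Y) Y"
    proof -
      have "?G * Z = ?G * U * W + ?G * Y" unfolding ZWY using G U W Y by (simp add: mat_mult_add mat_mult_assoc)
      then have "mat_inner (?G * Z) Z = mat_inner (?G * U * W) Z + mat_inner (?G * Y) Z"
        using G U W Y Z by (simp add: mat_inner_expand)
      also have "mat_inner (?G * Y) Z = mat_inner (?G * Y) (U * W) + mat_inner (?G * Y) Y"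
        unfolding ZWY using G U W Y by (simp add: mat_inner_expand)
      also have "mat_inner (?G * Y) (U * W) = mat_inner Y (?G\<^sup>T * (U * W))" using G U W Y by (intro mat_inner_mult_right) auto
      also have "?G\<^sup>T * (U * W) = ?G * U * W" unfolding GT using G U W by (simp add: mat_mult_assoc)
      also have "mat_inner Y (?G * U * W) = mat_inner (?G * U * W) Y" using G U W Y by (intro mat_inner_commute) auto
      finally show ?thesis by simp
    qed
    have nGUW: "fro_norm (?G * U * W) \<le> lam / 2 * (fro_norm Z / sqrt c)"
    proof -
      have "fro_norm (?G * U * W) \<le> fro_norm (?G * U) * fro_norm W" using G U W by (intro fro_norm_mult_le) auto
      also have "\<dots> \<le> lam / 2 * (fro_norm Z / sqrt c)" using GU nW lam by (intro mult_mono) auto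
      finally show ?thesis .
    qed
    have bnd: "\<bar>mat_inner (?G * U * W) X\<bar> \<le> lam / 2 * (fro_norm Z / sqrt c) * fro_norm Z"
      if X: "X \<in> carrier_mat n r" "fro_norm X \<le> fro_norm Z" for X
    proof -
      have "\<bar>mat_inner (?G * U * W) X\<bar> \<le> fro_norm (?G * U * W) * fro_norm X"
        using G U W X by (intro mat_inner_Cauchy_Schwarz) auto
      also have "\<dots> \<le> lam / 2 * (fro_norm Z / sqrt c) * fro_norm Z" using nGUW X lam cp by (intro mult_mono) auto
      finally show ?thesis .
    qed
    from bnd[OF Z order_refl] bnd[OF Y YZ']
    have "\<bar>mat_inner (?G * U * W) Z\<bar> + \<bar>mat_inner (?G * U * W) Y\<bar> \<le> 2 * (lam / 2 * (fro_norm Z / sqrt c) * fro_norm Z)"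
      by linarith
    also have "\<dots> = lam * ((fro_norm Z)\<^sup>2 / sqrt c)" by (simp add: power2_eq_square)
    finally have cross: "\<bar>mat_inner (?G * U * W) Z\<bar> + \<bar>mat_inner (?G * U * W) Y\<bar> \<le> lam * ((fro_norm Z)\<^sup>2 / sqrt c)" .
    have "- mat_inner (?G * Z) Z \<le> lam * ((fro_norm Z)\<^sup>2 / sqrt c) + (lam + (1 + \<delta>) * c) * (fro_norm Y)\<^sup>2"
      using negY splitZ cross unfolding fro_norm_sq by linarith
    \<comment> \<open>Written with \<open>2 * c\<close> so that the bound on \<open>Y\<close>
      applies. The resulting \<open>(1 + \<delta>) / 2\<close> is subtracted from
      \<open>1 - \<delta>\<close> and leaves \<open>(1 - 3 * \<delta>) / 2\<close>.\<close>
    also have "(lam + (1 + \<delta>) * c) * (fro_norm Y)\<^sup>2 = lam * (fro_norm Y)\<^sup>2 + (1 + \<delta>) / 2 * (2 * c * (fro_norm Y)\<^sup>2)"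
      by (simp add: algebra_simps)
    also have "\<dots> \<le> lam * (fro_norm Z)\<^sup>2 + (1 + \<delta>) / 2 * E\<^sup>2"
      using YZ bY lam \<delta> by (intro add_mono mult_left_mono) auto
    finally have "- mat_inner (?G * Z) Z \<le> lam * ((fro_norm Z)\<^sup>2 / sqrt c) + (lam * (fro_norm Z)\<^sup>2 + (1 + \<delta>) / 2 * E\<^sup>2)"
      by simp
    moreover have "(1 - 3 * \<delta>) / 2 * E\<^sup>2 = (1 - \<delta>) * E\<^sup>2 - (1 + \<delta>) / 2 * E\<^sup>2" by (simp add: field_simps)
    moreover have "lam * (fro_norm U / 2 + (fro_norm Z)\<^sup>2 / sqrt c + (fro_norm Z)\<^sup>2)
        = lam / 2 * fro_norm U + lam * ((fro_norm Z)\<^sup>2 / sqrt c) + lam * (fro_norm Z)\<^sup>2"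
      by (simp add: distrib_left)
    ultimately show ?thesis using base by linarith
  qed
  show thesis
  proof (rule that[OF c0 cU _ 1 2])
    fix k assume "\<And>x. x \<in> carrier_mat r 1 \<Longrightarrow> k * mat_inner x x \<le> mat_inner (U * x) (U * x)"
    from this[OF v(1)] show "k \<le> c" using v(2) cv by simp
  qed
qed

text \<open>Here \<open>x\<close> stands for the squared norm of \<open>U\<close>. The left side of
  the crude estimate grows quadratically in \<open>x\<close>, since \<open>E\<close> grows linearly,
  while the right side grows linearly because \<open>c \<le> x\<close> and, for
  \<open>1 \<le> x\<close>, also \<open>u \<le> x\<close>.\<close>

lemma norm_bound_from_quartic:
  fixes x r b m E c u lam :: real
  assumes r: "1 \<le> r" and b: "0 \<le> b" and m: "0 \<le> m" and x: "0 \<le> x" and u: "u\<^sup>2 = x" and c: "c \<le> x"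
    and lam: "0 \<le> lam" "lam \<le> 1" and \<delta>: "0 \<le> \<delta>" "\<delta> < 1 / 3" and c0: "0 \<le> c" and u0: "0 \<le> u"
    and E: "x / r - m \<le> E"
    and le: "(1 - \<delta>) * E\<^sup>2 \<le> lam / 2 * u + (lam + 2 * (1 + \<delta>) * c) * b"
  shows "x \<le> 1 + 2 * r * m + 6 * r\<^sup>2 * (1 + 4 * b)"
proof (rule ccontr)
  assume "\<not> ?thesis"
  then have x1: "1 + 2 * r * m + 6 * r\<^sup>2 * (1 + 4 * b) < x" by simp
  have p: "0 \<le> 2 * r * m" "0 \<le> 6 * r\<^sup>2 * (1 + 4 * b)" using r m b by auto
  have "1 \<le> x" "2 * r * m \<le> x" using x1 p by linarith+
  have "u \<le> x"
  proof (cases "u \<le> 1")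
    case False
    then have "u * 1 \<le> u * u" by (intro mult_left_mono) auto
    then show ?thesis using u by (simp add: power2_eq_square)
  qed (use \<open>1 \<le> x\<close> in simp)
  \<comment> \<open>Half of \<open>x / r\<close> pays for \<open>m\<close>. The square of the other
    half, times \<open>2 / 3\<close>, is \<open>x\<^sup>2 / (6 r\<^sup>2)\<close>, the source of the
    6 in the bound.\<close>
  have "x / (2 * r) \<le> x / r - m" using \<open>2 * r * m \<le> x\<close> r by (simp add: field_simps)
  then have "x / (2 * r) \<le> E" using E by simp
  moreover have "0 \<le> x / (2 * r)" using x r by simp
  ultimately have "(x / (2 * r))\<^sup>2 \<le> E\<^sup>2" by (intro power_mono)
  then have "2 / 3 * (x / (2 * r))\<^sup>2 \<le> (1 - \<delta>) * E\<^sup>2" using \<delta> by (intro mult_mono) auto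
  also have "\<dots> \<le> lam / 2 * u + (lam + 2 * (1 + \<delta>) * c) * b" by (rule le)
  \<comment> \<open>\<open>8 / 3\<close> bounds \<open>2 * (1 + \<delta>)\<close>, as
    \<open>\<delta>\<close> is below \<open>1 / 3\<close>.\<close>
  also have "\<dots> \<le> 1 / 2 * x + (x + 8 / 3 * x) * b"
    by (intro add_mono mult_mono) (use lam \<open>u \<le> x\<close> \<open>1 \<le> x\<close> b u0 x \<delta> c c0 in auto)
  also have "\<dots> = x * (1 + 4 * b) - (x / 2 + x * b / 3)" by (simp add: field_simps)
  also have "\<dots> \<le> x * (1 + 4 * b)" using mult_nonneg_nonneg[OF x b] x by linarith
  finally have "2 / 3 * (x / (2 * r))\<^sup>2 \<le> x * (1 + 4 * b)" .
  then have "x * x \<le> x * (6 * r\<^sup>2 * (1 + 4 * b))" using r by (simp add: power_divide field_simps power2_eq_square)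
  then have "x \<le> 6 * r\<^sup>2 * (1 + 4 * b)" using \<open>1 \<le> x\<close> by simp
  then show False using x1 p by linarith
qed

text \<open>\<open>R\<close> cancels in \<open>(Z * R) * (Z * R)\<^sup>T\<close>, so all rotated
  factors share the minimal value.\<close>

lemma global_minimum_rotated_factor:
  assumes tcd: "twice_cont_diff n n f" and rip: "RIP n (2 * r) \<delta> f" and \<delta>: "\<delta> < 1"
    and Z: "Z \<in> carrier_mat n r" and crit: "gradient n n f (Z * Z\<^sup>T) = 0\<^sub>m n n"
    and R: "R \<in> carrier_mat r r" "R * R\<^sup>T = 1\<^sub>m r"
  shows "Z * R \<in> global_minima n r (\<lambda>U. f (U * U\<^sup>T))"
proof -
  have "(Z * R) * (Z * R)\<^sup>T = Z * (R * R\<^sup>T) * Z\<^sup>T" using Z R(1) by (simp add: mat_expand)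
  then have "(Z * R) * (Z * R)\<^sup>T = Z * Z\<^sup>T" unfolding R(2) using Z by simp
  then show ?thesis unfolding global_minima_def
    using Z R restricted_strong_monotonicity(2)[OF tcd rip \<delta> _ Z crit] by simp
qed

text \<open>\<open>lam1\<close> is produced before \<open>n\<close>, \<open>f\<close>,
  \<open>Z\<close>, \<open>U\<close> are quantified, which makes it depend on the five listed
  parameters alone.\<close>

lemma approximate_second_order_point_near_minimum:
  fixes \<delta> s m \<alpha> :: real and r :: nat
  assumes \<delta>: "0 \<le> \<delta>" "\<delta> < 1 / 3" and r: "1 \<le> r" and \<alpha>: "0 < \<alpha>" and s: "0 < s" and m: "0 \<le> m"
  obtains lam1 where "0 < lam1"
    "\<And>n f Z U lam. twice_cont_diff n n f \<Longrightarrow> symmetric_gradient n f \<Longrightarrow> RIP n (2 * r) \<delta> f \<Longrightarrow> 0 < n \<Longrightarrow>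
      Z \<in> carrier_mat n r \<Longrightarrow> U \<in> carrier_mat n r \<Longrightarrow> gradient n n f (Z * Z\<^sup>T) = 0\<^sub>m n n \<Longrightarrow>
      (\<And>x. x \<in> carrier_mat r 1 \<Longrightarrow> s * mat_inner x x \<le> mat_inner (Z * x) (Z * x)) \<Longrightarrow>
      fro_norm (Z * Z\<^sup>T) = m \<Longrightarrow> 0 < lam \<Longrightarrow> lam \<le> lam1 \<Longrightarrow>
      fro_norm (gradient n r (\<lambda>U. f (U * U\<^sup>T)) U) \<le> lam \<Longrightarrow>
      - (2 * lam) \<le> lambda_min n r (hessian n r (\<lambda>U. f (U * U\<^sup>T)) U) \<Longrightarrow>
      \<exists>R \<in> carrier_mat r r. R * R\<^sup>T = 1\<^sub>m r \<and> fro_norm (U - Z * R) \<le> \<alpha>"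
proof -
  \<comment> \<open>\<open>b\<close> and \<open>B\<close> bound the squared norms of
    \<open>Z\<close> and \<open>U\<close>, \<open>c0\<close> bounds \<open>c\<close> from below,
    \<open>C\<close> is the factor of \<open>lam\<close> in the sharp estimate, \<open>k\<close>
    converts a distance of Gram matrices into one of factors, and \<open>\<eta>\<close> is the Gram
    distance to be reached.\<close>
  define b where "b = real r * m"
  define B where "B = 1 + 2 * real r * m + 6 * (real r)\<^sup>2 * (1 + 4 * b)"
  define c0 where "c0 = min (s / 2) (s\<^sup>2 / (64 * (b + 1)))"
  define C where "C = B + b / sqrt c0 + b"
  define k where "k = sqrt b / s + 1 / sqrt (2 * s) + 1"
  define \<eta> where "\<eta> = min (s / 2) (\<alpha> / k)"
  \<comment> \<open>The three bounds serve, in this order, the norm bound for \<open>U\<close>, the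
    lower bound for \<open>c\<close>, and the final estimate of \<open>E\<close> by
    \<open>\<eta>\<close>.\<close>
  define lam1 where "lam1 = min 1 (min (s\<^sup>2 / (24 * (B + b))) (\<eta>\<^sup>2 * ((1 - 3 * \<delta>) / 2) / C))"
  have b: "0 \<le> b" using m by (simp add: b_def)
  have "0 \<le> 2 * real r * m" "0 \<le> 6 * (real r)\<^sup>2 * (1 + 4 * b)" using m b by auto
  then have B: "1 \<le> B" unfolding B_def by linarith
  have "0 < c0" using s b by (simp add: c0_def)
  moreover have "c0 \<le> s / 2" "c0 \<le> s\<^sup>2 / (64 * (b + 1))"
    unfolding c0_def by (rule min.cobounded1, rule min.cobounded2)
  ultimately have c0: "0 < c0" "c0 \<le> s / 2" "c0 \<le> s\<^sup>2 / (64 * (b + 1))" by blast+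
  have C: "0 < C" unfolding C_def using B b c0 by (intro add_pos_nonneg) auto
  have k: "0 < k" unfolding k_def using s b by (intro add_nonneg_pos) auto
  have "0 < \<eta>" using s \<alpha> k by (simp add: \<eta>_def)
  moreover have "\<eta> \<le> s / 2" "\<eta> \<le> \<alpha> / k" unfolding \<eta>_def by (rule min.cobounded1, rule min.cobounded2)
  ultimately have \<eta>: "0 < \<eta>" "\<eta> \<le> s / 2" "\<eta> \<le> \<alpha> / k" by blast+
  have lam1: "0 < lam1" unfolding lam1_def using s B b C \<eta> \<delta> by auto
  show thesis
  proof (rule that[OF lam1])
    fix n f Z U lam
    assume tcd: "twice_cont_diff n n f" and sg: "symmetric_gradient n f" and rip: "RIP n (2 * r) \<delta> f" and n: "0 < n"
      and Z: "Z \<in> carrier_mat n r" and U: "U \<in> carrier_mat n r" and crit: "gradient n n f (Z * Z\<^sup>T) = 0\<^sub>m n n"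
      and lb: "\<And>x. x \<in> carrier_mat r 1 \<Longrightarrow> s * mat_inner x x \<le> mat_inner (Z * x) (Z * x)"
      and mZ: "fro_norm (Z * Z\<^sup>T) = m" and lam: "0 < lam" "lam \<le> lam1"
      and small: "fro_norm (gradient n r (\<lambda>U. f (U * U\<^sup>T)) U) \<le> lam"
      and lmin: "- (2 * lam) \<le> lambda_min n r (hessian n r (\<lambda>U. f (U * U\<^sup>T)) U)"
    have lam': "lam \<le> 1" "lam \<le> s\<^sup>2 / (24 * (B + b))" "lam \<le> \<eta>\<^sup>2 * ((1 - 3 * \<delta>) / 2) / C"
      using lam by (auto simp: lam1_def)
    define E where "E = fro_norm (U * U\<^sup>T - Z * Z\<^sup>T)"
    have \<delta>1: "\<delta> < 1" using \<delta> by simp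
    have r0: "0 < r" using r by simp
    obtain c where c: "0 \<le> c" "c \<le> (fro_norm U)\<^sup>2"
      and cmax: "\<And>k. (\<And>x. x \<in> carrier_mat r 1 \<Longrightarrow> k * mat_inner x x \<le> mat_inner (U * x) (U * x)) \<Longrightarrow> k \<le> c"
      and E1: "(1 - \<delta>) * E\<^sup>2 \<le> lam / 2 * fro_norm U + (lam + 2 * (1 + \<delta>) * c) * (fro_norm Z)\<^sup>2"
      and E2: "0 < c \<Longrightarrow> (1 - 3 * \<delta>) / 2 * E\<^sup>2 \<le> lam * (fro_norm U / 2 + (fro_norm Z)\<^sup>2 / sqrt c + (fro_norm Z)\<^sup>2)"
      using approximate_critical_point_bounds[OF tcd sg rip \<delta>(1) \<delta>1 n r0 U Z crit small lmin] unfolding E_def by blast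
    have E0: "0 \<le> E" by (simp add: E_def)
    have Zb: "(fro_norm Z)\<^sup>2 \<le> b" using fro_norm_sq_le_gram[OF Z] mZ by (simp add: b_def)
    have E1': "(1 - \<delta>) * E\<^sup>2 \<le> lam / 2 * fro_norm U + (lam + 2 * (1 + \<delta>) * c) * b"
    proof -
      have "(lam + 2 * (1 + \<delta>) * c) * (fro_norm Z)\<^sup>2 \<le> (lam + 2 * (1 + \<delta>) * c) * b"
        using Zb lam c \<delta> by (intro mult_left_mono) auto
      then show ?thesis using E1 by linarith
    qed
    have UB: "(fro_norm U)\<^sup>2 \<le> B" unfolding B_def
    proof (rule norm_bound_from_quartic[where u = "fro_norm U" and lam = lam and \<delta> = \<delta> and c = c and E = E])
      have "fro_norm (U * U\<^sup>T) \<le> E + m"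
      proof -
        have "U * U\<^sup>T = (U * U\<^sup>T - Z * Z\<^sup>T) + Z * Z\<^sup>T" using U Z by (intro eq_matI) auto
        then show ?thesis unfolding E_def mZ[symmetric]
          using fro_norm_add_le[of "U * U\<^sup>T - Z * Z\<^sup>T" "Z * Z\<^sup>T"] U Z by simp
      qed
      then have "(fro_norm U)\<^sup>2 / real r \<le> E + m"
        using fro_norm_sq_le_gram[OF U] r by (simp add: divide_le_eq mult.commute) (meson mult_left_mono of_nat_0_le_iff order_trans)
      then show "(fro_norm U)\<^sup>2 / real r - m \<le> E" by simp
    qed (use r b m c lam lam' \<delta> E1' in auto)
    have UB': "fro_norm U \<le> B"
    proof (rule power2_le_imp_le)
      have "B * 1 \<le> B * B" using B by (intro mult_left_mono) auto
      then show "(fro_norm U)\<^sup>2 \<le> B\<^sup>2" using UB by (simp add: power2_eq_square)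
    qed (use B in simp)
    have cc: "c0 \<le> c"
    proof (rule ccontr)
      assume "\<not> c0 \<le> c"
      then have lt: "c < c0" by simp
      \<comment> \<open>The choice of \<open>lam1\<close> and of \<open>c0\<close> makes both parts
        of the right side at most \<open>s\<^sup>2 / 24\<close>, so \<open>E\<^sup>2\<close> is at
        most \<open>s\<^sup>2 / 8\<close>.\<close>
      have "2 / 3 * E\<^sup>2 \<le> (1 - \<delta>) * E\<^sup>2" using \<delta> by (intro mult_right_mono) auto
      also have "\<dots> \<le> lam / 2 * fro_norm U + (lam + 2 * (1 + \<delta>) * c) * b" by (rule E1')
      also have "\<dots> \<le> lam * B + (lam + 8 / 3 * c0) * b"
      proof (intro add_mono mult_right_mono)
        have "lam / 2 * fro_norm U \<le> lam * fro_norm U" using lam by (intro mult_right_mono) auto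
        also have "\<dots> \<le> lam * B" using UB' lam by (intro mult_left_mono) auto
        finally show "lam / 2 * fro_norm U \<le> lam * B" .
        show "2 * (1 + \<delta>) * c \<le> 8 / 3 * c0" using \<delta> lt c by (intro mult_mono) auto
      qed (use b in auto)
      also have "\<dots> = lam * (B + b) + 8 / 3 * c0 * b" by (simp add: algebra_simps)
      also have "lam * (B + b) \<le> s\<^sup>2 / 24" using lam'(2) B b by (simp add: field_simps)
      also have "8 / 3 * c0 * b \<le> s\<^sup>2 / 24"
      proof -
        have "c0 * b \<le> c0 * (b + 1)" using c0 by simp
        also have "\<dots> \<le> s\<^sup>2 / 64" using c0(3) b by (simp add: field_simps)
        finally have "8 / 3 * (c0 * b) \<le> s\<^sup>2 / 24" by linarith
        then show ?thesis unfolding mult.assoc .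
      qed
      finally have "E\<^sup>2 \<le> s\<^sup>2 / 8" by simp
      also have "\<dots> \<le> (s / 2)\<^sup>2" by (simp add: power_divide)
      finally have "E \<le> s / 2" by (rule power2_le_imp_le) (use s in simp)
      \<comment> \<open>Closeness of the Gram matrices forces a large smallest eigenvalue, against
        \<open>c < c0 \<le> s / 2\<close>.\<close>
      then have "s / 2 \<le> c" unfolding E_def by (intro cmax gram_close_imp_factor_close(1)[OF Z U s lb]) auto
      then show False using lt c0 by linarith
    qed
    have "(1 - 3 * \<delta>) / 2 * E\<^sup>2 \<le> lam * (fro_norm U / 2 + (fro_norm Z)\<^sup>2 / sqrt c + (fro_norm Z)\<^sup>2)"
      using E2 cc c0 by simp
    also have "\<dots> \<le> lam * C" unfolding C_def
    proof (intro mult_left_mono add_mono)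
      show "fro_norm U / 2 \<le> B" using UB' fro_norm_nonneg[of U] by linarith
      show "(fro_norm Z)\<^sup>2 / sqrt c \<le> b / sqrt c0" using Zb cc c0 b by (intro frac_le) auto
    qed (use Zb lam in auto)
    also have "\<dots> \<le> \<eta>\<^sup>2 * ((1 - 3 * \<delta>) / 2)" using lam'(3) C by (simp add: field_simps)
    finally have "E\<^sup>2 \<le> \<eta>\<^sup>2" using \<delta> by (simp add: mult.commute[of "\<eta>\<^sup>2"] divide_right_mono)
    then have E\<eta>: "E \<le> \<eta>" by (rule power2_le_imp_le) (use \<eta> in simp)
    then have "E \<le> s / 2" using \<eta> by simp
    then obtain R where R: "R \<in> carrier_mat r r" "R * R\<^sup>T = 1\<^sub>m r"
      "fro_norm (U - Z * R) \<le> E * (fro_norm Z / s + 1 / sqrt (2 * s))"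
      using gram_close_imp_factor_close(2)[OF Z U s lb] unfolding E_def by blast
    note R(3)
    also have "E * (fro_norm Z / s + 1 / sqrt (2 * s)) \<le> \<eta> * k"
    proof (rule mult_mono)
      have "fro_norm Z \<le> sqrt b" using Zb by (simp add: real_le_rsqrt)
      then have "fro_norm Z / s \<le> sqrt b / s" using s by (simp add: divide_right_mono)
      then show "fro_norm Z / s + 1 / sqrt (2 * s) \<le> k" by (simp add: k_def)
    qed (use E\<eta> \<eta> s in auto)
    also have "\<dots> \<le> \<alpha>" using \<eta>(3) k by (simp add: pos_le_divide_eq)
    finally show "\<exists>R \<in> carrier_mat r r. R * R\<^sup>T = 1\<^sub>m r \<and> fro_norm (U - Z * R) \<le> \<alpha>" using R by blast
  qed
qed

theorem theorem7:
  fixes \<delta> s m \<alpha> :: real and r :: nat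
  assumes "0 \<le> \<delta>" and "\<delta> < 1 / 3" and "1 \<le> r" and "0 < \<alpha>"
  shows "\<exists>lam1 > 0. \<forall>(n :: nat) (f :: real mat \<Rightarrow> real) (Mstar :: real mat).
    twice_cont_diff n n f \<and> symmetric_gradient n f \<and> RIP n (2 * r) \<delta> f \<and>
    psd_mat n Mstar \<and> mat_rank Mstar = r \<and> gradient n n f Mstar = 0\<^sub>m n n \<and>
    singular_value r Mstar = s \<and> fro_norm Mstar = m \<longrightarrow>
    (\<forall>lam. 0 < lam \<and> lam \<le> lam1 \<longrightarrow>
       strict_saddle n r (\<lambda>U. f (U * U\<^sup>T)) \<alpha> lam (2 * lam))"
proof (cases "0 < s \<and> 0 \<le> m")
  case False
  \<comment> \<open>\<open>s\<close> and \<open>m\<close> are arbitrary reals here. Unless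
    \<open>s\<close> is positive and \<open>m\<close> nonnegative no minimizer matches them, and any
    constant will do.\<close>
  have "False" if "psd_mat n Mstar" "mat_rank Mstar = r" "singular_value r Mstar = s" "fro_norm Mstar = m" for n Mstar
    using psd_factorization[OF that(1,2) assms(3)] that(3,4) False fro_norm_nonneg[of Mstar] by metis
  then show ?thesis by (intro exI[of _ 1]) auto
next
  case True
  show ?thesis
  proof (rule approximate_second_order_point_near_minimum[OF assms conjunct1[OF True] conjunct2[OF True]])
    fix lam1 :: real
    assume lam1: "0 < lam1" and near: "\<And>n f Z U lam. twice_cont_diff n n f \<Longrightarrow> symmetric_gradient n f \<Longrightarrow> RIP n (2 * r) \<delta> f \<Longrightarrow> 0 < n \<Longrightarrow>
      Z \<in> carrier_mat n r \<Longrightarrow> U \<in> carrier_mat n r \<Longrightarrow> gradient n n f (Z * Z\<^sup>T) = 0\<^sub>m n n \<Longrightarrow>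
      (\<And>x. x \<in> carrier_mat r 1 \<Longrightarrow> s * mat_inner x x \<le> mat_inner (Z * x) (Z * x)) \<Longrightarrow>
      fro_norm (Z * Z\<^sup>T) = m \<Longrightarrow> 0 < lam \<Longrightarrow> lam \<le> lam1 \<Longrightarrow>
      fro_norm (gradient n r (\<lambda>U. f (U * U\<^sup>T)) U) \<le> lam \<Longrightarrow>
      - (2 * lam) \<le> lambda_min n r (hessian n r (\<lambda>U. f (U * U\<^sup>T)) U) \<Longrightarrow>
      \<exists>R \<in> carrier_mat r r. R * R\<^sup>T = 1\<^sub>m r \<and> fro_norm (U - Z * R) \<le> \<alpha>"
    show ?thesis
    proof (intro exI[of _ lam1] conjI allI impI)
    show "0 < lam1" by (rule lam1)
    fix n f Mstar lam
    assume "twice_cont_diff n n f \<and> symmetric_gradient n f \<and> RIP n (2 * r) \<delta> f \<and>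
      psd_mat n Mstar \<and> mat_rank Mstar = r \<and> gradient n n f Mstar = 0\<^sub>m n n \<and>
      singular_value r Mstar = s \<and> fro_norm Mstar = m"
    then have tcd: "twice_cont_diff n n f" and sg: "symmetric_gradient n f" and rip: "RIP n (2 * r) \<delta> f"
      and psd: "psd_mat n Mstar" and rk: "mat_rank Mstar = r" and crit: "gradient n n f Mstar = 0\<^sub>m n n"
      and s: "singular_value r Mstar = s" and m: "fro_norm Mstar = m" by auto
    assume lam: "0 < lam \<and> lam \<le> lam1"
    obtain Z where Z: "Z \<in> carrier_mat n r" and MZ: "Mstar = Z * Z\<^sup>T"
      and lb: "\<And>x. x \<in> carrier_mat r 1 \<Longrightarrow> s * mat_inner x x \<le> mat_inner (Z * x) (Z * x)"
      using psd_factorization[OF psd rk assms(3)] s by metis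
    \<comment> \<open>A matrix without columns has rank zero, contrary to
      \<open>1 \<le> r\<close>.\<close>
    have n: "0 < n"
    proof (rule ccontr)
      assume "\<not> 0 < n"
      then have "Mstar \<in> carrier_mat 0 0" using psd by (simp add: psd_mat_def)
      then have "mat_rank Mstar \<le> 0" using vec_space.rank_le_nc[of Mstar 0 0] by simp
      then show False using rk assms(3) by simp
    qed
    show "strict_saddle n r (\<lambda>U. f (U * U\<^sup>T)) \<alpha> lam (2 * lam)"
      unfolding strict_saddle_def
    proof (intro conjI ballI)
      fix U :: "real mat" assume U: "U \<in> carrier_mat n r"
      let ?F = "\<lambda>U. f (U * U\<^sup>T)"
      show "set_dist U (global_minima n r ?F) \<le> ereal \<alpha> \<or> lam \<le> fro_norm (gradient n r ?F U) \<or>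
        lambda_min n r (hessian n r ?F U) \<le> - (2 * lam)"
      proof (rule ccontr)
        \<comment> \<open>The failure of the gradient and eigenvalue alternatives supplies the
          hypotheses of \<open>near\<close>; the minimizer \<open>Z * R\<close> found in this way
          refutes the failure of the distance alternative.\<close>
        assume neg: "\<not> ?thesis"
        then obtain R where R: "R \<in> carrier_mat r r" "R * R\<^sup>T = 1\<^sub>m r" "fro_norm (U - Z * R) \<le> \<alpha>"
          using near[OF tcd sg rip n Z U _ lb, of lam] crit m lam unfolding MZ by auto
        have "Z * R \<in> global_minima n r ?F"
          using global_minimum_rotated_factor[OF tcd rip _ Z _ R(1,2)] crit assms(2) unfolding MZ by simp
        then have "set_dist U (global_minima n r ?F) \<le> ereal (fro_norm (U - Z * R))"
          unfolding set_dist_def by (rule INF_lower)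
        also have "\<dots> \<le> ereal \<alpha>" using R(3) by simp
        finally show False using neg by simp
      qed
    qed (use assms(4) lam in auto)
  qed
  qed
qed

end
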